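(* Let $N\ge2$ be an integer and $\alpha_N^\dagger=\alpha^\dagger\!\left(e^{-2\pi\sqrt{N/3}}\right)$. Then $$\sqrt{\frac{3}{N}}\frac{1}{2\pi}=\sum_{k=0}^\infty\frac{\left(\frac12\right)_k\left(\frac13\right)_k\left(\frac23\right)_k}{(k!)^3}\left(b_N^\dagger k+a_N^\dagger\right)\left(X_N^\dagger\right)^k,$$ where $b_N^\dagger=1-2\alpha_N^\dagger$, $a_N^\dagger=-\frac{1}{\sqrt N}C_N(q)\big|_{q=e^{-2\pi/\sqrt{3N}}}$, and $X_N^\dagger=4\alpha_N^\dagger(1-\alpha_N^\dagger)$.
   Context: Let $a(q)=\sum_{m,n\in\mathbb Z}q^{m^2+mn+n^2}$ and for a positive integer $N$ $$C_N(q)=\frac{1}{a^2(q)a^2(q^N)}\det\begin{pmatrix}a(q)&a(q^N)\\ q\frac{da(q)}{dq}&q\frac{da(q^N)}{dq}\end{pmatrix}.$$ Let $\eta(\tau)=e^{\pi i\tau/12}\prod_{k\ge1}(1-e^{2\pi ik\tau})$ be the Dedekind eta function, and define $\alpha^\dagger$ by $\frac{1}{\alpha^\dagger(e^{2\pi i\tau})}=1+\frac{1}{27}\frac{\eta^{12}(\tau)}{\eta^{12}(3\tau)}$. $(a)_k$ is the Pochhammer symbol. *)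

theory Defs
  imports "HOL-Analysis.Analysis"
begin

text \<open>
  Intended for \<open>norm q < 1\<close>, where the double series converges absolutely.  The exponent is never
  negative, so the integer power is an ordinary power (with \<open>0 powi 0 = 1\<close>).
\<close>
definition cubic_a :: "complex \<Rightarrow> complex" where
  "cubic_a q = (\<Sum>\<^sub>\<infinity>(m, n)\<in>(UNIV :: (int \<times> int) set). q powi (m\<^sup>2 + m * n + n\<^sup>2))"

text \<open>
  In the lower right entry \<open>q \<mapsto> a(q\<^sup>N)\<close> is differentiated as a whole, so that entry equals
  \<open>N q\<^sup>N a'(q\<^sup>N)\<close>.
\<close>
definition cubic_C :: "nat \<Rightarrow> complex \<Rightarrow> complex" where
  "cubic_C N q =
     1 / ((cubic_a q)\<^sup>2 * (cubic_a (q ^ N))\<^sup>2) *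
     det (vector
       [vector [cubic_a q,                cubic_a (q ^ N)],
        vector [q * deriv cubic_a q,      q * deriv (\<lambda>z. cubic_a (z ^ N)) q]] :: complex^2^2)"

definition dedekind_eta :: "complex \<Rightarrow> complex" where
  "dedekind_eta \<tau> =
     exp (pi * \<i> * \<tau> / 12) * prodinf (\<lambda>k. 1 - exp (2 * pi * \<i> * of_nat (Suc k) * \<tau>))"

text \<open>
  The defining identity is stated at \<open>q = exp (2 \<pi> i \<tau>)\<close>; as a function of \<open>q\<close> this uses the
  principal branch \<open>\<tau> = Ln q / (2 \<pi> i)\<close>.  Lemma \<open>cubic_alpha_exp\<close> below shows that the choice of
  branch is immaterial.
\<close>
definition cubic_alpha :: "complex \<Rightarrow> complex" where
  "cubic_alpha q =
     (let \<tau> = Ln q / (2 * pi * \<i>)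
      in 1 / (1 + 1 / 27 * (dedekind_eta \<tau> ^ 12 / dedekind_eta (3 * \<tau>) ^ 12)))"

lemma dedekind_eta_quotient:
  "dedekind_eta \<tau> ^ 12 / dedekind_eta (3 * \<tau>) ^ 12 =
     (let q = exp (2 * pi * \<i> * \<tau>)
      in prodinf (\<lambda>k. 1 - q ^ Suc k) ^ 12 / prodinf (\<lambda>k. 1 - (q ^ 3) ^ Suc k) ^ 12 / q)"
proof -
  have eta12: "dedekind_eta z ^ 12 =
      exp (pi * \<i> * z) * prodinf (\<lambda>k. 1 - exp (2 * pi * \<i> * z) ^ Suc k) ^ 12" for z
  proof -
    have "exp (pi * \<i> * z / 12) ^ 12 = exp (pi * \<i> * z)"
      by (simp flip: exp_of_nat_mult)
    moreover have "exp (2 * pi * \<i> * of_nat (Suc k) * z) = exp (2 * pi * \<i> * z) ^ Suc k" for k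
      by (subst exp_of_nat_mult [symmetric]) (simp only: mult_ac)
    ultimately show ?thesis
      by (simp only: dedekind_eta_def power_mult_distrib)
  qed
  have "exp (2 * pi * \<i> * (3 * \<tau>)) = exp (2 * pi * \<i> * \<tau>) ^ 3"
    by (subst exp_of_nat_mult [symmetric]) (simp add: mult_ac)
  moreover have "exp (pi * \<i> * (3 * \<tau>)) = exp (pi * \<i> * \<tau>) * exp (2 * pi * \<i> * \<tau>)"
    by (subst exp_add [symmetric]) (simp add: algebra_simps)
  ultimately show ?thesis
    unfolding eta12 Let_def by (simp add: field_simps)
qed

lemma cubic_alpha_exp:
  "1 / cubic_alpha (exp (2 * pi * \<i> * \<tau>)) =
     1 + 1 / 27 * (dedekind_eta \<tau> ^ 12 / dedekind_eta (3 * \<tau>) ^ 12)"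
  unfolding cubic_alpha_def Let_def dedekind_eta_quotient by simp

end

theory Submission
  imports Defs "HOL-Complex_Analysis.Complex_Analysis" "HOL-Probability.Characteristic_Functions"
begin

text \<open>
  The functions \<open>a\<close>, \<open>b\<^sup>3\<close>, \<open>c\<^sup>3\<close> transform under the Fricke involution \<open>\<tau> \<mapsto> - 1 / (3 \<tau>)\<close>: for \<open>a\<close>
  this is Poisson summation, for the eta quotients it follows from Poisson summation and the pentagonal
  number theorem. The group generated by this involution and \<open>\<tau> \<mapsto> \<tau> + 1\<close> has one cusp and a fundamental
  domain bounded away from the real line, so by the maximum principle a holomorphic function of \<open>q\<close> on the
  unit disc that is invariant under it is constant. Dividing weight 6 expressions by \<open>b\<^sup>3 c\<^sup>3\<close> gives the
  three identities \<open>a\<^sup>3 = b\<^sup>3 + c\<^sup>3\<close>, \<open>\<theta> log (c\<^sup>3 / b\<^sup>3) = a\<^sup>2\<close> and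
  \<open>a \<theta>\<^sup>2a - 2 (\<theta>a)\<^sup>2 = 2/9 b\<^sup>3 c\<^sup>3\<close>, where \<open>\<theta> = q d/dq\<close>. They imply that \<open>a\<^sup>2\<close>, as a function of
  \<open>X = 4 \<alpha> (1 - \<alpha>)\<close>, satisfies the hypergeometric equation of order three, hence equals the series
  near \<open>q = 0\<close> and, by analytic continuation, up to the fixed point \<open>q = exp (- 2 \<pi> / \<surd>3)\<close> of the
  involution. Differentiating this relation and the transformation law of \<open>a\<close> gives the theorem.
\<close>

section \<open>Poisson summation for Gaussians\<close>

text \<open>The numbers q = exp (- 2 pi sqrt (N/3)) and p = exp (- 2 pi / sqrt (3 N)) are nomes
  exchanged by the involution, and moreover p^N = q. So \<open>cubic_C\<close> at p involves only
  the values of a and \<theta>a at p and q, and the transformation law expresses those at p by those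
  at q. Differentiating that law also differentiates its weight factor; this extra term is where
  1/pi comes from. In the series the factor k brings in \<theta>a, and a_N contains exactly what
  cancels it.

  The involution fixes exp (- 2 pi / sqrt 3), where X = 1; N >= 2 puts q strictly below that point,
  hence X inside the disc of convergence.

  The constancy argument wants weight 6 and a zero at the cusp. The identities for a^3 (weight 3)
  and a^2 (weight 2) are therefore proved for the square and the cube of the difference of their two
  sides: these vanish to order at least 2 at the cusp, b^3 c^3 only to order 1, so the constant
  quotient is 0. Only the third identity needs an actual coefficient, and for this a(0) and a'(0)
  suffice.\<close>

lemma summable_on_power_abs_int:
  fixes r :: real
  assumes "0 \<le> r" "r < 1"
  shows "(\<lambda>m::int. r ^ nat \<bar>m\<bar>) summable_on UNIV"
proof -
  have geo: "(\<lambda>n::nat. r ^ n) summable_on UNIV"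
    using assms by (intro norm_summable_imp_summable_on) (auto simp: norm_power)
  have 1: "(\<lambda>m::int. r ^ nat \<bar>m\<bar>) summable_on range int"
    by (subst summable_on_reindex) (use geo in \<open>auto simp: o_def\<close>)
  have 2: "(\<lambda>m::int. r ^ nat \<bar>m\<bar>) summable_on range (\<lambda>n. - int n)"
    by (subst summable_on_reindex) (use geo in \<open>auto simp: o_def inj_on_def\<close>)
  have "(\<lambda>m::int. r ^ nat \<bar>m\<bar>) summable_on range int \<union> range (\<lambda>n. - int n)"
    using 1 2 by (rule summable_on_union)
  moreover have "range int \<union> range (\<lambda>n. - int n) = UNIV"
  proof -
    have "m \<in> range int \<union> range (\<lambda>n. - int n)" for m by (cases m rule: int_cases2) auto
    then show ?thesis by blast
  qed
  ultimately show ?thesis by simp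
qed

lemma abs_le_square_int: "\<bar>m\<bar> \<le> m\<^sup>2" for m :: int
  using self_le_power[of "\<bar>m\<bar>" 2] by (cases "m = 0") auto

lemma summable_on_gauss_int:
  fixes c :: real
  assumes "c > 0"
  shows "(\<lambda>m::int. exp (- c * (of_int m)\<^sup>2)) summable_on UNIV"
proof (rule summable_on_comparison_test)
  show "(\<lambda>m::int. exp (-c) ^ nat \<bar>m\<bar>) summable_on UNIV"
    using assms by (intro summable_on_power_abs_int) auto
  show "exp (- c * (of_int m)\<^sup>2) \<le> exp (-c) ^ nat \<bar>m\<bar>" for m :: int
  proof -
    have "real_of_int \<bar>m\<bar> \<le> (of_int m)\<^sup>2" by (metis abs_le_square_int of_int_le_iff of_int_power)
    then have "- c * (of_int m)\<^sup>2 \<le> real (nat \<bar>m\<bar>) * - c" using assms by simp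
    then show ?thesis by (metis exp_le_cancel_iff exp_of_nat_mult)
  qed
qed auto

lemma square_shift_lower_bound: "(m::real)\<^sup>2 / 2 - x\<^sup>2 \<le> (x + m)\<^sup>2"
proof -
  have "0 \<le> (2 * x + m)\<^sup>2" by simp
  then show ?thesis by (simp add: power2_eq_square algebra_simps)
qed

text \<open>An affine substitution turns the integral into the characteristic function of the
  standard normal distribution; \<open>c\<close> is the scale for which pi s (c y)^2 = y^2 /
  2.\<close>

lemma fourier_gauss:
  fixes s x k :: real
  assumes s: "s > 0"
  defines "\<phi> \<equiv> (\<lambda>t. complex_of_real (exp (- pi * s * (x + t)\<^sup>2)) * cis (- 2 * pi * k * t))"
  shows "integrable lborel \<phi>"
    and "integral\<^sup>L lborel \<phi> = complex_of_real (exp (- pi * k\<^sup>2 / s) / sqrt s) * cis (2 * pi * k * x)"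
proof -
  define c where "c = 1 / sqrt (2 * pi * s)"
  define t where "t = - 2 * pi * k * c"
  have c: "c > 0" using s by (simp add: c_def)
  have c2: "c\<^sup>2 = 1 / (2 * pi * s)" using s by (simp add: c_def power_divide)
  have eq: "\<phi> (- x + c * y) = of_real (sqrt (2 * pi)) * cis (2 * pi * k * x) * (std_normal_density y *\<^sub>R iexp (t * y))" for y
  proof -
    have "pi * s * (c * y)\<^sup>2 = y\<^sup>2 / 2" using s by (simp add: power_mult_distrib c2)
    then have "exp (- pi * s * (c * y)\<^sup>2) = sqrt (2 * pi) * std_normal_density y"
      by (simp add: normal_density_def)
    moreover have "cis (- 2 * pi * k * (- x + c * y)) = cis (2 * pi * k * x) * iexp (t * y)"

      by (simp add: cis_conv_exp t_def algebra_simps flip: exp_add)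
    ultimately show ?thesis by (simp add: \<phi>_def scaleR_conv_of_real)
  qed
  have int: "integrable lborel (\<lambda>y. std_normal_density y *\<^sub>R iexp (t * y))"
  proof (rule Bochner_Integration.integrable_bound)
    show "integrable lborel std_normal_density" by (simp add: integrable_normal_density)
  qed (auto simp: normal_density_def)
  have val: "(\<integral>y. std_normal_density y *\<^sub>R iexp (t * y) \<partial>lborel) = exp (- (t\<^sup>2) / 2)"
    using fun_cong[OF char_std_normal_distribution, of t]
    by (simp add: char_def integral_density)
  have int2: "integrable lborel (\<lambda>y. \<phi> (- x + c * y))"
    unfolding eq by (intro integrable_mult_right int)
  show "integrable lborel \<phi>"
    using lborel_integrable_real_affine_iff[of c \<phi> "-x"] c int2 by simp
  have "integral\<^sup>L lborel \<phi> = c *\<^sub>R (\<integral>y. \<phi> (- x + c * y) \<partial>lborel)"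
    using lborel_integral_real_affine[of c \<phi> "-x"] c by simp
  also have "\<dots> = of_real (c * sqrt (2 * pi) * exp (- (t\<^sup>2) / 2)) * cis (2 * pi * k * x)"
    unfolding eq integral_mult_right_zero val by (simp add: scaleR_conv_of_real)
  also have "c * sqrt (2 * pi) = 1 / sqrt s" by (simp add: c_def real_sqrt_mult)
  also have "- (t\<^sup>2) / 2 = - pi * k\<^sup>2 / s"
    using s by (simp add: t_def power_mult_distrib c2) (simp add: power2_eq_square field_simps)
  finally show "integral\<^sup>L lborel \<phi> = complex_of_real (exp (- pi * k\<^sup>2 / s) / sqrt s) * cis (2 * pi * k * x)"
    by simp
qed

section \<open>Pointwise convergence of Fourier series of holomorphic functions\<close>

lemma exp_2pi_minus_one_factor:
  obtains \<phi> where "\<phi> holomorphic_on ball 0 1" "\<And>z. z \<in> ball 0 1 \<Longrightarrow> \<phi> z \<noteq> 0"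
    "\<And>z. z \<in> ball 0 1 \<Longrightarrow> exp (2 * pi * \<i> * z) - 1 = z * \<phi> z"
proof -
  \<comment> \<open>The value at 0 fills the removable singularity; the subtracted fraction is 0 and
    only matches the shape of \<open>pole_theorem\<close>. The zeros of exp (2 pi i z) - 1 are the
    integers, all simple, and 0 is the only one in the ball, so the quotient has no zeros
    there.\<close>
  define \<phi> where "\<phi> = (\<lambda>z. if z = 0 then deriv (\<lambda>z. exp (2 * pi * \<i> * z) - 1) 0
    else (exp (2 * pi * \<i> * z) - 1) / z - (exp (2 * pi * \<i> * 0) - 1) / (z - 0))"
  have "deriv (\<lambda>z. exp (2 * pi * \<i> * z) - 1) 0 = 2 * pi * \<i>"
    by (rule DERIV_imp_deriv) (auto intro!: derivative_eq_intros)
  then have 0: "\<phi> 0 \<noteq> 0" by (simp add: \<phi>_def)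
  have ne: "\<phi> z \<noteq> 0" if z: "z \<in> ball 0 1" for z
  proof
    assume *: "\<phi> z = 0"
    then have "z \<noteq> 0" using 0 by auto
    with * have "exp (2 * pi * \<i> * z) = 1" by (simp add: \<phi>_def)
    then obtain n :: int where n: "Im (2 * pi * \<i> * z) = of_int (2 * n) * pi" "Re (2 * pi * \<i> * z) = 0"
      by (auto simp: exp_eq_1)
    then have "Re z = of_int n" "Im z = 0" by auto
    then have "z = of_int n" by (simp add: complex_eq_iff)
    with z \<open>z \<noteq> 0\<close> show False by simp
  qed
  have hol: "\<phi> holomorphic_on ball 0 1" unfolding \<phi>_def
    by (rule pole_theorem) (auto intro!: holomorphic_intros)
  show ?thesis by (rule that[OF hol ne]) (auto simp: \<phi>_def)
qed

lemma integral_exp_2pi_int: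
  fixes k :: int
  shows "integral {-1/2..1/2} (\<lambda>t. exp (- 2 * pi * \<i> * of_int k * of_real t)) = (if k = 0 then 1 else (0 :: complex))"
proof (cases "k = 0")
  case False
  define A where "A = (\<lambda>z :: complex. exp (- 2 * pi * \<i> * of_int k * z) / (- 2 * pi * \<i> * of_int k))"
  have "((\<lambda>t. exp (- 2 * pi * \<i> * of_int k * of_real t)) has_integral (A (of_real (1/2)) - A (of_real (-1/2)))) {-1/2..1/2}"
    by (rule fundamental_theorem_of_calculus)
       (use False in \<open>auto simp: A_def intro!: has_vector_derivative_real_field derivative_eq_intros\<close>)
  moreover have "A (of_real (1/2)) - A (of_real (-1/2)) = 0"
  proof -
    have "exp (- (pi * \<i> * of_int k)) = exp (pi * \<i> * of_int k)"
      by (rule exp_eq[THEN iffD2], rule exI[of _ "-k"]) (simp add: algebra_simps)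
    then show ?thesis by (simp add: A_def mult_ac)
  qed
  ultimately show ?thesis using False by (simp add: integral_unique)
qed simp

text \<open>One integration by parts against the exponential. Since \<open>g\<close> may fail to be
  periodic, the boundary terms stay, but they too are O(1/k).\<close>

lemma riemann_lebesgue_holomorphic:
  assumes hol: "g holomorphic_on ball 0 1"
  obtains K where "\<And>k::int. k \<noteq> 0 \<Longrightarrow>
    norm (integral {-1/2..1/2} (\<lambda>t. g (of_real t) * exp (- 2 * pi * \<i> * of_int k * of_real t))) \<le> K / \<bar>of_int k\<bar>"
proof -
  have sub: "complex_of_real t \<in> ball 0 1" if "t \<in> {-1/2..1/2}" for t :: real
    using that by (auto simp: abs_if)
  have hol': "deriv g holomorphic_on ball 0 1" using hol by (intro holomorphic_deriv) auto
  have cont: "continuous_on {-1/2..1/2::real} (\<lambda>t. h (of_real t))" if "h holomorphic_on ball 0 1" for h :: "complex \<Rightarrow> complex"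
    by (rule continuous_on_compose2[OF holomorphic_on_imp_continuous_on[OF that]])
       (auto intro!: continuous_intros simp: abs_if)
  have "compact ((\<lambda>t. deriv g (of_real t)) ` {-1/2..1/2::real})"
    by (intro compact_continuous_image cont hol') auto
  then have "\<exists>M. \<forall>t\<in>{-1/2..1/2}. norm (deriv g (of_real t)) \<le> M"
    by (auto simp: bounded_iff dest!: compact_imp_bounded)
  then obtain M where M: "\<And>t. t \<in> {-1/2..1/2} \<Longrightarrow> norm (deriv g (of_real t)) \<le> M"
    by blast
  define e where "e = (\<lambda>(k::int) z. exp (- 2 * pi * \<i> * of_int k * z))"
  have norm_e: "norm (e k (of_real t)) = 1" for k t by (simp add: e_def)
  have "norm (integral {-1/2..1/2} (\<lambda>t. g (of_real t) * e k (of_real t)))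
      \<le> (norm (g (1/2)) + norm (g (-1/2)) + M) / (2 * pi) / \<bar>of_int k\<bar>" if k: "k \<noteq> 0" for k
  proof -
    define c :: complex where "c = - 2 * pi * \<i> * of_int k"
    have c: "c \<noteq> 0" "norm c = 2 * pi * \<bar>of_int k\<bar>" using k by (auto simp: c_def norm_mult)
    have ftc: "((\<lambda>t. deriv g (of_real t) * e k (of_real t) / c + g (of_real t) * e k (of_real t)) has_integral
          (g (of_real (1/2)) * e k (of_real (1/2)) / c - g (of_real (-1/2)) * e k (of_real (-1/2)) / c)) {-1/2..1/2}"
    proof (rule fundamental_theorem_of_calculus)
      fix t :: real assume t: "t \<in> {-1/2..1/2}"
      have "(g has_field_derivative deriv g (of_real t)) (at (of_real t))"
        using hol sub[OF t] by (auto intro: holomorphic_derivI)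
      moreover have "(e k has_field_derivative (c * e k (of_real t))) (at (of_real t))"
        unfolding e_def c_def by (auto intro!: derivative_eq_intros)
      ultimately have "((\<lambda>z. g z * e k z / c) has_field_derivative
          deriv g (of_real t) * e k (of_real t) / c + g (of_real t) * e k (of_real t)) (at (of_real t))"
        using c by (auto intro!: derivative_eq_intros simp: field_simps)
      then show "((\<lambda>t. g (of_real t) * e k (of_real t) / c) has_vector_derivative
          deriv g (of_real t) * e k (of_real t) / c + g (of_real t) * e k (of_real t)) (at t within {-1/2..1/2})"
        by (rule has_vector_derivative_real_field)
    qed simp
    have ce: "continuous_on {-1/2..1/2::real} (\<lambda>t. e k (of_real t))"
      unfolding e_def by (intro continuous_intros)
    have cd: "continuous_on {-1/2..1/2::real} (\<lambda>t. deriv g (of_real t) * e k (of_real t) / c)"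
      using c by (intro continuous_intros cont hol' ce) auto
    have cg: "continuous_on {-1/2..1/2::real} (\<lambda>t. g (of_real t) * e k (of_real t))"
      using c by (intro continuous_intros cont hol ce)
    have "integral {-1/2..1/2} (\<lambda>t. g (of_real t) * e k (of_real t)) =
        g (1/2) * e k (of_real (1/2)) / c - g (-1/2) * e k (of_real (-1/2)) / c
        - integral {-1/2..1/2} (\<lambda>t. deriv g (of_real t) * e k (of_real t) / c)"
      using integral_unique[OF ftc] integral_add[OF integrable_continuous_interval[OF cd] integrable_continuous_interval[OF cg]]
      by (simp add: algebra_simps)
    also have "norm \<dots> \<le> norm (g (1/2)) / norm c + norm (g (-1/2)) / norm c + M / norm c"
    proof -
      have "norm (integral {-1/2..1/2} (\<lambda>t. deriv g (of_real t) * e k (of_real t) / c)) \<le> M / norm c * (1/2 - (-1/2))"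
        by (rule integral_bound[OF _ cd]) (use M in \<open>auto simp: norm_mult norm_divide norm_e divide_right_mono\<close>)
      moreover have "norm (g (1/2) * e k (of_real (1/2)) / c) = norm (g (1/2)) / norm c"
         "norm (g (-1/2) * e k (of_real (-1/2)) / c) = norm (g (-1/2)) / norm c"
        using norm_e by (simp_all only: norm_mult norm_divide mult_1_right)
      ultimately show ?thesis
        by (intro order_trans[OF norm_triangle_ineq4] add_mono) simp_all
    qed
    also have "\<dots> = (norm (g (1/2)) + norm (g (-1/2)) + M) / (2 * pi) / \<bar>of_int k\<bar>"
      unfolding c by (simp add: add_divide_distrib)
    finally show ?thesis .
  qed
  then show ?thesis unfolding e_def by (rule that)
qed

text \<open>
  Dividing \<open>F - F 0\<close> by \<open>exp (2 \<pi> i t) - 1\<close> turns its Fourier coefficients into differences of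
  consecutive Fourier coefficients of the quotient, so the partial sums telescope.
\<close>

lemma fourier_partial_sums_tendsto:
  assumes hol: "F holomorphic_on ball 0 1"
  defines "c \<equiv> (\<lambda>k::int. integral {-1/2..1/2} (\<lambda>t. F (of_real t) * exp (- 2 * pi * \<i> * of_int k * of_real t)))"
  shows "(\<lambda>n. \<Sum>k\<in>{- int n..int n}. c k) \<longlonglongrightarrow> F 0"
proof -
  obtain \<phi> where \<phi>: "\<phi> holomorphic_on ball 0 1" "\<And>z. z \<in> ball 0 1 \<Longrightarrow> \<phi> z \<noteq> 0"
    "\<And>z. z \<in> ball 0 1 \<Longrightarrow> exp (2 * pi * \<i> * z) - 1 = z * \<phi> z"
    using exp_2pi_minus_one_factor by metis
  \<comment> \<open>This is (F z - F 0) / z with its removable singularity filled, again in the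
    shape of \<open>pole_theorem\<close>.\<close>
  define \<psi> where "\<psi> = (\<lambda>z. if z = 0 then deriv F 0 else F z / z - F 0 / (z - 0))"
  have \<psi>: "\<psi> holomorphic_on ball 0 1" unfolding \<psi>_def
    by (rule pole_theorem) (use hol in auto)
  have \<psi>F: "F z = F 0 + z * \<psi> z" if "z \<in> ball 0 1" for z
    by (auto simp: \<psi>_def field_simps)
  define g where "g = (\<lambda>z. \<psi> z / \<phi> z)"
  have g: "g holomorphic_on ball 0 1" unfolding g_def by (intro holomorphic_intros \<psi> \<phi>)
  have Fg: "F z = F 0 + (exp (2 * pi * \<i> * z) - 1) * g z" if "z \<in> ball 0 1" for z
    using \<phi>(2,3)[OF that] \<psi>F[OF that] by (simp add: g_def)
  define G where "G = (\<lambda>k::int. integral {-1/2..1/2} (\<lambda>t. g (of_real t) * exp (- 2 * pi * \<i> * of_int k * of_real t)))"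
  have sub: "complex_of_real t \<in> ball 0 1" if "t \<in> {-1/2..1/2}" for t :: real
    using that by (auto simp: abs_if)
  have cont: "continuous_on {-1/2..1/2::real} (\<lambda>t. g (of_real t))"
    by (rule continuous_on_compose2[OF holomorphic_on_imp_continuous_on[OF g]])
       (auto intro!: continuous_intros simp: abs_if)
  have c: "c k = (if k = 0 then F 0 else 0) + (G (k - 1) - G k)" for k
  proof -
    have "c k = integral {-1/2..1/2} (\<lambda>t. F 0 * exp (- 2 * pi * \<i> * of_int k * of_real t) +
        (g (of_real t) * exp (- 2 * pi * \<i> * of_int (k - 1) * of_real t)
         - g (of_real t) * exp (- 2 * pi * \<i> * of_int k * of_real t)))"
      unfolding c_def
    proof (rule integral_cong)
      fix t :: real assume t: "t \<in> {-1/2..1/2}"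
      have "exp (- 2 * pi * \<i> * of_int (k - 1) * of_real t) = exp (2 * pi * \<i> * t) * exp (- 2 * pi * \<i> * of_int k * of_real t)"
        by (simp add: algebra_simps flip: exp_add)
      then show "F (of_real t) * exp (- 2 * pi * \<i> * of_int k * of_real t) = F 0 * exp (- 2 * pi * \<i> * of_int k * of_real t) +
        (g (of_real t) * exp (- 2 * pi * \<i> * of_int (k - 1) * of_real t)
         - g (of_real t) * exp (- 2 * pi * \<i> * of_int k * of_real t))"
        by (subst Fg[OF sub[OF t]]) (simp add: algebra_simps)
    qed
    also have "\<dots> = F 0 * integral {-1/2..1/2} (\<lambda>t. exp (- 2 * pi * \<i> * of_int k * of_real t)) + (G (k - 1) - G k)"
      unfolding G_def
      by (subst integral_add integral_diff integral_mult_right;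
          (intro integrable_continuous_interval continuous_intros cont)?)+ simp
    finally show ?thesis unfolding integral_exp_2pi_int by simp
  qed
  have sum: "(\<Sum>k\<in>{- int n..int n}. c k) = F 0 + G (- int n - 1) - G (int n)" for n
  proof (induction n)
    case 0 then show ?case by (simp add: c)
  next
    case (Suc n)
    have "{- int (Suc n)..int (Suc n)} = insert (- int n - 1) (insert (int n + 1) {- int n..int n})" by auto
    then show ?case using Suc by (simp add: c) (simp add: add.commute)
  qed
  obtain K where K: "\<And>k. k \<noteq> 0 \<Longrightarrow> norm (G k) \<le> K / \<bar>of_int k\<bar>"
    using riemann_lebesgue_holomorphic[OF g] unfolding G_def by blast
  have K0: "(\<lambda>n. \<bar>K\<bar> / real n) \<longlonglongrightarrow> 0" by (rule lim_const_over_n)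
  have Kle: "K / real m \<le> \<bar>K\<bar> / real n" if "n \<le> m" "n > 0" for m n
    using that by (intro frac_le) auto
  have G1: "(\<lambda>n. G (- int n - 1)) \<longlonglongrightarrow> 0"
  proof (rule Lim_null_comparison[OF _ K0])
    show "\<forall>\<^sub>F n in sequentially. norm (G (- int n - 1)) \<le> \<bar>K\<bar> / real n"
      using eventually_gt_at_top[of 0]
    proof eventually_elim
      case (elim n)
      have "norm (G (- int n - 1)) \<le> K / \<bar>of_int (- int n - 1)\<bar>" by (rule K) auto
      also have "\<bar>real_of_int (- int n - 1)\<bar> = real (n + 1)" by simp
      also have "K / real (n + 1) \<le> \<bar>K\<bar> / real n" by (rule Kle) (use elim in auto)
      finally show ?case .
    qed
  qed
  have G2: "(\<lambda>n. G (int n)) \<longlonglongrightarrow> 0"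
  proof (rule Lim_null_comparison[OF _ K0])
    show "\<forall>\<^sub>F n in sequentially. norm (G (int n)) \<le> \<bar>K\<bar> / real n"
      using eventually_gt_at_top[of 0]
    proof eventually_elim
      case (elim n)
      have "norm (G (int n)) \<le> K / \<bar>of_int (int n)\<bar>" by (rule K) (use elim in auto)
      also have "\<bar>real_of_int (int n)\<bar> = real n" by simp
      also have "K / real n \<le> \<bar>K\<bar> / real n" by (rule Kle) (use elim in auto)
      finally show ?case .
    qed
  qed
  have "(\<lambda>n. F 0 + G (- int n - 1) - G (int n)) \<longlonglongrightarrow> F 0 + 0 - 0"
    by (intro tendsto_intros G1 G2)
  then show ?thesis by (simp add: sum)
qed

text \<open>Fourier series and the pentagonal series arrive as limits of symmetric partial sums;
  this identifies such limits with unconditional sums over the integers.\<close>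

lemma has_sum_int_symmetric_tendsto:
  assumes "(f has_sum S) (UNIV :: int set)"
  shows "(\<lambda>n. \<Sum>k\<in>{- int n..int n}. f k) \<longlonglongrightarrow> S"
proof -
  have "filterlim (\<lambda>n. {- int n..int n}) (finite_subsets_at_top UNIV) sequentially"
    unfolding filterlim_finite_subsets_at_top
  proof (intro allI impI)
    fix X :: "int set" assume X: "finite X \<and> X \<subseteq> UNIV"
    then obtain N where N: "\<forall>x\<in>X. \<bar>x\<bar> \<le> int N"
      by (meson finite_nat_bounded[of "(\<lambda>x. nat \<bar>x\<bar>) ` X"] finite_imageI finite_set_of_finite_funs)
        (metis (no_types, lifting) X abs_ge_zero finite_imageI finite_nat_set_iff_bounded_le imageI int_nat_eq nat_le_iff)
    show "\<forall>\<^sub>F n in sequentially. finite {- int n..int n} \<and> X \<subseteq> {- int n..int n} \<and> {- int n..int n} \<subseteq> UNIV"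
      using eventually_ge_at_top[of N]
    proof eventually_elim
      case (elim n)
      have "x \<in> {- int n..int n}" if "x \<in> X" for x
        using N that elim by (auto simp: abs_le_iff dest!: bspec)
      then show ?case by auto
    qed
  qed
  with assms show ?thesis unfolding has_sum_def by (rule filterlim_compose)
qed

text \<open>The majorant is uniform in \<open>z\<close> on a disc and summable in \<open>m\<close>.
  It feeds the M-test twice: to integrate the theta series termwise, and to see that it is
  holomorphic in the shift.\<close>

lemma norm_gauss_le:
  fixes z :: complex
  assumes "s > 0" "norm z \<le> R"
  shows "norm (exp (- of_real (pi * s) * (z + of_int m)\<^sup>2)) \<le> exp (pi * s * R\<^sup>2) * exp (- (pi * s / 2) * (of_int m)\<^sup>2)"
proof -
  have "(of_int m)\<^sup>2 / 2 - (Re z)\<^sup>2 \<le> (Re z + of_int m)\<^sup>2" by (rule square_shift_lower_bound)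
  moreover have "(Re z)\<^sup>2 + (Im z)\<^sup>2 \<le> R\<^sup>2"
    using assms(2) by (metis cmod_power2 norm_ge_zero power_mono)
  ultimately have "(of_int m)\<^sup>2 / 2 - R\<^sup>2 \<le> Re ((z + of_int m)\<^sup>2)" by (simp add: Re_power2)
  then have "pi * s * ((of_int m)\<^sup>2 / 2 - R\<^sup>2) \<le> pi * s * Re ((z + of_int m)\<^sup>2)"
    using assms by (intro mult_left_mono) auto
  then show ?thesis
    by (simp add: algebra_simps flip: exp_add)
qed

lemma summable_on_gauss_shift:
  fixes z :: complex
  assumes "s > 0"
  shows "(\<lambda>m::int. norm (exp (- of_real (pi * s) * (z + of_int m)\<^sup>2))) summable_on UNIV"
  by (rule Infinite_Sum.abs_summable_on_comparison_test'[OF _ norm_gauss_le[OF assms order_refl]])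
     (use assms in \<open>intro summable_on_cmult_right summable_on_gauss_int, simp\<close>)

text \<open>Unfolding: the exponential has period 1, so the term \<open>m\<close> contributes the
  integral of one and the same function over [m - 1/2, m + 1/2], and these intervals tile the line.
  What remains is the Fourier transform of a single Gaussian.\<close>

lemma theta_fourier_coefficient:
  fixes s x :: real and k :: int
  assumes s: "s > 0"
  shows "integral {-1/2..1/2} (\<lambda>t. (\<Sum>\<^sub>\<infinity>m::int. exp (- of_real (pi * s) * (of_real x + of_real t + of_int m)\<^sup>2)) *
      exp (- 2 * pi * \<i> * of_int k * of_real t))
    = complex_of_real (exp (- pi * (of_int k)\<^sup>2 / s) / sqrt s) * cis (2 * pi * of_int k * x)"
proof -
  define e where "e = (\<lambda>t::real. exp (- 2 * pi * \<i> * of_int k * of_real t))"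
  define h where "h = (\<lambda>m::int. \<lambda>t. exp (- of_real (pi * s) * (of_real x + of_real t + of_int m)\<^sup>2) * e t)"
  define M where "M = (\<lambda>m::int. exp (pi * s * (\<bar>x\<bar> + 1)\<^sup>2) * exp (- (pi * s / 2) * (of_int m)\<^sup>2))"
  have norm_e: "norm (e t) = 1" for t by (simp add: e_def)
  have hM: "norm (h m t) \<le> M m" if "t \<in> {-1/2..1/2}" for m t
  proof -
    have "norm (complex_of_real x + of_real t) \<le> \<bar>x\<bar> + \<bar>t\<bar>"
      by (rule order_trans[OF norm_triangle_ineq]) simp
    also have "\<dots> \<le> \<bar>x\<bar> + 1" using that by auto
    finally show ?thesis unfolding h_def norm_mult norm_e M_def
      by (subst mult_1_right) (rule norm_gauss_le[OF s])
  qed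
  have Ms: "M summable_on UNIV" unfolding M_def
    using s by (intro summable_on_cmult_right summable_on_gauss_int) auto
  have ul: "uniform_limit {-1/2..1/2} (\<lambda>X t. \<Sum>m\<in>X. h m t) (\<lambda>t. \<Sum>\<^sub>\<infinity>m. h m t) (finite_subsets_at_top UNIV)"
    by (rule Weierstrass_m_test_general[OF _ Ms]) (rule hM)
  have ch: "continuous_on {-1/2..1/2} (h m)" for m
    unfolding h_def e_def by (intro continuous_intros)
  obtain I J where I: "\<And>X. ((\<lambda>t. \<Sum>m\<in>X. h m t) has_integral I X) {-1/2..1/2}"
    and J: "((\<lambda>t. \<Sum>\<^sub>\<infinity>m. h m t) has_integral J) {-1/2..1/2}"
    and IJ: "(I \<longlongrightarrow> J) (finite_subsets_at_top UNIV)"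
    using uniform_limit_integral[OF ul continuous_on_sum[OF ch] finite_subsets_at_top_neq_bot] by blast
  define \<phi> where "\<phi> = (\<lambda>t. complex_of_real (exp (- pi * s * (x + t)\<^sup>2)) * cis (- 2 * pi * of_int k * t))"
  have c\<phi>: "continuous_on S \<phi>" for S unfolding \<phi>_def by (intro continuous_intros)
  have e_shift: "e (of_int m + t) = e t" for m t
  proof -
    have "exp (- 2 * pi * \<i> * of_int (k * m)) = 1"
      using exp_integer_2pi[of "of_int (- (k * m))"] by (simp add: mult_ac)
    moreover have "- 2 * pi * \<i> * of_int k * of_real (of_int m + t) =
        - 2 * pi * \<i> * of_int (k * m) + - 2 * pi * \<i> * of_int k * of_real t"
      by (simp add: algebra_simps)
    ultimately show ?thesis unfolding e_def by (simp only: exp_add mult_1_left)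
  qed
  have h\<phi>: "h m t = \<phi> (of_int m + t)" for m t
  proof -
    have "cis (- 2 * pi * of_int k * (of_int m + t)) = e (of_int m + t)" by (simp add: e_def cis_conv_exp mult_ac)
    moreover have "complex_of_real (exp (- pi * s * (x + (of_int m + t))\<^sup>2)) = exp (- of_real (pi * s) * (of_real x + of_real t + of_int m)\<^sup>2)"
      by (simp add: exp_of_real[symmetric] add_ac)
    ultimately show ?thesis unfolding \<phi>_def h_def e_shift by simp
  qed
  define d where "d = (\<lambda>m. integral {-1/2 + of_int m..1/2 + of_int m} \<phi>)"
  have hd: "integral {-1/2..1/2} (h m) = d m" for m
    using integral_shift_Icc_real[of "-1/2" "1/2" \<phi> "of_int m"] unfolding d_def
    by (simp add: h\<phi>[abs_def] o_def)
  have "I X = (\<Sum>m\<in>X. d m)" if "finite X" for X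
  proof -
    have "I X = integral {-1/2..1/2} (\<lambda>t. \<Sum>m\<in>X. h m t)" using integral_unique[OF I[of X]] by simp
    also have "\<dots> = (\<Sum>m\<in>X. integral {-1/2..1/2} (h m))"
      using that ch by (intro integral_sum integrable_continuous_interval)
    finally show ?thesis by (simp only: hd)
  qed
  then have dJ: "(d has_sum J) UNIV"
    unfolding has_sum_def
    by (intro Lim_transform_eventually[OF IJ] eventually_finite_subsets_at_top_weakI) auto
  have sumd: "(\<Sum>m\<in>{- int n..int n}. d m) = integral {-1/2 - real n..1/2 + real n} \<phi>" for n
  proof (induction n)
    case (Suc n)
    have "{- int (Suc n)..int (Suc n)} = insert (- int n - 1) (insert (int n + 1) {- int n..int n})" by auto
    then have "(\<Sum>m\<in>{- int (Suc n)..int (Suc n)}. d m) =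
        d (- int n - 1) + integral {-1/2 - real n..1/2 + real n} \<phi> + d (int n + 1)"
      using Suc by (simp add: add_ac)
    also have "d (- int n - 1) = integral {-1/2 - real (Suc n)..-1/2 - real n} \<phi>"
      unfolding d_def by (rule arg_cong2[where f = integral]) (auto simp: algebra_simps)
    also have "d (int n + 1) = integral {1/2 + real n..1/2 + real (Suc n)} \<phi>"
      unfolding d_def by (rule arg_cong2[where f = integral]) (auto simp: algebra_simps)
    also have "integral {-1/2 - real (Suc n)..-1/2 - real n} \<phi> + integral {-1/2 - real n..1/2 + real n} \<phi>
       = integral {-1/2 - real (Suc n)..1/2 + real n} \<phi>"
      by (rule Henstock_Kurzweil_Integration.integral_combine) (auto intro!: integrable_continuous_interval c\<phi>)
    also have "\<dots> + integral {1/2 + real n..1/2 + real (Suc n)} \<phi> = integral {-1/2 - real (Suc n)..1/2 + real (Suc n)} \<phi>"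
      by (rule Henstock_Kurzweil_Integration.integral_combine) (auto intro!: integrable_continuous_interval c\<phi>)
    finally show ?case .
  qed (simp add: d_def)
  define G where "G = complex_of_real (exp (- pi * (of_int k)\<^sup>2 / s) / sqrt s) * cis (2 * pi * of_int k * x)"
  have "(\<phi> has_integral G) UNIV"
    using has_integral_integral_lborel[OF fourier_gauss(1)[OF s, of x "of_int k"]]
    unfolding fourier_gauss(2)[OF s] \<phi>_def G_def by simp
  then have lim: "\<forall>e>0. \<exists>B>0. \<forall>a b. ball 0 B \<subseteq> cbox a b \<longrightarrow> norm (integral (cbox a b) \<phi> - G) < e"
    unfolding has_integral_alt' by simp
  have "(\<lambda>n. integral {-1/2 - real n..1/2 + real n} \<phi>) \<longlonglongrightarrow> G"
  proof (rule LIMSEQ_I)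
    fix r :: real assume "r > 0"
    then obtain B where B: "\<And>a b. ball 0 B \<subseteq> cbox a b \<Longrightarrow> norm (integral (cbox a b) \<phi> - G) < r"
      using lim by blast
    obtain N where N: "B \<le> real N" using real_arch_simple by blast
    show "\<exists>no. \<forall>n\<ge>no. norm (integral {-1/2 - real n..1/2 + real n} \<phi> - G) < r"
    proof (intro exI allI impI)
      fix n assume "n \<ge> N"
      then have "ball 0 B \<subseteq> cbox (-1/2 - real n) (1/2 + real n)"
        using N by (auto simp: abs_le_iff abs_less_iff)
      from B[OF this] show "norm (integral {-1/2 - real n..1/2 + real n} \<phi> - G) < r" by simp
    qed
  qed
  with has_sum_int_symmetric_tendsto[OF dJ] have "J = G" unfolding sumd by (rule LIMSEQ_unique)
  moreover have "(\<Sum>\<^sub>\<infinity>m. h m t) = (\<Sum>\<^sub>\<infinity>m::int. exp (- of_real (pi * s) * (of_real x + of_real t + of_int m)\<^sup>2)) * e t" for t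
    unfolding h_def by (rule infsum_cmult_left) (use abs_summable_summable[OF summable_on_gauss_shift[OF s]] in blast)
  ultimately show ?thesis using integral_unique[OF J] unfolding e_def G_def by simp
qed

text \<open>As a function of a complex shift the theta series is holomorphic, so its Fourier partial
  sums at 0 converge to its value there; Gaussian decay of the coefficients makes the sum
  unconditional. The real shift \<open>x\<close> is kept because the applications sum over cosets of
  the integers: halves for a, twelfths for eta.\<close>

theorem theta_transform:
  fixes s x :: real
  assumes s: "s > 0"
  shows "((\<lambda>k::int. complex_of_real (exp (- pi * (of_int k)\<^sup>2 / s) / sqrt s) * cis (2 * pi * of_int k * x)) has_sum
    (\<Sum>\<^sub>\<infinity>m::int. complex_of_real (exp (- pi * s * (x + of_int m)\<^sup>2)))) UNIV"
proof -
  define F where "F = (\<lambda>z::complex. \<Sum>\<^sub>\<infinity>m::int. exp (- of_real (pi * s) * (of_real x + z + of_int m)\<^sup>2))"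
  define c where "c = (\<lambda>k::int. complex_of_real (exp (- pi * (of_int k)\<^sup>2 / s) / sqrt s) * cis (2 * pi * of_int k * x))"
  define M where "M = (\<lambda>m::int. exp (pi * s * (\<bar>x\<bar> + 1)\<^sup>2) * exp (- (pi * s / 2) * (of_int m)\<^sup>2))"
  have "norm (exp (- of_real (pi * s) * (of_real x + z + of_int m)\<^sup>2)) \<le> M m" if "z \<in> cball 0 1" for m and z :: complex
  proof -
    have "norm (complex_of_real x + z) \<le> \<bar>x\<bar> + norm z"
      by (rule order_trans[OF norm_triangle_ineq]) simp
    also have "\<dots> \<le> \<bar>x\<bar> + 1" using that by auto
    finally show ?thesis unfolding M_def by (rule norm_gauss_le[OF s])
  qed
  moreover have "M summable_on UNIV" unfolding M_def
    using s by (intro summable_on_cmult_right summable_on_gauss_int) auto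
  ultimately have ul: "uniform_limit (cball 0 1) (\<lambda>X z. \<Sum>m\<in>X. exp (- of_real (pi * s) * (of_real x + z + of_int m)\<^sup>2)) F (finite_subsets_at_top UNIV)"
    unfolding F_def by (intro Weierstrass_m_test_general)
  have F: "F holomorphic_on ball 0 1"
    by (rule holomorphic_uniform_limit[OF _ ul]) (auto intro!: always_eventually holomorphic_intros continuous_intros)
  have "integral {-1/2..1/2} (\<lambda>t. F (of_real t) * exp (- 2 * pi * \<i> * of_int k * of_real t)) = c k" for k
    using theta_fourier_coefficient[OF s, of x k] by (simp only: F_def c_def)
  with fourier_partial_sums_tendsto[OF F] have lim: "(\<lambda>n. \<Sum>k\<in>{- int n..int n}. c k) \<longlonglongrightarrow> F 0" by simp
  have "(\<lambda>k::int. exp (- (pi / s) * (of_int k)\<^sup>2) * (1 / sqrt s)) summable_on UNIV"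
    using s by (intro summable_on_cmult_left summable_on_gauss_int) auto
  moreover have "norm (c k) = exp (- (pi / s) * (of_int k)\<^sup>2) * (1 / sqrt s)" for k
    using s by (simp add: c_def norm_mult norm_divide)
  ultimately have "c summable_on UNIV" by (intro abs_summable_summable[of c]) simp
  then have "(c has_sum infsum c UNIV) UNIV" by simp
  moreover from has_sum_int_symmetric_tendsto[OF this] lim have "infsum c UNIV = F 0" by (rule LIMSEQ_unique)
  moreover have "F 0 = (\<Sum>\<^sub>\<infinity>m::int. complex_of_real (exp (- pi * s * (x + of_int m)\<^sup>2)))"
    unfolding F_def by (rule infsum_cong) (simp add: exp_of_real[symmetric])
  ultimately show ?thesis by (simp add: c_def)
qed

section \<open>The inversion formula for the Dedekind eta function\<close>

definition euler_phi :: "complex \<Rightarrow> complex" where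
  "euler_phi q = prodinf (\<lambda>k. 1 - q ^ Suc k)"

lemma euler_phi_convergent:
  assumes "norm (q::complex) < 1"
  shows "convergent_prod (\<lambda>k. 1 - q ^ Suc k)"
proof -
  have "summable (\<lambda>k. norm q * norm q ^ k)" using assms by (intro summable_mult summable_geometric) auto
  then have "summable (\<lambda>k. norm (q ^ Suc k))" by (simp add: norm_mult norm_power)
  then have "abs_convergent_prod (\<lambda>k. 1 + (- (q ^ Suc k)))"
    by (intro summable_imp_abs_convergent_prod) simp
  then show ?thesis by (intro abs_convergent_prod_imp_convergent_prod) simp
qed

lemma one_minus_power_Suc_nonzero:
  assumes "norm (q::complex) < 1"
  shows "1 - q ^ Suc k \<noteq> 0"
proof
  assume "1 - q ^ Suc k = 0"
  then have "norm (q ^ Suc k) = 1" by simp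
  moreover have "norm q ^ Suc k \<le> norm q ^ 1" using assms by (intro power_decreasing) auto
  ultimately show False using assms by (simp add: norm_power del: power_Suc)
qed

lemma euler_phi_nonzero: "norm q < 1 \<Longrightarrow> euler_phi q \<noteq> 0"
  unfolding euler_phi_def by (intro prodinf_nonzero euler_phi_convergent one_minus_power_Suc_nonzero)

lemma euler_phi_0 [simp]: "euler_phi 0 = 1" by (simp add: euler_phi_def)

lemma euler_phi_LIMSEQ:
  assumes "norm q < 1"
  shows "(\<lambda>n. \<Prod>k<n. 1 - q ^ Suc k) \<longlonglongrightarrow> euler_phi q"
proof -
  have "(\<lambda>n. \<Prod>k\<le>n. 1 - q ^ Suc k) \<longlonglongrightarrow> euler_phi q"
    unfolding euler_phi_def by (rule convergent_prod_LIMSEQ[OF euler_phi_convergent[OF assms]])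
  then show ?thesis by (subst filterlim_sequentially_Suc[symmetric]) (simp add: lessThan_Suc_atMost del: power_Suc)
qed

lemma euler_phi_holomorphic: "euler_phi holomorphic_on ball 0 1"
proof (rule holomorphic_uniform_sequence[where f = "\<lambda>n q. \<Prod>k<n. 1 - q ^ Suc k"])
  fix q :: complex assume "q \<in> ball 0 1"
  then obtain d where d: "d > 0" "cball q d \<subseteq> ball 0 1" using open_contains_cball open_ball by metis
  obtain r where r: "r < 1" "\<And>z. z \<in> cball q d \<Longrightarrow> norm z \<le> r" "0 \<le> r"
  proof -
    have "continuous_on (cball q d) norm" by (intro continuous_intros)
    then obtain z where "z \<in> cball q d" "\<And>w. w \<in> cball q d \<Longrightarrow> norm w \<le> norm z"
      using continuous_attains_sup[of "cball q d" norm] d(1) by auto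
    then show thesis using d by (intro that[of "norm z"]) auto
  qed
  have "uniformly_convergent_on (cball q d) (\<lambda>n z. \<Sum>k<n. norm ((1 - z ^ Suc k) - 1))"
  proof (rule Weierstrass_m_test')
    show "summable (\<lambda>k. r * r ^ k)" using r by (intro summable_mult summable_geometric) auto
    show "norm (norm ((1 - z ^ Suc k) - 1)) \<le> r * r ^ k" if "z \<in> cball q d" for k z
      using r(2)[OF that] power_mono[of "norm z" r "Suc k"] by (simp add: norm_mult norm_power)
  qed
  then have "uniformly_convergent_on (cball q d) (\<lambda>n z. \<Prod>k<n. 1 - z ^ Suc k)"
    by (intro uniformly_convergent_on_prod') (auto intro!: continuous_intros)
  then have "uniform_limit (cball q d) (\<lambda>n z. \<Prod>k<n. 1 - z ^ Suc k) (\<lambda>z. lim (\<lambda>n. \<Prod>k<n. 1 - z ^ Suc k)) sequentially"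
    by (simp only: uniformly_convergent_uniform_limit_iff)
  moreover have "lim (\<lambda>n. \<Prod>k<n. 1 - z ^ Suc k) = euler_phi z" if "z \<in> cball q d" for z
    using that d by (intro limI euler_phi_LIMSEQ) auto
  ultimately have "uniform_limit (cball q d) (\<lambda>n z. \<Prod>k<n. 1 - z ^ Suc k) euler_phi sequentially"
    by (subst (asm) uniform_limit_cong'[where g = "\<lambda>n z. \<Prod>k<n. 1 - z ^ Suc k" and i = euler_phi]) auto
  then show "\<exists>d>0. cball q d \<subseteq> ball 0 1 \<and> uniform_limit (cball q d) (\<lambda>n z. \<Prod>k<n. 1 - z ^ Suc k) euler_phi sequentially"
    using d by blast
qed (auto intro!: holomorphic_intros)

text \<open>
  Shanks' finite form of Euler's pentagonal number theorem: the summand \<open>k\<close> on the right carries the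
  exponents \<open>j (3 j + 1) / 2\<close> for \<open>j = k\<close> and \<open>j = - k\<close>.
\<close>

lemma shanks_identity:
  fixes q :: complex
  assumes "norm q < 1"
  defines "P \<equiv> \<lambda>n. \<Prod>k<n. 1 - q ^ Suc k"
  shows "(\<Sum>s\<le>n. (-1) ^ s * P n / P s * q ^ (s * n + (\<Sum>{..s}))) =
    1 + (\<Sum>k=1..n. (-1) ^ k * (q ^ (k * k + (\<Sum>{..k})) + q ^ (k * k + (\<Sum>{..<k}))))"
proof (induction n)
  case (Suc n)
  have P_Suc: "P (Suc k) = P k * (1 - q ^ Suc k)" for k by (simp add: P_def)
  have P0: "P k \<noteq> 0" for k unfolding P_def using one_minus_power_Suc_nonzero[OF assms(1)] by simp
  have q0: "1 - q ^ Suc k \<noteq> 0" for k by (rule one_minus_power_Suc_nonzero[OF assms(1)])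
  \<comment> \<open>Passing from n to n + 1 changes each partial sum only by a boundary term. At m =
    n this boundary term and the new summand s = n + 1 are the two powers of q in the summand k = n
    + 1 on the right.\<close>
  have tel: "(\<Sum>s\<le>m. (-1) ^ s * P (Suc n) / P s * q ^ (s * Suc n + (\<Sum>{..s}))) =
     (\<Sum>s\<le>m. (-1) ^ s * P n / P s * q ^ (s * n + (\<Sum>{..s}))) - (-1) ^ m * P n / P m * q ^ (Suc m * Suc n + (\<Sum>{..m}))" for m
  proof (induction m)
    case 0
    then show ?case by (simp add: P_Suc) (simp add: P_def algebra_simps)
  next
    case (Suc m)
    define Q where "Q = q ^ (Suc m * Suc n + \<Sum>{..m})"
    have e1: "q ^ (Suc m * Suc n + \<Sum>{..Suc m}) = Q * q ^ Suc m"
      by (simp add: Q_def power_add mult_ac)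
    have e2: "q ^ (Suc m * n + \<Sum>{..Suc m}) = Q"
      by (simp add: Q_def power_add mult_ac)
    have e3: "q ^ (Suc (Suc m) * Suc n + \<Sum>{..Suc m}) = Q * q ^ Suc m * q ^ Suc n"
      by (simp add: Q_def power_add mult_ac)
    have Pm: "P m = P (Suc m) / (1 - q ^ Suc m)" using q0[of m] P_Suc[of m] by (simp add: field_simps)
    have "S - (-1) ^ m * p / (p' / (1 - a)) * Q + (-1) ^ Suc m * (p * (1 - b)) / p' * (Q * a) =
        S + (-1) ^ Suc m * p / p' * Q - (-1) ^ Suc m * p / p' * (Q * a * b)"
      if "p' \<noteq> 0" "1 - a \<noteq> 0" for S p p' a b :: complex
      using that by (simp add: field_simps)
    note alg = this[OF P0[of "Suc m"] q0[of m], folded Pm P_Suc]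
    define f where "f = (\<lambda>s. (-1) ^ s * P (Suc n) / P s * q ^ (s * Suc n + (\<Sum>{..s})))"
    define g where "g = (\<lambda>s. (-1) ^ s * P n / P s * q ^ (s * n + (\<Sum>{..s})))"
    have "sum f {..m} = sum g {..m} - (-1) ^ m * P n / P m * Q"
      using Suc.IH by (simp only: f_def g_def Q_def)
    moreover have "f (Suc m) = (-1) ^ Suc m * P (Suc n) / P (Suc m) * (Q * q ^ Suc m)"
      by (simp only: f_def e1)
    moreover have "g (Suc m) = (-1) ^ Suc m * P n / P (Suc m) * Q"
      by (simp only: g_def e2)
    ultimately have "sum f {..Suc m} = sum g {..Suc m} - (-1) ^ Suc m * P n / P (Suc m) * (Q * q ^ Suc m * q ^ Suc n)"
      using alg[of "sum g {..m}" "P n" "q ^ Suc n", folded P_Suc] by (simp only: sum.atMost_Suc)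
    then show ?case by (simp only: f_def g_def e3)
  qed
  have "(\<Sum>s\<le>Suc n. (-1) ^ s * P (Suc n) / P s * q ^ (s * Suc n + (\<Sum>{..s}))) =
      (\<Sum>s\<le>n. (-1) ^ s * P n / P s * q ^ (s * n + (\<Sum>{..s}))) - (-1) ^ n * q ^ (Suc n * Suc n + (\<Sum>{..n}))
      + (-1) ^ Suc n * q ^ (Suc n * Suc n + (\<Sum>{..Suc n}))"
    using P0[of n] P0[of "Suc n"]
    by (subst sum.atMost_Suc, subst tel) (simp only: nonzero_mult_div_cancel_right)
  then show ?case
    unfolding Suc.IH by (simp add: lessThan_Suc_atMost algebra_simps)
qed (simp add: P_def)

text \<open>On the left of \<open>shanks_identity\<close> the summand s = 0 is the partial product
  itself. All others carry q^(s n) with s >= 1, and the partial products and their inverses are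
  bounded, so together they are O(n |q|^n).\<close>

theorem pentagonal_number_theorem:
  fixes q :: complex
  assumes q: "norm q < 1"
  shows "(\<lambda>n. 1 + (\<Sum>k=1..n. (-1) ^ k * (q ^ (k * k + (\<Sum>{..k})) + q ^ (k * k + (\<Sum>{..<k}))))) \<longlonglongrightarrow> euler_phi q"
proof -
  define P where "P = (\<lambda>n. \<Prod>k<n. 1 - q ^ Suc k)"
  have P: "P \<longlonglongrightarrow> euler_phi q" unfolding P_def by (rule euler_phi_LIMSEQ[OF q])
  then have "(\<lambda>n. inverse (P n)) \<longlonglongrightarrow> inverse (euler_phi q)" by (intro tendsto_inverse euler_phi_nonzero q)
  then obtain C2 where C2: "\<And>n. norm (inverse (P n)) \<le> C2"
    by (metis Bseq_def convergentI convergent_imp_Bseq)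
  obtain C1 where C1: "\<And>n. norm (P n) \<le> C1"
    by (metis P Bseq_def convergentI convergent_imp_Bseq)
  have pos: "C1 \<ge> 0" "C2 \<ge> 0" using C1[of 0] C2[of 0] norm_ge_zero order_trans by blast+
  have bound: "norm (\<Sum>s=1..n. (-1) ^ s * P n / P s * q ^ (s * n + (\<Sum>{..s}))) \<le> C1 * C2 * (real n * norm q ^ n)" for n
  proof -
    have "norm (\<Sum>s=1..n. (-1) ^ s * P n / P s * q ^ (s * n + (\<Sum>{..s}))) \<le> (\<Sum>s=1..n. C1 * C2 * norm q ^ n)"
    proof (rule sum_norm_le)
      fix s assume s: "s \<in> {1..n}"
      have "norm ((-1) ^ s * P n / P s * q ^ (s * n + (\<Sum>{..s}))) =
          norm (P n) * norm (inverse (P s)) * norm q ^ (s * n + (\<Sum>{..s}))"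
        by (simp add: norm_mult norm_power norm_divide norm_inverse divide_inverse)
      also have "\<dots> \<le> C1 * C2 * norm q ^ n"
        using s q pos by (intro mult_mono C1 C2 power_decreasing) (auto simp: trans_le_add1)
      finally show "norm ((-1) ^ s * P n / P s * q ^ (s * n + (\<Sum>{..s}))) \<le> C1 * C2 * norm q ^ n" .
    qed
    then show ?thesis by (simp add: mult_ac)
  qed
  have "(\<lambda>n. real n * norm q ^ n) \<longlonglongrightarrow> 0" using q by (intro powser_times_n_limit_0) simp
  then have "(\<lambda>n. C1 * C2 * (real n * norm q ^ n)) \<longlonglongrightarrow> 0" by (rule tendsto_mult_right_zero)
  then have "(\<lambda>n. \<Sum>s=1..n. (-1) ^ s * P n / P s * q ^ (s * n + (\<Sum>{..s}))) \<longlonglongrightarrow> 0"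
    by (rule Lim_null_comparison[rotated]) (use bound in auto)
  from tendsto_add[OF P this] have "(\<lambda>n. P n + (\<Sum>s=1..n. (-1) ^ s * P n / P s * q ^ (s * n + (\<Sum>{..s})))) \<longlonglongrightarrow> euler_phi q"
    by simp
  moreover have "P n + (\<Sum>s=1..n. (-1) ^ s * P n / P s * q ^ (s * n + (\<Sum>{..s}))) =
      1 + (\<Sum>k=1..n. (-1) ^ k * (q ^ (k * k + (\<Sum>{..k})) + q ^ (k * k + (\<Sum>{..<k}))))" for n
  proof -
    have "{..n} = insert 0 {1..n}" by auto
    then have "(\<Sum>s\<le>n. (-1) ^ s * P n / P s * q ^ (s * n + (\<Sum>{..s}))) =
       P n + (\<Sum>s=1..n. (-1) ^ s * P n / P s * q ^ (s * n + (\<Sum>{..s})))" by (simp add: P_def)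
    then show ?thesis using shanks_identity[OF q, of n] unfolding P_def by simp
  qed
  ultimately show ?thesis by simp
qed

section \<open>Eta on the imaginary axis as a theta series\<close>

definition theta_real :: "real \<Rightarrow> real \<Rightarrow> real" where
  "theta_real s x = (\<Sum>\<^sub>\<infinity>m::int. exp (- pi * s * (x + of_int m)\<^sup>2))"

lemma theta_real_has_sum:
  assumes "s > 0"
  shows "((\<lambda>m::int. exp (- pi * s * (x + of_int m)\<^sup>2)) has_sum theta_real s x) UNIV"
proof -
  have "norm (exp (- of_real (pi * s) * (complex_of_real x + of_int m)\<^sup>2)) = exp (- pi * s * (x + of_int m)\<^sup>2)" for m
    by (simp add: Re_power2)
  with summable_on_gauss_shift[OF assms, of "of_real x"] show ?thesis
    unfolding theta_real_def by simp
qed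

lemma theta_real_transform:
  assumes s: "s > 0"
  shows "((\<lambda>k::int. exp (- pi * (of_int k)\<^sup>2 / s) / sqrt s * cos (2 * pi * of_int k * x)) has_sum theta_real s x) UNIV"
proof -
  have "(\<Sum>\<^sub>\<infinity>m::int. complex_of_real (exp (- pi * s * (x + of_int m)\<^sup>2))) = of_real (theta_real s x)"
    by (intro infsumI has_sum_of_real theta_real_has_sum s)
  with has_sum_Re[OF theta_transform[OF s, of x]] show ?thesis by simp
qed

text \<open>Completing the square in the pentagonal exponent, k (3 k + 1) / 2 + 1/24 = 3/2 (k +
  1/6)^2. With q = exp (- 2 pi y) this is the summand of eta (i y); the 1/24 is the exponent of the
  factor in front of Euler's product.\<close>

definition eta_term :: "real \<Rightarrow> int \<Rightarrow> real" where
  "eta_term y k = (if even k then 1 else - 1) * exp (- 3 * pi * y * (of_int k + 1/6)\<^sup>2)"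

lemma eta_term_summable:
  assumes "y > 0"
  shows "eta_term y summable_on UNIV"
proof -
  have "(\<lambda>m::int. exp (- pi * (3 * y) * (1/6 + of_int m)\<^sup>2)) summable_on UNIV"
    using theta_real_has_sum[of "3 * y" "1/6"] assms by (auto simp: summable_on_def)
  moreover have "norm (eta_term y m) = exp (- pi * (3 * y) * (1/6 + of_int m)\<^sup>2)" for m
    by (simp add: eta_term_def add_ac)
  ultimately show ?thesis by (intro abs_summable_summable[of "eta_term y"]) simp
qed

lemma real_sum_atMost: "real (\<Sum>{..k}) = real k * (real k + 1) / 2"
  by (induction k) (auto simp: field_simps)

lemma real_sum_lessThan: "real (\<Sum>{..<k}) = real k * (real k - 1) / 2"
  by (induction k) (auto simp: field_simps)

lemma euler_phi_eta_term:
  assumes y: "y > 0"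
  shows "of_real (exp (- pi * y / 12)) * euler_phi (of_real (exp (- 2 * pi * y))) = of_real (infsum (eta_term y) UNIV)"
proof -
  define q where "q = exp (- 2 * pi * y)"
  have q: "norm (complex_of_real q) < 1" using y by (simp add: q_def)
  have sum: "(\<Sum>k\<in>{- int n..int n}. eta_term y k) =
     exp (- pi * y / 12) * (1 + (\<Sum>k=1..n. (-1) ^ k * (q ^ (k * k + (\<Sum>{..k})) + q ^ (k * k + (\<Sum>{..<k})))))" for n
  proof (induction n)
    case 0
    have "3 * pi * y * (1/6)\<^sup>2 = pi * y / 12" by (simp add: power2_eq_square)
    then show ?case by (simp add: eta_term_def)
  next
    case (Suc n)
    have "{- int (Suc n)..int (Suc n)} = insert (- int n - 1) (insert (int n + 1) {- int n..int n})" by auto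
    moreover have "eta_term y (int n + 1) = exp (- pi * y / 12) * ((-1) ^ Suc n * q ^ (Suc n * Suc n + (\<Sum>{..Suc n})))"
    proof -
      have "q ^ (Suc n * Suc n + (\<Sum>{..Suc n})) = exp (real (Suc n * Suc n + (\<Sum>{..Suc n})) * (- 2 * pi * y))"
        unfolding q_def exp_of_nat_mult ..
      also have "real (Suc n * Suc n + (\<Sum>{..Suc n})) = (real n + 1)\<^sup>2 + (real n + 1) * (real n + 2) / 2"
        unfolding of_nat_add real_sum_atMost by (simp add: power2_eq_square algebra_simps)
      finally have "exp (- pi * y / 12) * q ^ (Suc n * Suc n + (\<Sum>{..Suc n})) = exp (- 3 * pi * y * (real n + 1 + 1/6)\<^sup>2)"
        by (simp add: power2_eq_square field_simps flip: exp_add)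
      then show ?thesis by (simp add: eta_term_def)
    qed
    moreover have "eta_term y (- int n - 1) = exp (- pi * y / 12) * ((-1) ^ Suc n * q ^ (Suc n * Suc n + (\<Sum>{..<Suc n})))"
    proof -
      have "q ^ (Suc n * Suc n + (\<Sum>{..<Suc n})) = exp (real (Suc n * Suc n + (\<Sum>{..<Suc n})) * (- 2 * pi * y))"
        unfolding q_def exp_of_nat_mult ..
      also have "real (Suc n * Suc n + (\<Sum>{..<Suc n})) = (real n + 1)\<^sup>2 + (real n + 1) * real n / 2"
        unfolding of_nat_add real_sum_lessThan by (simp add: power2_eq_square algebra_simps)
      finally have "exp (- pi * y / 12) * q ^ (Suc n * Suc n + (\<Sum>{..<Suc n})) = exp (- 3 * pi * y * (- real n - 1 + 1/6)\<^sup>2)"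
        by (simp add: power2_eq_square field_simps flip: exp_add)
      then show ?thesis by (simp add: eta_term_def)
    qed
    ultimately show ?case using Suc by (simp add: ring_distribs add_ac)
  qed
  have "(\<lambda>n. of_real (\<Sum>k\<in>{- int n..int n}. eta_term y k) :: complex) \<longlonglongrightarrow> of_real (infsum (eta_term y) UNIV)"
    using eta_term_summable[OF y] by (intro tendsto_of_real has_sum_int_symmetric_tendsto) simp
  moreover have "(\<lambda>n. of_real (\<Sum>k\<in>{- int n..int n}. eta_term y k) :: complex) \<longlonglongrightarrow> of_real (exp (- pi * y / 12)) * euler_phi (of_real q)"
    unfolding sum using tendsto_mult_left[OF pentagonal_number_theorem[OF q]] by simp
  ultimately show ?thesis unfolding q_def by (rule LIMSEQ_unique[symmetric])
qed

text \<open>Splitting by parity removes the alternating sign, so that Poisson summation applies to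
  each class: k = 2 m gives k + 1/6 = 2 (m + 1/12), and k = - 2 m - 1 gives k + 1/6 = - 2 (m +
  5/12).\<close>

lemma eta_term_inverse_eq_theta:
  assumes y: "y > 0"
  shows "infsum (eta_term (1 / y)) UNIV = theta_real (12 / y) (1/12) - theta_real (12 / y) (5/12)"
proof (rule infsumI)
  have s: "12 / y > 0" using y by simp
  have r1: "(eta_term (1 / y) has_sum theta_real (12 / y) (1/12)) (range (\<lambda>m. 2 * m))"
  proof (subst has_sum_reindex)
    have "(of_int (2 * m) + 1/6)\<^sup>2 = 4 * (1/12 + real_of_int m)\<^sup>2" for m
      by (simp add: power2_eq_square field_simps)
    then have "eta_term (1 / y) (2 * m) = exp (- pi * (12 / y) * (1/12 + of_int m)\<^sup>2)" for m
      by (simp add: eta_term_def del: of_int_mult)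
    then show "(eta_term (1 / y) \<circ> (\<lambda>m. 2 * m) has_sum theta_real (12 / y) (1/12)) UNIV"
      using theta_real_has_sum[OF s, of "1/12"] by (simp add: o_def)
  qed (auto simp: inj_on_def)
  have r2: "(eta_term (1 / y) has_sum - theta_real (12 / y) (5/12)) (range (\<lambda>m. - 2 * m - 1))"
  proof (subst has_sum_reindex)
    have "(of_int (- 2 * m - 1) + 1/6)\<^sup>2 = 4 * (5/12 + real_of_int m)\<^sup>2" for m
      by (simp add: power2_eq_square field_simps)
    then have "eta_term (1 / y) (- 2 * m - 1) = - exp (- pi * (12 / y) * (5/12 + of_int m)\<^sup>2)" for m
      by (simp add: eta_term_def del: of_int_mult of_int_diff of_int_minus)
    then show "(eta_term (1 / y) \<circ> (\<lambda>m. - 2 * m - 1) has_sum - theta_real (12 / y) (5/12)) UNIV"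
      using has_sum_uminusI[OF theta_real_has_sum[OF s, of "5/12"]] by (simp add: o_def)
  qed (auto simp: inj_on_def)
  have "2 * m \<noteq> - 2 * n - 1" for m n :: int by presburger
  then have r3: "range (\<lambda>m. 2 * m) \<inter> range (\<lambda>m::int. - 2 * m - 1) = {}" by blast
  have "range (\<lambda>m. 2 * m) \<union> range (\<lambda>m::int. - 2 * m - 1) = UNIV"
  proof -
    have "x \<in> range (\<lambda>m. 2 * m) \<union> range (\<lambda>m::int. - 2 * m - 1)" for x :: int
    proof (cases "even x")
      case False
      then obtain j where "x = 2 * j + 1" by (elim oddE)
      then have "x = - 2 * (- j - 1) - 1" by simp
      then show ?thesis by blast
    qed auto
    then show ?thesis by blast
  qed
  then show "(eta_term (1 / y) has_sum theta_real (12 / y) (1/12) - theta_real (12 / y) (5/12)) UNIV"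
    using has_sum_Un_disjoint[OF r1 r2 r3] by simp
qed

text \<open>
  The Gauss sum of the character mod 12 is \<open>\<surd>12\<close>; here it appears as
  \<open>cos (\<pi> k / 6) - cos (5 \<pi> k / 6)\<close>, which is \<open>\<plusminus>\<surd>3\<close> for \<open>k\<close> coprime to 6 and vanishes otherwise.
\<close>

lemma eta_term_inverse:
  assumes y: "y > 0"
  shows "infsum (eta_term (1 / y)) UNIV = sqrt y * infsum (eta_term y) UNIV"
proof -
  have s: "12 / y > 0" using y by simp
  define w where "w = (\<lambda>k::int. cos (2 * pi * of_int k * (1/12)) - cos (2 * pi * of_int k * (5/12)))"
  define f where "f = (\<lambda>k::int. exp (- pi * (of_int k)\<^sup>2 / (12 / y)) / sqrt (12 / y) * w k)"
  have "(f has_sum theta_real (12 / y) (1/12) - theta_real (12 / y) (5/12)) UNIV"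
    using has_sum_add[OF theta_real_transform[OF s, of "1/12"] has_sum_uminusI[OF theta_real_transform[OF s, of "5/12"]]]
    by (simp add: f_def w_def right_diff_distrib)
  then have 1: "(f has_sum infsum (eta_term (1 / y)) UNIV) UNIV"
    by (simp only: eta_term_inverse_eq_theta[OF y])
  have f_minus: "f (- k) = f k" for k by (simp add: f_def w_def)
  have w1: "w (6 * n + 1) = (if even n then 1 else - 1) * sqrt 3" for n
  proof -
    have "cos (2 * pi * of_int (6 * n + 1) * (1/12)) = cos (pi * of_int n + pi / 6)"
      by (simp add: algebra_simps)
    also have "\<dots> = (if even n then 1 else - 1) * (sqrt 3 / 2)"
      by (simp add: cos_add cos_30 cos_npi_int sin_npi_int)
    finally have a: "cos (2 * pi * of_int (6 * n + 1) * (1/12)) = (if even n then 1 else - 1) * (sqrt 3 / 2)" .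
    have "cos (2 * pi * of_int (6 * n + 1) * (5/12)) = cos (pi * of_int (5 * n) + (pi - pi / 6))"
      by (simp add: algebra_simps)
    also have "\<dots> = (if even n then 1 else - 1) * (- sqrt 3 / 2)"
      by (simp only: cos_add cos_diff cos_30 cos_npi_int sin_npi_int cos_pi sin_pi) simp
    finally show ?thesis unfolding w_def a by simp
  qed
  have w0: "w k = 0" if "even k \<or> 3 dvd k" for k
  proof -
    have "w k = 2 * sin (pi * of_int k / 2) * sin (pi * of_int k / 3)"
      unfolding w_def cos_diff_cos by (simp add: algebra_simps)
    moreover have "sin (pi * of_int k / 2) = 0" if k: "even k"
    proof -
      from k obtain j where "k = 2 * j" by auto
      then show ?thesis using sin_npi_int[of j] by simp
    qed
    moreover have "sin (pi * of_int k / 3) = 0" if k: "3 dvd k"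
    proof -
      from k obtain j where "k = 3 * j" by auto
      then show ?thesis using sin_npi_int[of j] by simp
    qed
    ultimately show ?thesis using that by auto
  qed
  have f1: "f (6 * n + 1) = sqrt y / 2 * eta_term y n" for n
  proof -
    have "sqrt 12 = 2 * sqrt 3" using real_sqrt_mult[of 4 3] by simp
    then have a: "sqrt 3 / sqrt (12 / y) = sqrt y / 2" using y by (simp add: real_sqrt_divide)
    have b: "- pi * (of_int (6 * n + 1))\<^sup>2 / (12 / y) = - 3 * pi * y * (of_int n + 1/6)\<^sup>2"
      using y by (simp add: power2_eq_square field_simps)
    have "E / S * (g * t) = t / S * (g * E)" for E S g t :: real by simp
    then show ?thesis unfolding f_def w1 eta_term_def b a[symmetric] .
  qed
  have e: "(eta_term y has_sum infsum (eta_term y) UNIV) UNIV" using eta_term_summable[OF y] by simp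
  \<comment> \<open>The integers coprime to 6 are the numbers 6 n + 1 and their negatives. As
    \<open>f\<close> is even, each family contributes half of the total.\<close>
  have r1: "(f has_sum sqrt y / 2 * infsum (eta_term y) UNIV) (range (\<lambda>n. 6 * n + 1))"
  proof (subst has_sum_reindex)
    show "(f \<circ> (\<lambda>n. 6 * n + 1) has_sum sqrt y / 2 * infsum (eta_term y) UNIV) UNIV"
      unfolding o_def f1 by (rule has_sum_cmult_right[OF e])
  qed (simp add: inj_on_def)
  have r2: "(f has_sum sqrt y / 2 * infsum (eta_term y) UNIV) (range (\<lambda>n. - (6 * n + 1)))"
  proof (subst has_sum_reindex)
    show "(f \<circ> (\<lambda>n. - (6 * n + 1)) has_sum sqrt y / 2 * infsum (eta_term y) UNIV) UNIV"
      unfolding o_def f_minus f1 by (rule has_sum_cmult_right[OF e])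
  qed (simp add: inj_on_def)
  have "6 * m + 1 \<noteq> - (6 * n + 1)" for m n :: int by presburger
  then have r3: "range (\<lambda>n. 6 * n + 1) \<inter> range (\<lambda>n::int. - (6 * n + 1)) = {}" by blast
  have "(f has_sum sqrt y * infsum (eta_term y) UNIV) (range (\<lambda>n. 6 * n + 1) \<union> range (\<lambda>n::int. - (6 * n + 1)))"
    using has_sum_Un_disjoint[OF r1 r2 r3] by simp
  moreover have f0: "f k = 0" if "k \<notin> range (\<lambda>n. 6 * n + 1) \<union> range (\<lambda>n::int. - (6 * n + 1))" for k
  proof -
    from that have "k \<noteq> 6 * (k div 6) + 1" "k \<noteq> - (6 * (- (k div 6) - 1) + 1)" by blast+
    then have "k \<noteq> 6 * (k div 6) + 1" "k \<noteq> 6 * (k div 6) + 5" by auto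
    then have "k mod 6 \<noteq> 1" "k mod 6 \<noteq> 5" by (metis mult_div_mod_eq)+
    then have "even k \<or> 3 dvd k" by presburger
    then show "f k = 0" by (simp add: f_def w0)
  qed
  have "(f has_sum c) UNIV" if "(f has_sum c) R" "\<And>k. k \<notin> R \<Longrightarrow> f k = 0" for c R
    using that(1) by (rule has_sum_cong_neutral[THEN iffD1, rotated 3]) (simp_all add: that(2))
  from has_sum_unique[OF 1 this[OF calculation f0]] show ?thesis .
qed

text \<open>The classical law eta (i / y) = sqrt y eta (i y), with eta split into its exponential
  factor and Euler's product.\<close>

theorem euler_phi_inversion:
  assumes "y > 0"
  shows "of_real (exp (- pi / (12 * y))) * euler_phi (of_real (exp (- 2 * pi / y))) =
    of_real (sqrt y) * (of_real (exp (- pi * y / 12)) * euler_phi (of_real (exp (- 2 * pi * y))))"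
  using euler_phi_eta_term[OF assms] euler_phi_eta_term[of "1 / y"] eta_term_inverse[OF assms] assms
  by (simp add: mult.commute[of 12])

section \<open>The cubic theta function\<close>

lemma summable_on_mult_product:
  fixes f :: "'a \<Rightarrow> real" and g :: "'b \<Rightarrow> real"
  assumes "f summable_on A" "g summable_on B" "\<And>x. f x \<ge> 0" "\<And>y. g y \<ge> 0"
  shows "(\<lambda>(x, y). f x * g y) summable_on A \<times> B"
proof (rule summable_on_SigmaI)
  show "((\<lambda>y. case (x, y) of (x, y) \<Rightarrow> f x * g y) has_sum f x * infsum g B) B" for x
    using has_sum_cmult_right[of g B "infsum g B" "f x"] assms(2) by simp
  show "(\<lambda>x. f x * infsum g B) summable_on A" using assms by (intro summable_on_cmult_left)
qed (use assms in auto)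

text \<open>Twice the form equals m^2 + n^2 + (m + n)^2. With r = sqrt (norm q) the bound dominates
  the double series for a by a product of two geometric series.\<close>

lemma abs_le_twice_quadratic_form: "\<bar>m\<bar> + \<bar>n\<bar> \<le> 2 * (m\<^sup>2 + m * n + n\<^sup>2)" for m n :: int
proof -
  from abs_le_square_int[of m] abs_le_square_int[of n] have "\<bar>m\<bar> + \<bar>n\<bar> \<le> m\<^sup>2 + n\<^sup>2" by simp
  also have "\<dots> \<le> m\<^sup>2 + n\<^sup>2 + (m + n)\<^sup>2" by simp
  finally show ?thesis by (simp add: power2_eq_square algebra_simps)
qed

lemma quadratic_form_nonneg: "m\<^sup>2 + m * n + n\<^sup>2 \<ge> 0" for m n :: int
  using abs_le_twice_quadratic_form[of m n] by simp

lemma power_quadratic_form_le: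
  fixes r :: real
  assumes "0 \<le> r" "r \<le> 1"
  shows "(r\<^sup>2) ^ nat (m\<^sup>2 + m * n + n\<^sup>2) \<le> r ^ nat \<bar>m\<bar> * r ^ nat \<bar>n\<bar>"
proof -
  have "r ^ (2 * nat (m\<^sup>2 + m * n + n\<^sup>2)) \<le> r ^ (nat \<bar>m\<bar> + nat \<bar>n\<bar>)"
    using assms abs_le_twice_quadratic_form[of m n] quadratic_form_nonneg[of m n]
    by (intro power_decreasing) auto
  then show ?thesis by (simp add: power_mult power_add)
qed

lemma power_int_quadratic_form:
  "q powi (m\<^sup>2 + m * n + n\<^sup>2) = (q :: complex) ^ nat (m\<^sup>2 + m * n + n\<^sup>2)"
  using quadratic_form_nonneg[of m n] by (simp add: power_int_def)

lemma norm_cubic_term_le: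
  fixes q :: complex
  assumes "norm q \<le> r\<^sup>2" "0 \<le> r" "r \<le> 1"
  shows "norm (case p of (m, n) \<Rightarrow> q powi (m\<^sup>2 + m * n + n\<^sup>2)) \<le> (case p of (m, n) \<Rightarrow> r ^ nat \<bar>m\<bar> * r ^ nat \<bar>n\<bar>)"
proof (cases p)
  case (Pair m n)
  have "norm q ^ nat (m\<^sup>2 + m * n + n\<^sup>2) \<le> (r\<^sup>2) ^ nat (m\<^sup>2 + m * n + n\<^sup>2)"
    using assms by (intro power_mono) auto
  also have "\<dots> \<le> r ^ nat \<bar>m\<bar> * r ^ nat \<bar>n\<bar>" by (rule power_quadratic_form_le) (use assms in auto)
  finally show ?thesis unfolding Pair prod.case power_int_quadratic_form norm_power .
qed

lemma summable_on_power_abs_int2: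
  fixes r :: real
  assumes "0 \<le> r" "r < 1"
  shows "(\<lambda>(m::int, n::int). r ^ nat \<bar>m\<bar> * r ^ nat \<bar>n\<bar>) summable_on UNIV"
  using summable_on_mult_product[OF summable_on_power_abs_int[OF assms] summable_on_power_abs_int[OF assms]] assms
  by simp

lemma cubic_a_summable:
  fixes q :: complex
  assumes "norm q < 1"
  shows "(\<lambda>(m::int, n::int). q powi (m\<^sup>2 + m * n + n\<^sup>2)) summable_on UNIV"
proof -
  have "sqrt (norm q) < 1" using assms by simp
  then have "(\<lambda>p. norm (case p of (m::int, n::int) \<Rightarrow> q powi (m\<^sup>2 + m * n + n\<^sup>2))) summable_on UNIV"
    using assms
    by (intro Infinite_Sum.abs_summable_on_comparison_test'[OF summable_on_power_abs_int2[of "sqrt (norm q)"] norm_cubic_term_le]) auto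
  then show ?thesis by (rule abs_summable_summable)
qed

lemma cubic_a_holomorphic: "cubic_a holomorphic_on ball 0 1"
proof -
  have hol: "cubic_a holomorphic_on ball 0 R" if R: "0 < R" "R < 1" for R
  proof -
    have ul: "uniform_limit (cball 0 R) (\<lambda>X q. \<Sum>p\<in>X. case p of (m::int, n::int) \<Rightarrow> q powi (m\<^sup>2 + m * n + n\<^sup>2)) cubic_a (finite_subsets_at_top UNIV)"
      unfolding cubic_a_def
    proof (rule Weierstrass_m_test_general)
      show "(\<lambda>(m::int, n::int). sqrt R ^ nat \<bar>m\<bar> * sqrt R ^ nat \<bar>n\<bar>) summable_on UNIV"
        using R by (intro summable_on_power_abs_int2) auto
    qed (rule norm_cubic_term_le, use R in auto)
    show ?thesis
      by (rule holomorphic_uniform_limit[OF _ ul])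
        (auto intro!: always_eventually holomorphic_intros continuous_intros simp: power_int_quadratic_form split: prod.split)
  qed
  show ?thesis
  proof (rule holomorphic_on_subset[of _ "\<Union>R\<in>{0<..<1}. ball 0 R"])
    show "cubic_a holomorphic_on (\<Union>R\<in>{0<..<1}. ball 0 R)"
      by (rule holomorphic_on_UN_open) (use hol in auto)
    show "ball 0 1 \<subseteq> (\<Union>R\<in>{0<..<1::real}. ball (0::complex) R)"
    proof
      fix q :: complex assume "q \<in> ball 0 1"
      then have "(norm q + 1) / 2 \<in> {0<..<1}" "q \<in> ball 0 ((norm q + 1) / 2)"
        using norm_ge_zero[of q] by (auto simp del: norm_ge_zero)
      then show "q \<in> (\<Union>R\<in>{0<..<1::real}. ball (0::complex) R)" by blast
    qed
  qed
qed

text \<open>For |m|, |n| <= 1 the form takes the value 0 once, 1 six times and 3 twice. Every other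
  pair has an exponent k >= 2, so q^2 can be split off; the factor 16 = 4^2 restores the exponent k
  of the majorant from k - 2. This precision is enough to read off a(0) and a'(0).\<close>

lemma cubic_a_expansion:
  obtains K where "\<And>q. norm q \<le> 1/4 \<Longrightarrow> norm (cubic_a q - (1 + 6 * q + 2 * q ^ 3)) \<le> K * (norm q)\<^sup>2"
proof
  define F :: "(int \<times> int) set" where "F = {-1..1} \<times> {-1..1}"
  define g :: "int \<times> int \<Rightarrow> real" where "g = (\<lambda>(m, n). (1/2) ^ nat \<bar>m\<bar> * (1/2) ^ nat \<bar>n\<bar>)"
  define K where "K = 16 * infsum g (- F)"
  fix q :: complex assume q: "norm q \<le> 1/4"
  define f where "f = (\<lambda>(m::int, n::int). q powi (m\<^sup>2 + m * n + n\<^sup>2))"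
  have "finite F" by (simp add: F_def)
  have f: "f summable_on UNIV" unfolding f_def using q by (intro cubic_a_summable) simp
  have "infsum f (F \<union> - F) = infsum f F + infsum f (- F)"
    by (intro infsum_Un_disjoint summable_on_subset_banach[OF f]) auto
  moreover have "{-1..1::int} = {-1, 0, 1}" by auto
  then have "sum f F = 1 + 6 * q + 2 * q ^ 3"
    unfolding F_def f_def by (simp add: sum.cartesian_product[symmetric] power_int_quadratic_form power2_eq_square eval_nat_numeral)
  ultimately have eq: "cubic_a q - (1 + 6 * q + 2 * q ^ 3) = infsum f (- F)"
    using \<open>finite F\<close> by (simp add: cubic_a_def f_def)
  have "norm (infsum f (- F)) \<le> 16 * (norm q)\<^sup>2 * infsum g (- F)"
  proof (rule norm_infsum_le)
    show "(f has_sum infsum f (- F)) (- F)" using summable_on_subset_banach[OF f] by simp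
    have "g summable_on UNIV" unfolding g_def by (rule summable_on_power_abs_int2) auto
    then have "g summable_on - F" by (rule summable_on_subset_banach) auto
    then show "((\<lambda>p. 16 * (norm q)\<^sup>2 * g p) has_sum 16 * (norm q)\<^sup>2 * infsum g (- F)) (- F)"
      by (intro has_sum_cmult_right) simp
    fix p assume p: "p \<in> - F"
    obtain m n where mn: "p = (m, n)" by force
    define k where "k = nat (m\<^sup>2 + m * n + n\<^sup>2)"
    have "\<bar>m\<bar> \<ge> 2 \<or> \<bar>n\<bar> \<ge> 2" using p by (auto simp: F_def mn)
    moreover have "x\<^sup>2 \<ge> 4" if "\<bar>x\<bar> \<ge> 2" for x :: int using power_mono[of 2 "\<bar>x\<bar>" 2] that by simp
    ultimately have "m\<^sup>2 + n\<^sup>2 \<ge> 4" by (metis add_increasing add_increasing2 zero_le_power2)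
    moreover have "2 * (m\<^sup>2 + m * n + n\<^sup>2) = (m + n)\<^sup>2 + m\<^sup>2 + n\<^sup>2" by (simp add: power2_eq_square algebra_simps)
    ultimately have "2 * (m\<^sup>2 + m * n + n\<^sup>2) \<ge> 4" using zero_le_power2[of "m + n"] by linarith
    then have "m\<^sup>2 + m * n + n\<^sup>2 \<ge> 2" by simp
    then have k: "k = 2 + (k - 2)" by (simp add: k_def)
    have "norm (f p) = norm q ^ k" by (simp add: f_def mn power_int_quadratic_form norm_power k_def)
    also have "\<dots> = (norm q)\<^sup>2 * norm q ^ (k - 2)" by (subst k, subst power_add) simp
    also have "\<dots> \<le> (norm q)\<^sup>2 * (1/4) ^ (k - 2)" using q by (intro mult_left_mono power_mono) auto
    also have "(1/4 :: real) ^ (k - 2) = 16 * ((1/2)\<^sup>2) ^ k" by (subst (2) k, subst power_add) (simp add: power2_eq_square)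
    also have "(norm q)\<^sup>2 * (16 * ((1/2)\<^sup>2) ^ k) \<le> (norm q)\<^sup>2 * (16 * g p)"
      unfolding k_def g_def mn prod.case by (intro mult_left_mono power_quadratic_form_le) auto
    finally show "norm (f p) \<le> 16 * (norm q)\<^sup>2 * g p" by (simp add: mult_ac)
  qed
  then show "norm (cubic_a q - (1 + 6 * q + 2 * q ^ 3)) \<le> K * (norm q)\<^sup>2"
    unfolding eq K_def by (simp add: mult_ac)
qed

lemma cubic_a_0 [simp]: "cubic_a 0 = 1"
proof -
  obtain K where "\<And>q. norm q \<le> 1/4 \<Longrightarrow> norm (cubic_a q - (1 + 6 * q + 2 * q ^ 3)) \<le> K * (norm q)\<^sup>2"
    using cubic_a_expansion by blast
  from this[of 0] show ?thesis by simp
qed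

lemma deriv_cubic_a_0: "deriv cubic_a 0 = 6"
proof (rule DERIV_imp_deriv)
  obtain K where K: "\<And>q. norm q \<le> 1/4 \<Longrightarrow> norm (cubic_a q - (1 + 6 * q + 2 * q ^ 3)) \<le> K * (norm q)\<^sup>2"
    using cubic_a_expansion by blast
  have "((\<lambda>q. (cubic_a q - 1) / q - 6) \<longlongrightarrow> 0) (at 0)"
  proof (rule Lim_null_comparison)
    show "\<forall>\<^sub>F q in at 0. norm ((cubic_a q - 1) / q - 6) \<le> K * norm q + 2 * (norm q)\<^sup>2"
    proof (rule eventually_mono[OF eventually_at_ball'[of "1/4" 0 UNIV]])
      fix q :: complex assume "q \<in> ball 0 (1/4) \<and> q \<noteq> 0 \<and> q \<in> UNIV"
      then have q: "q \<noteq> 0" "norm q \<le> 1/4" by auto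
      have "(cubic_a q - 1) / q - 6 = (cubic_a q - (1 + 6 * q + 2 * q ^ 3)) / q + 2 * q\<^sup>2"
        using q by (simp add: field_simps power2_eq_square power3_eq_cube)
      also have "norm \<dots> \<le> norm ((cubic_a q - (1 + 6 * q + 2 * q ^ 3)) / q) + norm (2 * q\<^sup>2)" by (rule norm_triangle_ineq)
      also have "\<dots> \<le> K * (norm q)\<^sup>2 / norm q + 2 * (norm q)\<^sup>2"
        unfolding norm_divide norm_mult norm_power using K[OF q(2)] by (intro add_mono divide_right_mono) auto
      finally show "norm ((cubic_a q - 1) / q - 6) \<le> K * norm q + 2 * (norm q)\<^sup>2"
        using q by (simp add: power2_eq_square)
    qed simp
    have "((\<lambda>q::complex. K * norm q + 2 * (norm q)\<^sup>2) \<longlongrightarrow> K * norm (0::complex) + 2 * (norm (0::complex))\<^sup>2) (at 0)"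
      by (intro tendsto_intros)
    then show "((\<lambda>q::complex. K * norm q + 2 * (norm q)\<^sup>2) \<longlongrightarrow> 0) (at 0)" by simp
  qed
  then have "((\<lambda>q. (cubic_a q - 1) / q) \<longlongrightarrow> 6) (at 0)" by (simp add: LIM_zero_iff)
  then show "(cubic_a has_field_derivative 6) (at 0)" by (simp add: DERIV_def)
qed

text \<open>Completing the square, m^2 + m n + n^2 = 3/4 n^2 + (n/2 + m)^2, where s = 2 y for q =
  exp (- 2 pi y). The pair is ordered (n, m) so that the inner sum over m is
  \<open>theta_real s (n / 2)\<close>.\<close>

definition cubic_gauss :: "real \<Rightarrow> real" where
  "cubic_gauss s = (\<Sum>\<^sub>\<infinity>(n, m)\<in>(UNIV :: (int \<times> int) set). exp (- 3 * pi * s * (of_int n)\<^sup>2 / 4) * exp (- pi * s * (of_int n / 2 + of_int m)\<^sup>2))"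

lemma cubic_a_eq_cubic_gauss:
  assumes y: "y > 0"
  shows "(\<lambda>(n::int, m::int). exp (- 3 * pi * (2 * y) * (of_int n)\<^sup>2 / 4) * exp (- pi * (2 * y) * (of_int n / 2 + of_int m)\<^sup>2)) summable_on UNIV" (is ?A)
    and "cubic_a (of_real (exp (- 2 * pi * y))) = of_real (cubic_gauss (2 * y))" (is ?B)
proof -
  define f where "f = (\<lambda>(n::int, m::int). exp (- 3 * pi * (2 * y) * (of_int n)\<^sup>2 / 4) * exp (- pi * (2 * y) * (of_int n / 2 + of_int m)\<^sup>2))"
  define q where "q = complex_of_real (exp (- 2 * pi * y))"
  have eq: "(case p of (m, n) \<Rightarrow> q powi (m\<^sup>2 + m * n + n\<^sup>2)) = of_real (f p)" for p
  proof (cases p)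
    case (Pair m n)
    have "exp (- 2 * pi * y) powi (m\<^sup>2 + m * n + n\<^sup>2) = exp (of_int (m\<^sup>2 + m * n + n\<^sup>2) * (- 2 * pi * y))"
      by (simp add: exp_power_int)
    also have "\<dots> = f p" unfolding f_def Pair by (simp add: power2_eq_square algebra_simps flip: exp_add)
    finally show ?thesis unfolding Pair q_def prod.case by (metis of_real_power_int)
  qed
  have "norm q < 1" using y by (simp add: q_def)
  from cubic_a_summable[OF this] have "(\<lambda>p. complex_of_real (f p)) summable_on UNIV" unfolding eq .
  then have "f summable_on UNIV" by (metis summable_on_cong summable_on_Re Re_complex_of_real)
  then show ?A unfolding f_def .
  then have "((\<lambda>p. complex_of_real (f p)) has_sum of_real (infsum f UNIV)) UNIV"
    unfolding f_def[symmetric] by (intro has_sum_of_real) simp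
  then have "cubic_a q = of_real (infsum f UNIV)" unfolding cubic_a_def eq by (rule infsumI)
  then show ?B unfolding q_def cubic_gauss_def f_def .
qed

lemma cubic_gauss_inner:
  assumes s: "s > 0"
  shows "cubic_gauss s = (\<Sum>\<^sub>\<infinity>n::int. exp (- 3 * pi * s * (of_int n)\<^sup>2 / 4) * theta_real s (of_int n / 2))"
proof -
  have "(\<lambda>(n::int, m::int). exp (- 3 * pi * s * (of_int n)\<^sup>2 / 4) * exp (- pi * s * (of_int n / 2 + of_int m)\<^sup>2)) summable_on UNIV \<times> UNIV"
    using cubic_a_eq_cubic_gauss(1)[of "s / 2"] s by simp
  from infsum_Sigma'_banach[OF this] show ?thesis
    unfolding cubic_gauss_def theta_real_def
    using has_sum_imp_summable[OF theta_real_has_sum[OF s]]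
    by (subst infsum_cmult_right[symmetric]) auto
qed

text \<open>One-dimensional Poisson summation is used twice: forwards in m, producing cos (pi k n)
  with a new variable k, and, after interchanging the sums, backwards in n. This works because the
  cosine is symmetric in k and n, and 4 / (3 s) is the parameter for which the two Gaussians trade
  places.\<close>

lemma cubic_gauss_inversion:
  assumes s: "s > 0"
  shows "cubic_gauss s = 2 / (sqrt 3 * s) * cubic_gauss (4 / (3 * s))"
proof -
  define s' where "s' = 4 / (3 * s)"
  have s': "s' > 0" using s by (simp add: s'_def)
  define f where "f = (\<lambda>n k :: int. exp (- 3 * pi * s * (of_int n)\<^sup>2 / 4) * (exp (- pi * (of_int k)\<^sup>2 / s) / sqrt s * cos (2 * pi * of_int k * (of_int n / 2))))"
  have "(\<lambda>(n, k). exp (- (3 * pi * s / 4) * (of_int n)\<^sup>2) * (exp (- (pi / s) * (of_int k)\<^sup>2) * (1 / sqrt s))) summable_on (UNIV :: int set) \<times> (UNIV :: int set)"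
    using s by (intro summable_on_mult_product summable_on_cmult_left summable_on_gauss_int) auto
  then have "(\<lambda>(n, k). f n k) summable_on UNIV \<times> UNIV"
  proof (rule abs_summable_summable[OF Infinite_Sum.abs_summable_on_comparison_test'])
    fix p :: "int \<times> int"
    show "norm (case p of (n, k) \<Rightarrow> f n k) \<le> (case p of (n, k) \<Rightarrow> exp (- (3 * pi * s / 4) * (of_int n)\<^sup>2) * (exp (- (pi / s) * (of_int k)\<^sup>2) * (1 / sqrt s)))"
      using s by (auto simp: f_def abs_mult split: prod.split intro!: mult_left_le divide_right_mono)
  qed
  then have swap: "(\<Sum>\<^sub>\<infinity>n. \<Sum>\<^sub>\<infinity>k. f n k) = (\<Sum>\<^sub>\<infinity>k. \<Sum>\<^sub>\<infinity>n. f n k)" by (rule infsum_swap_banach)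
  have 1: "(\<Sum>\<^sub>\<infinity>k. f n k) = exp (- 3 * pi * s * (of_int n)\<^sup>2 / 4) * theta_real s (of_int n / 2)" for n
    unfolding f_def by (rule infsumI, rule has_sum_cmult_right, rule theta_real_transform[OF s])
  have 2: "(\<Sum>\<^sub>\<infinity>n. f n k) = sqrt s' / sqrt s * (exp (- 3 * pi * s' * (of_int k)\<^sup>2 / 4) * theta_real s' (of_int k / 2))" for k
  proof (rule infsumI)
    have "f n k = sqrt s' / sqrt s * exp (- 3 * pi * s' * (of_int k)\<^sup>2 / 4) * (exp (- pi * (of_int n)\<^sup>2 / s') / sqrt s' * cos (2 * pi * of_int n * (of_int k / 2)))" for n
    proof -
      have "- pi * (of_int n)\<^sup>2 / s' = - 3 * pi * s * (of_int n)\<^sup>2 / 4" "- 3 * pi * s' * (of_int k)\<^sup>2 / 4 = - pi * (of_int k)\<^sup>2 / s"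
        using s by (auto simp: s'_def field_simps)
      then show ?thesis unfolding f_def using s' by (simp add: mult_ac)
    qed
    then show "((\<lambda>n. f n k) has_sum sqrt s' / sqrt s * (exp (- 3 * pi * s' * (of_int k)\<^sup>2 / 4) * theta_real s' (of_int k / 2))) UNIV"
      using has_sum_cmult_right[OF theta_real_transform[OF s', of "of_int k / 2"], of "sqrt s' / sqrt s * exp (- 3 * pi * s' * (of_int k)\<^sup>2 / 4)"]
      by (simp only: mult.assoc)
  qed
  have "cubic_gauss s = (\<Sum>\<^sub>\<infinity>k. sqrt s' / sqrt s * (exp (- 3 * pi * s' * (of_int k)\<^sup>2 / 4) * theta_real s' (of_int k / 2)))"
    unfolding cubic_gauss_inner[OF s] 1[symmetric] swap 2 ..
  also have "\<dots> = sqrt s' / sqrt s * cubic_gauss s'"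
    unfolding cubic_gauss_inner[OF s'] by (rule infsum_cmult_right')
  also have "sqrt s' / sqrt s = 2 / (sqrt 3 * s)"
    using s by (simp add: s'_def real_sqrt_divide real_sqrt_mult)
  finally show ?thesis by (simp add: s'_def)
qed

theorem cubic_a_inversion:
  assumes y: "y > 0"
  shows "cubic_a (of_real (exp (- 2 * pi / (3 * y)))) = of_real (sqrt 3 * y) * cubic_a (of_real (exp (- 2 * pi * y)))"
proof -
  have "cubic_gauss (2 / (3 * y)) = sqrt 3 * y * cubic_gauss (2 * y)"
  proof -
    have "4 / (3 * (2 / (3 * y))) = 2 * y" using y by (simp add: field_simps)
    moreover have "2 / (sqrt 3 * (2 / (3 * y))) = sqrt 3 * y" using y by (simp add: real_div_sqrt field_simps)
    ultimately show ?thesis using cubic_gauss_inversion[of "2 / (3 * y)"] y by simp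
  qed
  with cubic_a_eq_cubic_gauss(2)[OF y] cubic_a_eq_cubic_gauss(2)[of "1 / (3 * y)"] y show ?thesis by simp
qed

section \<open>Functions invariant under the Fricke involution\<close>

lemma holomorphic_factor_at_0:
  assumes "f holomorphic_on S" "open S" "0 \<in> S" "f 0 = 0"
  obtains g where "g holomorphic_on S" "\<And>z. z \<in> S \<Longrightarrow> f z = z * g z" "g 0 = deriv f 0"
proof
  define g where "g = (\<lambda>z. if z = 0 then deriv f 0 else f z / z - f 0 / (z - 0))"
  show "g holomorphic_on S" unfolding g_def
    by (rule pole_theorem) (use assms in \<open>auto simp: interior_open\<close>)
  show "f z = z * g z" if "z \<in> S" for z using assms by (simp add: g_def)
  show "g 0 = deriv f 0" by (simp add: g_def)
qed

definition nome :: "complex \<Rightarrow> complex" where "nome \<tau> = exp (2 * pi * \<i> * \<tau>)"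

definition fricke :: "complex \<Rightarrow> complex" where "fricke \<tau> = - 1 / (3 * \<tau>)"

lemma norm_nome: "norm (nome \<tau>) = exp (- 2 * pi * Im \<tau>)"
  by (simp add: nome_def)

lemma nome_in_ball: "Im \<tau> > 0 \<Longrightarrow> nome \<tau> \<in> ball 0 1"
  by (simp add: norm_nome)

lemma nome_nonzero [simp]: "nome \<tau> \<noteq> 0" by (simp add: nome_def)

lemma nome_add_int: "nome (\<tau> + of_int n) = nome \<tau>"
proof -
  have "exp (2 * pi * \<i> * of_int n) = 1"
    using exp_integer_2pi[of "of_int n"] by (simp add: mult_ac)
  then show ?thesis by (simp add: nome_def ring_distribs exp_add)
qed

lemma Im_fricke: "\<tau> \<noteq> 0 \<Longrightarrow> Im (fricke \<tau>) = Im \<tau> / (3 * (norm \<tau>)\<^sup>2)"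
proof -
  have "fricke \<tau> = - (inverse \<tau> / 3)" by (simp add: fricke_def inverse_eq_divide)
  then show ?thesis by (simp add: cmod_power2)
qed

lemma Im_fricke_pos: "Im \<tau> > 0 \<Longrightarrow> Im (fricke \<tau>) > 0"
  by (subst Im_fricke) (auto intro!: divide_pos_pos mult_pos_pos)

lemma nome_surj:
  assumes "q \<in> ball 0 1 - {0}"
  obtains \<tau> where "Im \<tau> > 0" "nome \<tau> = q"
proof
  define \<tau> where "\<tau> = Ln q / (2 * pi * \<i>)"
  have "q \<noteq> 0" using assms by auto
  then show *: "nome \<tau> = q" by (simp add: nome_def \<tau>_def)
  have "exp (- 2 * pi * Im \<tau>) < 1" using assms unfolding norm_nome[symmetric] * by simp
  then show "Im \<tau> > 0" by (simp add: mult_less_0_iff zero_less_mult_iff)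
qed

text \<open>
  If \<open>\<bar>Re \<tau>\<bar> \<le> 1/2\<close> and \<open>Im \<tau> < 1/4\<close>, then \<open>3 \<bar>\<tau>\<bar>\<^sup>2 < 15/16\<close>, so the Fricke
  involution multiplies the imaginary part by more than \<open>16/15\<close>.
\<close>

lemma fricke_reduction:
  assumes inv: "\<And>\<tau>. Im \<tau> > 0 \<Longrightarrow> F (nome (fricke \<tau>)) = F (nome \<tau>)"
    and "Im \<tau> > 0"
  shows "\<exists>\<tau>'. Im \<tau>' \<ge> 1/4 \<and> F (nome \<tau>') = F (nome \<tau>)"
proof -
  \<comment> \<open>Induction on a number \<open>n\<close> of gains by 16/15 that suffices to lift
    the imaginary part to 1/4.\<close>
  have "\<exists>\<tau>'. Im \<tau>' \<ge> 1/4 \<and> F (nome \<tau>') = F (nome \<tau>)" if "Im \<tau> > 0" "1/4 \<le> (16/15)^n * Im \<tau>" for n \<tau>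
    using that
  proof (induction n arbitrary: \<tau>)
    case (Suc n)
    show ?case
    proof (cases "Im \<tau> \<ge> 1/4")
      case False
      define \<sigma> where "\<sigma> = \<tau> + of_int (- round (Re \<tau>))"
      have re: "\<bar>Re \<sigma>\<bar> \<le> 1/2"
        using of_int_round_abs_le[of "Re \<tau>"] by (simp add: \<sigma>_def abs_minus_commute)
      have im: "Im \<sigma> = Im \<tau>" by (simp add: \<sigma>_def)
      have s0: "\<sigma> \<noteq> 0" using Suc.prems im by auto
      have "(Re \<sigma>)\<^sup>2 \<le> (1/2)\<^sup>2" using re by (metis abs_ge_zero power2_abs power_mono)
      moreover have "(Im \<sigma>)\<^sup>2 \<le> (1/4)\<^sup>2" using False im Suc.prems by (intro power_mono) auto
      ultimately have n: "3 * (norm \<sigma>)\<^sup>2 \<le> 15/16"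
        unfolding cmod_power2 by (simp add: power_divide)
      have "16/15 * Im \<tau> \<le> Im (fricke \<sigma>)"
      proof -
        have "16/15 * (3 * (norm \<sigma>)\<^sup>2) * Im \<tau> \<le> 1 * Im \<tau>"
          by (rule mult_right_mono) (use n Suc.prems in auto)
        moreover have "3 * (norm \<sigma>)\<^sup>2 > 0" using s0 by simp
        ultimately show ?thesis
          unfolding Im_fricke[OF s0] im by (subst pos_le_divide_eq) (auto simp: mult_ac)
      qed
      then have "1/4 \<le> (16/15)^n * Im (fricke \<sigma>)"
      proof -
        have "1/4 \<le> (16/15)^n * (16/15 * Im \<tau>)" using Suc.prems by (simp add: mult_ac)
        also have "\<dots> \<le> (16/15)^n * Im (fricke \<sigma>)"
          by (rule mult_left_mono) (use \<open>16/15 * Im \<tau> \<le> Im (fricke \<sigma>)\<close> in auto)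
        finally show ?thesis .
      qed
      moreover have "Im (fricke \<sigma>) > 0" using Suc.prems im by (intro Im_fricke_pos) auto
      ultimately obtain \<tau>' where "Im \<tau>' \<ge> 1/4" "F (nome \<tau>') = F (nome (fricke \<sigma>))"
        using Suc.IH by blast
      moreover have "F (nome (fricke \<sigma>)) = F (nome \<tau>)"
        using inv[of \<sigma>] Suc.prems im by (simp add: \<sigma>_def nome_add_int del: of_int_minus)
      ultimately show ?thesis by metis
    qed blast
  qed auto
  moreover obtain n where "1/4 / Im \<tau> < (16/15)^n" using real_arch_pow[of "16/15"] by auto
  ultimately show ?thesis using assms(2) by (metis pos_divide_less_eq less_imp_le)
qed

theorem fricke_invariant_constant:
  assumes hol: "F holomorphic_on ball 0 1"
    and inv: "\<And>\<tau>. Im \<tau> > 0 \<Longrightarrow> F (nome (fricke \<tau>)) = F (nome \<tau>)"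
    and "q \<in> ball 0 1"
  shows "F q = F 0"
proof -
  \<comment> \<open>The radius corresponds to Im \<tau> = 1/4, the height reached by
    \<open>fricke_reduction\<close>. Hence all values of \<open>F\<close> already occur on this
    closed disc, and the maximum is attained inside the unit disc.\<close>
  define \<rho> where "\<rho> = exp (- 2 * pi * (1/4))"
  have \<rho>: "0 < \<rho>" "\<rho> < 1" by (auto simp: \<rho>_def)
  have cont: "continuous_on (cball 0 \<rho>) (\<lambda>q. norm (F q))"
    using \<rho> by (intro continuous_on_norm holomorphic_on_imp_continuous_on holomorphic_on_subset[OF hol]) auto
  obtain q0 where q0: "q0 \<in> cball 0 \<rho>" "\<And>q. q \<in> cball 0 \<rho> \<Longrightarrow> norm (F q) \<le> norm (F q0)"
    using continuous_attains_sup[OF _ _ cont] \<rho> by (metis centre_in_cball compact_cball empty_iff less_imp_le)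
  have max: "norm (F q) \<le> norm (F q0)" if q: "q \<in> ball 0 1" for q
  proof (cases "q = 0")
    case False
    then obtain \<tau> where "Im \<tau> > 0" "nome \<tau> = q" using nome_surj q by blast
    with fricke_reduction[where F = F, OF inv] obtain \<tau>' where t: "Im \<tau>' \<ge> 1/4" "F (nome \<tau>') = F q" by metis
    have "nome \<tau>' \<in> cball 0 \<rho>" using t(1) by (simp add: norm_nome \<rho>_def)
    with q0(2)[of "nome \<tau>'"] t(2) show ?thesis by simp
  qed (use q0 \<rho> in auto)
  have "F constant_on ball 0 1"
    by (rule maximum_modulus_principle[OF hol, of "ball 0 1" q0]) (use q0(1) \<rho> max in auto)
  then show ?thesis using assms(3) by (metis constant_on_def centre_in_ball zero_less_one)
qed

section \<open>Modular identities\<close>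

definition upper_half :: "complex set" where "upper_half = {\<tau>. Im \<tau> > 0}"

lemma open_upper_half: "open upper_half"
  unfolding upper_half_def by (rule open_halfspace_Im_gt)

lemma connected_upper_half: "connected upper_half"
  unfolding upper_half_def by (intro convex_connected convex_halfspace_Im_gt)

lemma upper_half_nonzero: "\<tau> \<in> upper_half \<Longrightarrow> \<tau> \<noteq> 0" by (auto simp: upper_half_def)

lemma nome_upper_half: "\<tau> \<in> upper_half \<Longrightarrow> nome \<tau> \<in> ball 0 1"
  unfolding upper_half_def by (intro nome_in_ball) simp

lemma fricke_upper_half: "\<tau> \<in> upper_half \<Longrightarrow> fricke \<tau> \<in> upper_half"
  unfolding upper_half_def using Im_fricke_pos by simp

lemma fricke_fricke [simp]: "fricke (fricke \<tau>) = \<tau>" by (simp add: fricke_def)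

lemma has_field_derivative_nome:
  assumes "f holomorphic_on ball 0 1" "\<tau> \<in> upper_half"
  shows "((\<lambda>\<tau>. f (nome \<tau>)) has_field_derivative 2 * pi * \<i> * (nome \<tau> * deriv f (nome \<tau>))) (at \<tau>)"
proof -
  have "(nome has_field_derivative 2 * pi * \<i> * nome \<tau>) (at \<tau>)"
    unfolding nome_def by (auto intro!: derivative_eq_intros)
  moreover have "(f has_field_derivative deriv f (nome \<tau>)) (at (nome \<tau>))"
    using assms nome_upper_half by (auto intro: holomorphic_derivI)
  ultimately show ?thesis using DERIV_chain2 by (fastforce simp: mult_ac)
qed

lemma has_field_derivative_fricke:
  assumes "\<tau> \<noteq> 0"
  shows "(fricke has_field_derivative 1 / (3 * \<tau>\<^sup>2)) (at \<tau>)"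
  unfolding fricke_def using assms
  by (auto intro!: derivative_eq_intros simp: field_simps power2_eq_square)

text \<open>Chain rule through \<open>fricke\<close>, whose derivative is 1 / (3 \<tau>^2). The
  right-hand side \<open>g\<close> is left arbitrary so that the rule serves for u, for a and for
  \<theta>a.\<close>

lemma theta_derivative_at_fricke:
  assumes f: "f holomorphic_on ball 0 1"
    and eq: "\<And>\<tau>. \<tau> \<in> upper_half \<Longrightarrow> f (nome (fricke \<tau>)) = g \<tau>"
    and \<tau>: "\<tau> \<in> upper_half"
    and g: "(g has_field_derivative g') (at \<tau>)"
  shows "nome (fricke \<tau>) * deriv f (nome (fricke \<tau>)) = 3 * \<tau>\<^sup>2 * g' / (2 * pi * \<i>)"
proof -
  have "((\<lambda>\<tau>. f (nome (fricke \<tau>))) has_field_derivative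
      2 * pi * \<i> * (nome (fricke \<tau>) * deriv f (nome (fricke \<tau>))) * (1 / (3 * \<tau>\<^sup>2))) (at \<tau>)"
    using DERIV_chain2[OF has_field_derivative_nome[OF f fricke_upper_half[OF \<tau>]] has_field_derivative_fricke] upper_half_nonzero[OF \<tau>]
    by simp
  moreover have "((\<lambda>\<tau>. f (nome (fricke \<tau>))) has_field_derivative g') (at \<tau>)"
    by (rule has_field_derivative_transform_within_open[OF g open_upper_half \<tau>]) (simp add: eq)
  ultimately have "2 * pi * \<i> * (nome (fricke \<tau>) * deriv f (nome (fricke \<tau>))) * (1 / (3 * \<tau>\<^sup>2)) = g'"
    by (rule DERIV_unique)
  then show ?thesis using upper_half_nonzero[OF \<tau>] by (auto simp: field_simps)
qed

text \<open>Poisson summation was carried out for real parameters only, that is for \<tau> = i y.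
  Both sides are holomorphic in \<tau>, so the identity theorem extends the law.\<close>

lemma fricke_identity_from_imaginary_axis:
  assumes F: "F holomorphic_on ball 0 1" and G: "G holomorphic_on ball 0 1"
    and J: "J holomorphic_on upper_half"
    and eq: "\<And>y. y > 0 \<Longrightarrow> F (of_real (exp (- 2 * pi / (3 * y)))) = J (\<i> * of_real y) * G (of_real (exp (- 2 * pi * y)))"
    and "\<tau> \<in> upper_half"
  shows "F (nome (fricke \<tau>)) = J \<tau> * G (nome \<tau>)"
proof -
  have n: "nome holomorphic_on upper_half" unfolding nome_def by (intro holomorphic_intros)
  have fr: "fricke holomorphic_on upper_half" unfolding fricke_def using upper_half_nonzero
    by (intro holomorphic_intros) auto
  have nf: "(\<lambda>\<tau>. nome (fricke \<tau>)) holomorphic_on upper_half"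
    by (rule holomorphic_on_compose_gen[OF fr n, unfolded o_def]) (auto intro: fricke_upper_half)
  have "(\<lambda>\<tau>. F (nome (fricke \<tau>))) holomorphic_on upper_half"
    by (rule holomorphic_on_compose_gen[OF nf F, unfolded o_def]) (auto intro: nome_upper_half fricke_upper_half simp del: mem_ball)
  moreover have "(\<lambda>\<tau>. G (nome \<tau>)) holomorphic_on upper_half"
    by (rule holomorphic_on_compose_gen[OF n G, unfolded o_def]) (auto intro: nome_upper_half simp del: mem_ball)
  ultimately have hol: "(\<lambda>\<tau>. F (nome (fricke \<tau>)) - J \<tau> * G (nome \<tau>)) holomorphic_on upper_half"
    using J by (intro holomorphic_intros)
  define U where "U = (\<lambda>y::real. \<i> * of_real y) ` {0<..}"
  have "F (nome (fricke \<tau>)) - J \<tau> * G (nome \<tau>) = 0"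
  proof (rule analytic_continuation[OF hol open_upper_half connected_upper_half, of U \<i>])
    show "U \<subseteq> upper_half" "\<i> \<in> upper_half" by (auto simp: U_def upper_half_def)
    show "\<i> islimpt U" unfolding islimpt_approachable
    proof (intro allI impI)
      fix e :: real assume "e > 0"
      then have "\<i> * of_real (1 + e / 2) \<in> U" unfolding U_def by (intro imageI) simp
      then show "\<exists>x'\<in>U. x' \<noteq> \<i> \<and> dist x' \<i> < e"
        by (rule bexI[rotated]) (use \<open>e > 0\<close> in \<open>auto simp: dist_norm norm_mult ring_distribs\<close>)
    qed
    show "\<tau> \<in> upper_half" by fact
    fix z assume "z \<in> U"
    then obtain y :: real where y: "y > 0" "z = \<i> * of_real y" by (auto simp: U_def)
    have "nome z = of_real (exp (- 2 * pi * y))"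
      unfolding y nome_def by (simp add: exp_of_real[symmetric] mult_ac)
    moreover have "nome (fricke z) = of_real (exp (- 2 * pi / (3 * y)))"
      using y(1) unfolding y nome_def fricke_def by (simp add: exp_of_real[symmetric] field_simps)
    ultimately show "F (nome (fricke z)) - J z * G (nome z) = 0" using eq[OF y(1)] y(2) by simp
  qed
  then show ?thesis by simp
qed

text \<open>The factor of weight one, normalised to be positive on the imaginary axis, where it
  equals sqrt 3 y; \<open>fricke\<close> then inverts it.\<close>

definition automorphy :: "complex \<Rightarrow> complex" where "automorphy \<tau> = - \<i> * of_real (sqrt 3) * \<tau>"

lemma of_real_sqrt_3_squared: "complex_of_real (sqrt 3) * of_real (sqrt 3) = 3"
  by (simp flip: of_real_mult)

lemma automorphy_squared: "(automorphy \<tau>)\<^sup>2 = - 3 * \<tau>\<^sup>2"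
  using of_real_sqrt_3_squared by (simp add: automorphy_def power2_eq_square algebra_simps)

lemma automorphy_imaginary: "automorphy (\<i> * of_real y) = of_real (sqrt 3 * y)"
  by (simp add: automorphy_def complex_eq_iff)

lemma automorphy_fricke: "\<tau> \<noteq> 0 \<Longrightarrow> automorphy (fricke \<tau>) = 1 / automorphy \<tau>"
  using of_real_sqrt_3_squared by (simp add: automorphy_def fricke_def field_simps)

lemma automorphy_nonzero: "\<tau> \<in> upper_half \<Longrightarrow> automorphy \<tau> \<noteq> 0"
  using upper_half_nonzero by (auto simp: automorphy_def)

lemma automorphy_holomorphic: "automorphy holomorphic_on S"
  unfolding automorphy_def by (intro holomorphic_intros)

lemma has_field_derivative_automorphy:
  "(automorphy has_field_derivative (- \<i> * of_real (sqrt 3))) (at \<tau>)"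
  unfolding automorphy_def by (auto intro!: derivative_eq_intros)

text \<open>
  These are \<open>b(q)\<^sup>3\<close> and \<open>c(q)\<^sup>3\<close> in the notation of the Borweins, so that
  \<open>\<alpha>\<^sup>\<dagger> = c\<^sup>3 / a\<^sup>3\<close>.
\<close>

definition cube_b :: "complex \<Rightarrow> complex" where
  "cube_b q = euler_phi q ^ 9 / euler_phi (q ^ 3) ^ 3"

definition cube_c :: "complex \<Rightarrow> complex" where
  "cube_c q = 27 * q * euler_phi (q ^ 3) ^ 9 / euler_phi q ^ 3"

lemma cube_in_ball: "(q::complex) \<in> ball 0 1 \<Longrightarrow> q ^ 3 \<in> ball 0 1"
  using power_less_one_iff[of "norm q" 3] by (simp add: norm_power)

lemma euler_phi_cube_holomorphic: "(\<lambda>q. euler_phi (q ^ 3)) holomorphic_on ball 0 1"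
  by (rule holomorphic_on_compose_gen[OF _ euler_phi_holomorphic, unfolded o_def])
    (auto intro!: holomorphic_intros cube_in_ball simp del: mem_ball)

lemma euler_phi_ball_nonzero: "q \<in> ball 0 1 \<Longrightarrow> euler_phi q \<noteq> 0" "q \<in> ball 0 1 \<Longrightarrow> euler_phi (q ^ 3) \<noteq> 0"
  using euler_phi_nonzero[of q] euler_phi_nonzero[of "q ^ 3"] cube_in_ball[of q] by auto

lemma cube_b_holomorphic: "cube_b holomorphic_on ball 0 1"
  unfolding cube_b_def using euler_phi_ball_nonzero
  by (intro holomorphic_intros euler_phi_holomorphic euler_phi_cube_holomorphic) auto

lemma cube_c_holomorphic: "cube_c holomorphic_on ball 0 1"
  unfolding cube_c_def using euler_phi_ball_nonzero
  by (intro holomorphic_intros euler_phi_holomorphic euler_phi_cube_holomorphic) auto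

lemma cube_b_nonzero: "q \<in> ball 0 1 \<Longrightarrow> cube_b q \<noteq> 0"
  unfolding cube_b_def using euler_phi_ball_nonzero by simp

lemma cubic_a_fricke:
  assumes "\<tau> \<in> upper_half"
  shows "cubic_a (nome (fricke \<tau>)) = automorphy \<tau> * cubic_a (nome \<tau>)"
proof (rule fricke_identity_from_imaginary_axis[OF cubic_a_holomorphic cubic_a_holomorphic automorphy_holomorphic _ assms])
  fix y :: real assume "y > 0"
  then show "cubic_a (of_real (exp (- 2 * pi / (3 * y)))) = automorphy (\<i> * of_real y) * cubic_a (of_real (exp (- 2 * pi * y)))"
    using cubic_a_inversion[of y] by (simp only: automorphy_imaginary)
qed

text \<open>Eta inversion at 3 y links q' = exp (- 2 pi / (3 y)) to q^3, and at y it links q'^3 to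
  q. So the roles of the two Euler products in b^3 are exchanged, which gives c^3.\<close>

lemma cube_b_fricke:
  assumes "\<tau> \<in> upper_half"
  shows "cube_b (nome (fricke \<tau>)) = automorphy \<tau> ^ 3 * cube_c (nome \<tau>)"
proof (rule fricke_identity_from_imaginary_axis[OF cube_b_holomorphic cube_c_holomorphic _ _ assms])
  show "(\<lambda>\<tau>. automorphy \<tau> ^ 3) holomorphic_on upper_half" by (intro holomorphic_intros automorphy_holomorphic)
  fix y :: real assume y: "y > 0"
  \<comment> \<open>\<open>E\<close> and \<open>F\<close> are the 24th roots of q' and q that
    complete Euler's product to eta. In the quotient all powers of \<open>E\<close> cancel and F^24
    = q remains, while t^9 = 27 t^3 accounts for the 27 in \<open>cube_c\<close>.\<close>
  define E where "E = complex_of_real (exp (- pi / (36 * y)))"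
  define F where "F = complex_of_real (exp (- pi * y / 12))"
  define q where "q = complex_of_real (exp (- 2 * pi * y))"
  define q' where "q' = complex_of_real (exp (- 2 * pi / (3 * y)))"
  define r where "r = complex_of_real (sqrt y)"
  define t where "t = complex_of_real (sqrt 3)"
  have nz: "E \<noteq> 0" "F \<noteq> 0" "r \<noteq> 0" using y by (simp_all add: E_def F_def r_def)
  have E3: "complex_of_real (exp (- pi / (12 * y))) = E ^ 3"
    unfolding E_def of_real_power[symmetric] exp_of_nat_mult[symmetric] by simp
  have F3: "complex_of_real (exp (- pi * (3 * y) / 12)) = F ^ 3"
    unfolding F_def of_real_power[symmetric] exp_of_nat_mult[symmetric] by simp
  have q24: "q = F ^ 24" unfolding q_def F_def of_real_power[symmetric] exp_of_nat_mult[symmetric] by simp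
  have q3: "complex_of_real (exp (- 2 * pi * (3 * y))) = q ^ 3"
    unfolding q_def of_real_power[symmetric] exp_of_nat_mult[symmetric] by simp
  have q'3: "complex_of_real (exp (- 2 * pi / y)) = q' ^ 3"
    unfolding q'_def of_real_power[symmetric] exp_of_nat_mult[symmetric] by simp
  have "E * euler_phi q' = t * r * (F ^ 3 * euler_phi (q ^ 3))"
    using euler_phi_inversion[of "3 * y"] y unfolding F3 q3 by (simp add: E_def q'_def r_def t_def real_sqrt_mult)
  then have 1: "euler_phi q' = t * r * F ^ 3 * euler_phi (q ^ 3) / E" using nz by (simp add: field_simps)
  have "E ^ 3 * euler_phi (q' ^ 3) = r * (F * euler_phi q)"
    using euler_phi_inversion[of y] y unfolding E3 q'3 by (simp add: F_def q_def r_def)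
  then have 2: "euler_phi (q' ^ 3) = r * F * euler_phi q / E ^ 3" using nz by (simp add: field_simps)
  have q: "q \<in> ball 0 1" using y by (simp add: q_def)
  have t: "t\<^sup>2 = 3" using of_real_sqrt_3_squared by (simp add: t_def power2_eq_square)
  have r: "r\<^sup>2 = of_real y" using y unfolding r_def of_real_power[symmetric] by simp
  have "cube_b q' = (t * r * F ^ 3 * euler_phi (q ^ 3)) ^ 9 / (r * F * euler_phi q) ^ 3"
    unfolding cube_b_def 1 2 using nz by (simp add: power_divide flip: power_mult)
  also have "\<dots> = t ^ 3 * (t\<^sup>2) ^ 3 * (r\<^sup>2) ^ 3 * F ^ 24 * euler_phi (q ^ 3) ^ 9 / euler_phi q ^ 3"
    using nz euler_phi_ball_nonzero[OF q] by (simp add: field_simps eval_nat_numeral)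
  also have "\<dots> = (t * of_real y) ^ 3 * cube_c q"
    unfolding t r cube_c_def q24[symmetric] by (simp add: power_mult_distrib)
  also have "t * of_real y = automorphy (\<i> * of_real y)" by (simp add: automorphy_imaginary t_def)
  finally show "cube_b (of_real (exp (- 2 * pi / (3 * y)))) = automorphy (\<i> * of_real y) ^ 3 * cube_c (of_real (exp (- 2 * pi * y)))"
    by (simp only: q_def q'_def)
qed

lemma cube_c_fricke:
  assumes "\<tau> \<in> upper_half"
  shows "cube_c (nome (fricke \<tau>)) = automorphy \<tau> ^ 3 * cube_b (nome \<tau>)"
  using cube_b_fricke[OF fricke_upper_half[OF assms]] automorphy_nonzero[OF assms] upper_half_nonzero[OF assms]
  by (simp add: automorphy_fricke field_simps)

text \<open>
  The product of \<open>b\<^sup>3\<close> and \<open>c\<^sup>3\<close> has weight 6, a simple zero at the cusp and no other zeros, so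
  dividing a cusp form of weight 6 by it gives a holomorphic invariant function.
\<close>

lemma fricke_weight_6_unique:
  assumes N: "N holomorphic_on ball 0 1" "N 0 = 0"
    and tr: "\<And>\<tau>. \<tau> \<in> upper_half \<Longrightarrow> N (nome (fricke \<tau>)) = automorphy \<tau> ^ 6 * N (nome \<tau>)"
    and q: "q \<in> ball 0 1"
  shows "N q = deriv N 0 / 27 * (cube_b q * cube_c q)"
proof -
  obtain g where g: "g holomorphic_on ball 0 1" "\<And>z. z \<in> ball 0 1 \<Longrightarrow> N z = z * g z" "g 0 = deriv N 0"
    using holomorphic_factor_at_0[OF N(1) _ _ N(2)] by auto
  define P where "P = (\<lambda>q. euler_phi q ^ 6 * euler_phi (q ^ 3) ^ 6)"
  have P0: "P z \<noteq> 0" if "z \<in> ball 0 1" for z using euler_phi_ball_nonzero[OF that] by (simp add: P_def)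
  have bc: "cube_b z * cube_c z = 27 * z * P z" if "z \<in> ball 0 1" for z
    using euler_phi_ball_nonzero[OF that] by (simp add: cube_b_def cube_c_def P_def eval_nat_numeral)
  \<comment> \<open>This is N / (b^3 c^3) with the common factor q cancelled, hence holomorphic at
    the cusp as well.\<close>
  define F where "F = (\<lambda>q. g q / (27 * P q))"
  have F: "F holomorphic_on ball 0 1"
    unfolding F_def using P0 unfolding P_def
    by (intro holomorphic_intros g euler_phi_holomorphic euler_phi_cube_holomorphic) auto
  have NF: "N z = F z * (cube_b z * cube_c z)" if "z \<in> ball 0 1" for z
    using P0[OF that] by (simp add: bc[OF that] g(2)[OF that] F_def)
  have "F q = F 0"
  proof (rule fricke_invariant_constant[OF F _ q])
    fix \<tau> :: complex assume "Im \<tau> > 0"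
    then have \<tau>: "\<tau> \<in> upper_half" by (simp add: upper_half_def)
    define w where "w = nome \<tau>"
    define D where "D = automorphy \<tau> ^ 6 * (cube_b w * cube_c w)"
    have w: "w \<in> ball 0 1" unfolding w_def by (rule nome_upper_half[OF \<tau>])
    have "w \<noteq> 0" by (simp add: w_def)
    then have D0: "D \<noteq> 0" using automorphy_nonzero[OF \<tau>] P0[OF w] by (simp add: D_def bc[OF w])
    have "F (nome (fricke \<tau>)) * (cube_b (nome (fricke \<tau>)) * cube_c (nome (fricke \<tau>))) = automorphy \<tau> ^ 6 * (F w * (cube_b w * cube_c w))"
      using tr[OF \<tau>] NF[OF w] NF[OF nome_upper_half[OF fricke_upper_half[OF \<tau>]]] by (simp add: w_def)
    then have "F (nome (fricke \<tau>)) * D = F w * D"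
      unfolding cube_b_fricke[OF \<tau>] cube_c_fricke[OF \<tau>] D_def w_def by (simp add: eval_nat_numeral mult_ac)
    then show "F (nome (fricke \<tau>)) = F (nome \<tau>)" using D0 by (simp add: w_def)
  qed
  also have "F 0 = deriv N 0 / 27" by (simp add: F_def P_def g(3))
  finally show ?thesis using NF[OF q] by simp
qed

text \<open>Makes the constant in \<open>fricke_weight_6_unique\<close> vanish when that lemma is
  applied to a power.\<close>

lemma deriv_power_at_zero:
  assumes "f holomorphic_on ball 0 1" "f 0 = 0" "n \<ge> 2"
  shows "deriv (\<lambda>q. f q ^ n) 0 = (0 :: complex)"
proof (rule DERIV_imp_deriv)
  have "(f has_field_derivative deriv f 0) (at 0)" using assms by (auto intro: holomorphic_derivI)
  then show "((\<lambda>q. f q ^ n) has_field_derivative 0) (at 0)"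
    using assms(2,3) by (auto intro!: derivative_eq_intros)
qed

text \<open>The involution exchanges b^3 and c^3, so their sum transforms like a^3, with weight 3.
  The difference vanishes at the cusp and its square has weight 6.\<close>

theorem cubic_a_cubed:
  assumes "q \<in> ball 0 1"
  shows "cubic_a q ^ 3 = cube_b q + cube_c q"
proof -
  define f where "f = (\<lambda>q. cubic_a q ^ 3 - (cube_b q + cube_c q))"
  have f: "f holomorphic_on ball 0 1" unfolding f_def
    by (intro holomorphic_intros cubic_a_holomorphic cube_b_holomorphic cube_c_holomorphic)
  have f0: "f 0 = 0" by (simp add: f_def cube_b_def cube_c_def)
  have "f q ^ 2 = deriv (\<lambda>q. f q ^ 2) 0 / 27 * (cube_b q * cube_c q)"
  proof (rule fricke_weight_6_unique[OF _ _ _ assms])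
    fix \<tau> assume \<tau>: "\<tau> \<in> upper_half"
    have "f (nome (fricke \<tau>)) = automorphy \<tau> ^ 3 * f (nome \<tau>)"
      unfolding f_def cubic_a_fricke[OF \<tau>] cube_b_fricke[OF \<tau>] cube_c_fricke[OF \<tau>]
      by (simp add: power_mult_distrib algebra_simps)
    then show "f (nome (fricke \<tau>)) ^ 2 = automorphy \<tau> ^ 6 * f (nome \<tau>) ^ 2"
      by (simp add: power_mult_distrib flip: power_mult)
  qed (use f f0 in \<open>auto intro!: holomorphic_intros\<close>)
  then show ?thesis using deriv_power_at_zero[OF f f0, of 2] by (simp add: f_def)
qed

text \<open>
  In terms of the paper's \<open>\<alpha>\<^sup>\<dagger>\<close>, \<open>cubic_u\<close> is \<open>\<alpha>\<^sup>\<dagger> / (1 - \<alpha>\<^sup>\<dagger>)\<close>, and below \<open>cubic_X\<close> is \<open>X\<^sup>\<dagger>\<close>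
  and \<open>cubic_r\<close> is \<open>b\<^sup>\<dagger>\<close>.
\<close>

definition cubic_u :: "complex \<Rightarrow> complex" where "cubic_u q = cube_c q / cube_b q"

lemma cubic_u_holomorphic: "cubic_u holomorphic_on ball 0 1"
  unfolding cubic_u_def using cube_b_nonzero by (intro holomorphic_intros cube_b_holomorphic cube_c_holomorphic) auto

lemma cubic_u_eq: "q \<in> ball 0 1 \<Longrightarrow> cubic_u q = 27 * q * (euler_phi (q ^ 3) / euler_phi q) ^ 12"
proof -
  have "27 * q * v ^ 9 / p ^ 3 / (p ^ 9 / v ^ 3) = 27 * q * (v / p) ^ 12" if "p \<noteq> 0" "v \<noteq> 0" for p v :: complex
  proof -
    have "v ^ 12 = v ^ 9 * v ^ 3" "p ^ 12 = p ^ 3 * p ^ 9" by (simp_all flip: power_add)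
    then show ?thesis using that by (simp add: power_divide)
  qed
  then show ?thesis if "q \<in> ball 0 1"
    using euler_phi_ball_nonzero[OF that] by (simp add: cubic_u_def cube_b_def cube_c_def)
qed

lemma cubic_u_0 [simp]: "cubic_u 0 = 0" by (simp add: cubic_u_def cube_c_def)

lemma cubic_u_nonzero: "q \<in> ball 0 1 \<Longrightarrow> q \<noteq> 0 \<Longrightarrow> cubic_u q \<noteq> 0"
  using euler_phi_ball_nonzero[of q] by (simp add: cubic_u_eq)

lemma cubic_u_fricke: "\<tau> \<in> upper_half \<Longrightarrow> cubic_u (nome (fricke \<tau>)) = 1 / cubic_u (nome \<tau>)"
  using automorphy_nonzero by (simp add: cubic_u_def cube_b_fricke cube_c_fricke)

text \<open>The logarithmic derivative \<open>q u'(q) / u(q)\<close> of \<open>cubic_u\<close>, extended to \<open>q = 0\<close>.\<close>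

definition cubic_e :: "complex \<Rightarrow> complex" where
  "cubic_e q = 1 + 12 * q * (deriv (\<lambda>q. euler_phi (q ^ 3)) q / euler_phi (q ^ 3) - deriv euler_phi q / euler_phi q)"

lemma cubic_e_holomorphic: "cubic_e holomorphic_on ball 0 1"
  unfolding cubic_e_def using euler_phi_ball_nonzero
  by (intro holomorphic_intros euler_phi_holomorphic euler_phi_cube_holomorphic holomorphic_deriv) auto

lemma theta_cubic_u_cubic_e:
  assumes q: "q \<in> ball 0 1"
  shows "q * deriv cubic_u q = cubic_e q * cubic_u q"
proof -
  define f where "f = (\<lambda>q. euler_phi (q ^ 3))"
  have f: "(f has_field_derivative deriv f q) (at q)"
    unfolding f_def by (rule holomorphic_derivI[OF euler_phi_cube_holomorphic _ q]) simp
  have p: "(euler_phi has_field_derivative deriv euler_phi q) (at q)"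
    by (rule holomorphic_derivI[OF euler_phi_holomorphic _ q]) simp
  have nz: "euler_phi q \<noteq> 0" "f q \<noteq> 0" using euler_phi_ball_nonzero[OF q] by (auto simp: f_def)
  have "((\<lambda>q. 27 * q * (f q / euler_phi q) ^ 12) has_field_derivative
      27 * (f q / euler_phi q) ^ 12 + 27 * q * (12 * (f q / euler_phi q) ^ 11 * ((deriv f q * euler_phi q - f q * deriv euler_phi q) / (euler_phi q * euler_phi q)))) (at q)"
    using nz by (auto intro!: derivative_eq_intros f p)
  then have "(cubic_u has_field_derivative
      27 * (f q / euler_phi q) ^ 12 + 27 * q * (12 * (f q / euler_phi q) ^ 11 * ((deriv f q * euler_phi q - f q * deriv euler_phi q) / (euler_phi q * euler_phi q)))) (at q)"
    by (rule has_field_derivative_transform_within_open[OF _ open_ball q]) (simp add: cubic_u_eq f_def)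
  then have d: "deriv cubic_u q = 27 * (f q / euler_phi q) ^ 12 + 27 * q * (12 * (f q / euler_phi q) ^ 11 * ((deriv f q * euler_phi q - f q * deriv euler_phi q) / (euler_phi q * euler_phi q)))"
    by (rule DERIV_imp_deriv)
  \<comment> \<open>One of the twelve factors is split off, so that the eleventh power enters the
    following field identity only as an opaque \<open>R\<close>.\<close>
  have "(f q / euler_phi q) ^ 12 = (f q / euler_phi q) ^ 11 * (f q / euler_phi q)"
    using power_Suc2[of "f q / euler_phi q" 11] by simp
  moreover have "q * (27 * (R * (F / p)) + 27 * q * (12 * R * ((F' * p - F * p') / (p * p)))) =
      (1 + 12 * q * (F' / F - p' / p)) * (27 * q * (R * (F / p)))"
    if "p \<noteq> 0" "F \<noteq> 0" for R F p F' p' :: complex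
    using that by (simp add: field_simps)
  ultimately show ?thesis
    unfolding d cubic_e_def cubic_u_eq[OF q] f_def[symmetric] fun_cong[OF f_def, symmetric] using nz by metis
qed

text \<open>The involution sends u to 1/u, which reverses the sign of the logarithmic derivative; 3
  \<tau>^2 = - \<open>automorphy \<tau> ^ 2\<close> reverses it back, leaving weight 2.\<close>

lemma cubic_e_fricke:
  assumes \<tau>: "\<tau> \<in> upper_half"
  shows "cubic_e (nome (fricke \<tau>)) = automorphy \<tau> ^ 2 * cubic_e (nome \<tau>)"
proof -
  define w where "w = nome \<tau>"
  have w: "w \<in> ball 0 1" unfolding w_def by (rule nome_upper_half[OF \<tau>])
  have u0: "cubic_u w \<noteq> 0" by (rule cubic_u_nonzero[OF w]) (simp add: w_def)
  have "((\<lambda>\<tau>. cubic_u (nome \<tau>)) has_field_derivative 2 * pi * \<i> * (cubic_e w * cubic_u w)) (at \<tau>)"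
    using has_field_derivative_nome[OF cubic_u_holomorphic \<tau>] theta_cubic_u_cubic_e[OF w] by (simp add: w_def)
  then have "((\<lambda>\<tau>. 1 / cubic_u (nome \<tau>)) has_field_derivative - (2 * pi * \<i> * cubic_e w) / cubic_u w) (at \<tau>)"
    using u0 by (auto intro!: derivative_eq_intros simp: w_def)
  from theta_derivative_at_fricke[OF cubic_u_holomorphic cubic_u_fricke \<tau> this]
  have "cubic_e (nome (fricke \<tau>)) * cubic_u (nome (fricke \<tau>)) = - 3 * \<tau>\<^sup>2 * cubic_e w / cubic_u w"
    using theta_cubic_u_cubic_e[OF nome_upper_half[OF fricke_upper_half[OF \<tau>]]] by simp
  then show ?thesis using u0 unfolding cubic_u_fricke[OF \<tau>] automorphy_squared w_def by (simp add: field_simps)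
qed

text \<open>Both sides have weight 2 and the value 1 at the cusp; the cube of their difference has
  weight 6.\<close>

theorem cubic_a_squared:
  assumes "q \<in> ball 0 1"
  shows "cubic_a q ^ 2 = cubic_e q"
proof -
  define f where "f = (\<lambda>q. cubic_a q ^ 2 - cubic_e q)"
  have f: "f holomorphic_on ball 0 1" unfolding f_def
    by (intro holomorphic_intros cubic_a_holomorphic cubic_e_holomorphic)
  have f0: "f 0 = 0" by (simp add: f_def cubic_e_def)
  have "f q ^ 3 = deriv (\<lambda>q. f q ^ 3) 0 / 27 * (cube_b q * cube_c q)"
  proof (rule fricke_weight_6_unique[OF _ _ _ assms])
    fix \<tau> assume \<tau>: "\<tau> \<in> upper_half"
    have "f (nome (fricke \<tau>)) = automorphy \<tau> ^ 2 * f (nome \<tau>)"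
      unfolding f_def cubic_a_fricke[OF \<tau>] cubic_e_fricke[OF \<tau>]
      by (simp add: power_mult_distrib algebra_simps)
    then show "f (nome (fricke \<tau>)) ^ 3 = automorphy \<tau> ^ 6 * f (nome \<tau>) ^ 3"
      by (simp add: power_mult_distrib flip: power_mult)
  qed (use f f0 in \<open>auto intro!: holomorphic_intros\<close>)
  then show ?thesis using deriv_power_at_zero[OF f f0, of 3] by (simp add: f_def)
qed

definition theta_a :: "complex \<Rightarrow> complex" where "theta_a q = q * deriv cubic_a q"

lemma theta_a_holomorphic: "theta_a holomorphic_on ball 0 1"
  unfolding theta_a_def by (intro holomorphic_intros holomorphic_deriv cubic_a_holomorphic) auto

text \<open>The summand with \<open>cubic_a\<close> is the derivative of the weight factor:
  \<theta>a is not modular. This defect must cancel in the differential equation below, and it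
  becomes the 1/pi of the final formula.\<close>

lemma theta_a_fricke:
  assumes \<tau>: "\<tau> \<in> upper_half"
  shows "theta_a (nome (fricke \<tau>)) = 3 * \<tau>\<^sup>2 * (- \<i> * complex_of_real (sqrt 3) * cubic_a (nome \<tau>)
    + automorphy \<tau> * (2 * complex_of_real pi * \<i> * theta_a (nome \<tau>))) / (2 * complex_of_real pi * \<i>)"
proof -
  have "((\<lambda>\<tau>. automorphy \<tau> * cubic_a (nome \<tau>)) has_field_derivative
      (- \<i> * complex_of_real (sqrt 3) * cubic_a (nome \<tau>)
        + automorphy \<tau> * (2 * complex_of_real pi * \<i> * theta_a (nome \<tau>)))) (at \<tau>)"
    using has_field_derivative_nome[OF cubic_a_holomorphic \<tau>]
    by (auto intro!: derivative_eq_intros has_field_derivative_automorphy simp: theta_a_def)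
  from theta_derivative_at_fricke[OF cubic_a_holomorphic cubic_a_fricke \<tau> this]
  show ?thesis by (simp add: theta_a_def)
qed

text \<open>The left side is half the second Rankin-Cohen bracket of a with itself. For a form of
  weight 1 the coefficient - 2 is the one that makes it modular, of weight 1 + 1 + 4 = 6.\<close>

theorem cubic_a_differential_equation:
  assumes "q \<in> ball 0 1"
  shows "cubic_a q * (q * deriv theta_a q) - 2 * (theta_a q)\<^sup>2 = 2 / 9 * (cube_b q * cube_c q)"
proof -
  define N where "N = (\<lambda>q. cubic_a q * (q * deriv theta_a q) - 2 * (theta_a q)\<^sup>2)"
  have hol: "N holomorphic_on ball 0 1" unfolding N_def
    by (intro holomorphic_intros holomorphic_deriv theta_a_holomorphic cubic_a_holomorphic) auto
  have "N q = deriv N 0 / 27 * (cube_b q * cube_c q)"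
  proof (rule fricke_weight_6_unique[OF hol _ _ assms])
    show "N 0 = 0" by (simp add: N_def theta_a_def)
    fix \<tau> assume \<tau>: "\<tau> \<in> upper_half"
    define P where "P = 2 * complex_of_real pi * \<i>"
    define j where "j = automorphy \<tau>"
    define k where "k = - \<i> * complex_of_real (sqrt 3)"
    define A where "A = cubic_a (nome \<tau>)"
    define B where "B = theta_a (nome \<tau>)"
    define C where "C = nome \<tau> * deriv theta_a (nome \<tau>)"
    have P0: "P \<noteq> 0" by (simp add: P_def)
    have \<tau>0: "\<tau> \<noteq> 0" using upper_half_nonzero[OF \<tau>] .
    have j: "j = k * \<tau>" by (simp add: j_def k_def automorphy_def)
    have dA: "((\<lambda>\<tau>. cubic_a (nome \<tau>)) has_field_derivative P * theta_a (nome \<sigma>)) (at \<sigma>)" if "\<sigma> \<in> upper_half" for \<sigma>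
      using has_field_derivative_nome[OF cubic_a_holomorphic that] by (simp add: theta_a_def P_def)
    have dB: "((\<lambda>\<tau>. theta_a (nome \<tau>)) has_field_derivative P * C) (at \<tau>)"
      using has_field_derivative_nome[OF theta_a_holomorphic \<tau>] by (simp add: C_def P_def)
    have dj: "(automorphy has_field_derivative k) (at \<sigma>)" for \<sigma>
      unfolding k_def by (rule has_field_derivative_automorphy)
    have B_fricke: "theta_a (nome (fricke \<sigma>)) = 3 * \<sigma>\<^sup>2 * (k * cubic_a (nome \<sigma>) + automorphy \<sigma> * (P * theta_a (nome \<sigma>))) / P"
      if \<sigma>: "\<sigma> \<in> upper_half" for \<sigma>
      using theta_a_fricke[OF \<sigma>] by (simp only: P_def k_def)
    have "((\<lambda>\<sigma>. 3 * \<sigma>\<^sup>2 * (k * cubic_a (nome \<sigma>) + automorphy \<sigma> * (P * theta_a (nome \<sigma>))) / P) has_field_derivative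
        (6 * \<tau> * (k * A + j * (P * B)) + 3 * \<tau>\<^sup>2 * (k * (P * B) + (k * (P * B) + j * (P * (P * C))))) / P) (at \<tau>)"
      unfolding A_def B_def j_def
      by (rule DERIV_cdivide) (auto intro!: derivative_eq_intros dj dA dB \<tau> simp: algebra_simps)
    from theta_derivative_at_fricke[OF theta_a_holomorphic B_fricke \<tau> this]
    have C_fricke: "nome (fricke \<tau>) * deriv theta_a (nome (fricke \<tau>)) =
        3 * \<tau>\<^sup>2 * ((6 * \<tau> * (k * A + j * (P * B)) + 3 * \<tau>\<^sup>2 * (k * (P * B) + (k * (P * B) + j * (P * (P * C))))) / P) / P"
      by (simp add: P_def)
    have "N (nome (fricke \<tau>)) =
      j * A * (3 * \<tau>\<^sup>2 * ((6 * \<tau> * (k * A + j * (P * B)) + 3 * \<tau>\<^sup>2 * (k * (P * B) + (k * (P * B) + j * (P * (P * C))))) / P) / P)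
      - 2 * (3 * \<tau>\<^sup>2 * (k * A + j * (P * B)) / P)\<^sup>2"
      unfolding N_def C_fricke cubic_a_fricke[OF \<tau>] B_fricke[OF \<tau>] A_def B_def j_def ..
    \<comment> \<open>With j = k \<tau> the terms in A^2 and in A B, which stem from the derivative
      of the weight factor, cancel.\<close>
    also have "\<dots> = (- 3 * \<tau>\<^sup>2)\<^sup>2 * (j\<^sup>2 * (A * C - 2 * B\<^sup>2))"
      unfolding j using P0 by (simp add: field_simps power2_eq_square)
    also have "\<dots> = automorphy \<tau> ^ 6 * N (nome \<tau>)"
      unfolding automorphy_squared[symmetric] N_def A_def B_def C_def j_def
      by (simp add: power2_eq_square eval_nat_numeral)
    finally show "N (nome (fricke \<tau>)) = automorphy \<tau> ^ 6 * N (nome \<tau>)" .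
  qed
  \<comment> \<open>Both \<theta>a and its \<theta>-derivative begin with 6 q, and a(0) = 1; the
    square of \<theta>a does not contribute to first order.\<close>
  moreover have "deriv N 0 = 6"
  proof -
    have t: "(theta_a has_field_derivative 6) (at 0)"
    proof -
      have "(deriv cubic_a has_field_derivative deriv (deriv cubic_a) 0) (at 0)"
        by (rule holomorphic_derivI[of _ "ball 0 1"]) (auto intro!: holomorphic_deriv cubic_a_holomorphic)
      then have "((\<lambda>q. q * deriv cubic_a q) has_field_derivative 6) (at 0)"
        by (auto intro!: derivative_eq_intros simp: deriv_cubic_a_0)
      then show ?thesis unfolding theta_a_def[abs_def] .
    qed
    have dt: "(deriv theta_a has_field_derivative deriv (deriv theta_a) 0) (at 0)"
      by (rule holomorphic_derivI[of _ "ball 0 1"]) (auto intro!: holomorphic_deriv theta_a_holomorphic)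
    have a: "(cubic_a has_field_derivative 6) (at 0)"
      using holomorphic_derivI[OF cubic_a_holomorphic, of 0] by (simp add: deriv_cubic_a_0)
    have "deriv theta_a 0 = 6" by (rule DERIV_imp_deriv[OF t])
    moreover have "theta_a 0 = 0" by (simp add: theta_a_def)
    ultimately have "(N has_field_derivative 6) (at 0)"
      unfolding N_def by (auto intro!: derivative_eq_intros t dt a)
    then show ?thesis by (rule DERIV_imp_deriv)
  qed
  ultimately have "N q = 6 / 27 * (cube_b q * cube_c q)" by simp
  also have "(6 / 27 :: complex) = 2 / 9" by simp
  finally show ?thesis by (simp only: N_def)
qed

section \<open>The hypergeometric equation\<close>

definition hyper_coeff :: "nat \<Rightarrow> complex" where
  "hyper_coeff k = pochhammer (1 / 2) k * pochhammer (1 / 3) k * pochhammer (2 / 3) k / fact k ^ 3"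

lemma hyper_coeff_Suc:
  "hyper_coeff (Suc k) * of_nat (Suc k) ^ 3 = hyper_coeff k * ((of_nat k + 1/2) * (of_nat k + 1/3) * (of_nat k + 2/3))"
proof -
  have "(of_nat (Suc k) :: complex) \<noteq> 0" "(fact k :: complex) \<noteq> 0" by (simp_all del: of_nat_Suc)
  then show ?thesis
    unfolding hyper_coeff_def pochhammer_Suc fact_Suc by (simp add: power_mult_distrib add_ac del: of_nat_Suc)
qed

lemma norm_hyper_coeff_le: "norm (hyper_coeff k) \<le> 1"
proof (induction k)
  case (Suc k)
  have m: "(real k + 1/2) * (real k + 1/3) * (real k + 2/3) \<le> (real k + 1) * (real k + 1) * (real k + 1)"
    by (intro mult_mono) auto
  have n: "norm (of_nat k + of_real a :: complex) = real k + a" if "a \<ge> 0" for a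
  proof -
    have "of_nat k + of_real a = (of_real (real k + a) :: complex)" by simp
    then show ?thesis using that by (simp only: norm_of_real)
  qed
  have "norm (hyper_coeff (Suc k)) * real (Suc k) ^ 3 = norm (hyper_coeff k) * ((real k + 1/2) * (real k + 1/3) * (real k + 2/3))"
    using arg_cong[OF hyper_coeff_Suc[of k], of norm] n[of "1/2"] n[of "1/3"] n[of "2/3"]
    by (simp add: norm_mult norm_power del: of_nat_Suc)
  also have "\<dots> \<le> 1 * ((real k + 1/2) * (real k + 1/3) * (real k + 2/3))"
    using Suc by (intro mult_right_mono) auto
  also have "\<dots> \<le> 1 * real (Suc k) ^ 3"
    using m by (simp add: power3_eq_cube add_ac)
  finally show ?case by (rule mult_right_le_imp_le) simp
qed (simp add: hyper_coeff_def)

definition hyper_fps :: "complex fps" where "hyper_fps = Abs_fps hyper_coeff"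

lemma fps_conv_radius_hyper_fps: "fps_conv_radius hyper_fps \<ge> 1"
  unfolding fps_conv_radius_def
proof (rule conv_radius_geI_ex')
  fix r :: real assume r: "0 < r" "ereal r < 1"
  show "summable (\<lambda>n. fps_nth hyper_fps n * of_real r ^ n)"
  proof (rule summable_comparison_test'[where N = 0])
    show "summable (\<lambda>n. r ^ n)" using r by (intro summable_geometric) simp
    show "norm (fps_nth hyper_fps n * of_real r ^ n) \<le> r ^ n" for n
      using mult_right_mono[OF norm_hyper_coeff_le[of n], of "r ^ n"] r
      by (simp add: hyper_fps_def norm_mult norm_power)
  qed
qed

lemma norm_less_hyper_conv_radius: "norm x < 1 \<Longrightarrow> ereal (norm x) < fps_conv_radius hyper_fps"
  using fps_conv_radius_hyper_fps by (metis ereal_less(3) less_le_trans one_ereal_def)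

text \<open>
  With \<open>\<theta> = x d/dx\<close> the hypothesis reads
  \<open>\<theta>\<^sup>3 Y = x (\<theta> + 1/2) (\<theta> + 1/3) (\<theta> + 2/3) Y\<close>, the equation whose only power series solution
  with \<open>Y 0 = 1\<close> is the hypergeometric series.
\<close>

lemma hypergeometric_equation_unique:
  fixes Y Y1 Y2 Y3 :: "complex \<Rightarrow> complex"
  assumes e: "e > 0" and hol: "Y holomorphic_on ball 0 e" and "Y 0 = 1"
    and Y1: "\<And>x. x \<in> ball 0 e \<Longrightarrow> Y1 x = x * deriv Y x"
    and Y2: "\<And>x. x \<in> ball 0 e \<Longrightarrow> Y2 x = x * deriv Y1 x"
    and Y3: "\<And>x. x \<in> ball 0 e \<Longrightarrow> Y3 x = x * deriv Y2 x"
    and ode: "\<And>x. x \<in> ball 0 e \<Longrightarrow> (1 - x) * Y3 x = x * (3/2 * Y2 x + 13/18 * Y1 x + 1/9 * Y x)"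
  shows "Y has_fps_expansion hyper_fps"
proof -
  have ev: "eventually (\<lambda>x. f x = g x) (nhds 0)" if "\<And>x. x \<in> ball 0 e \<Longrightarrow> f x = g x" for f g :: "complex \<Rightarrow> complex"
    using that e by (auto intro!: eventually_nhds_in_open[of "ball 0 e" 0, THEN eventually_mono])
  define F where "F = fps_expansion Y 0"
  have F: "Y has_fps_expansion F" unfolding F_def
    by (intro analytic_at_imp_has_fps_expansion_0 analytic_at[THEN iffD2] exI[of _ "ball 0 e"]) (use e hol in auto)
  define F1 where "F1 = fps_X * fps_deriv F"
  define F2 where "F2 = fps_X * fps_deriv F1"
  define F3 where "F3 = fps_X * fps_deriv F2"
  have step: "g has_fps_expansion fps_X * fps_deriv G"
    if "f has_fps_expansion G" "\<And>x. x \<in> ball 0 e \<Longrightarrow> g x = x * deriv f x" for f g :: "complex \<Rightarrow> complex" and G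
  proof -
    have "(\<lambda>x. x * deriv f x) has_fps_expansion fps_X * fps_deriv G"
      by (intro fps_expansion_intros that(1))
    then show ?thesis using has_fps_expansion_cong[OF ev[of g "\<lambda>x. x * deriv f x"] refl] that(2) by blast
  qed
  have F1: "Y1 has_fps_expansion F1" unfolding F1_def by (rule step[OF F Y1])
  have F2: "Y2 has_fps_expansion F2" unfolding F2_def by (rule step[OF F1 Y2])
  have F3: "Y3 has_fps_expansion F3" unfolding F3_def by (rule step[OF F2 Y3])
  have "(\<lambda>x. (1 - x) * Y3 x) has_fps_expansion (1 - fps_X) * F3"
    by (intro fps_expansion_intros F3)
  moreover have "(\<lambda>x. x * (3/2 * Y2 x + 13/18 * Y1 x + 1/9 * Y x)) has_fps_expansion
      fps_X * (fps_const (3/2) * F2 + fps_const (13/18) * F1 + fps_const (1/9) * F)"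
    by (intro fps_expansion_intros F F1 F2)
  then have "(\<lambda>x. (1 - x) * Y3 x) has_fps_expansion
      fps_X * (fps_const (3/2) * F2 + fps_const (13/18) * F1 + fps_const (1/9) * F)"
    using has_fps_expansion_cong[OF ev[of "\<lambda>x. (1 - x) * Y3 x" "\<lambda>x. x * (3/2 * Y2 x + 13/18 * Y1 x + 1/9 * Y x)", OF ode] refl]
    by blast
  ultimately have eq: "(1 - fps_X) * F3 = fps_X * (fps_const (3/2) * F2 + fps_const (13/18) * F1 + fps_const (1/9) * F)"
    by (rule fps_expansion_unique_complex)
  have n1: "fps_nth F1 n = of_nat n * fps_nth F n" for n by (cases n) (simp_all add: F1_def)
  have n2: "fps_nth F2 n = of_nat n ^ 2 * fps_nth F n" for n by (cases n) (simp_all add: F2_def n1 power2_eq_square)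
  have n3: "fps_nth F3 n = of_nat n ^ 3 * fps_nth F n" for n by (cases n) (simp_all add: F3_def n2 power2_eq_square power3_eq_cube)
  have rec: "of_nat (Suc k) ^ 3 * fps_nth F (Suc k) = ((of_nat k + 1/2) * (of_nat k + 1/3) * (of_nat k + 2/3)) * fps_nth F k" for k
  proof -
    have "fps_nth ((1 - fps_X) * F3) (Suc k) = fps_nth F3 (Suc k) - fps_nth F3 k"
      by (simp add: left_diff_distrib)
    then have "fps_nth F3 (Suc k) - fps_nth F3 k = 3/2 * fps_nth F2 k + 13/18 * fps_nth F1 k + 1/9 * fps_nth F k"
      unfolding eq by simp
    then have "of_nat (Suc k) ^ 3 * fps_nth F (Suc k) = (of_nat k ^ 3 + 3/2 * of_nat k ^ 2 + 13/18 * of_nat k + 1/9) * fps_nth F k"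
      unfolding n1 n2 n3 by (simp add: algebra_simps del: of_nat_Suc)
    also have "(of_nat k ^ 3 + 3/2 * of_nat k ^ 2 + 13/18 * of_nat k + 1/9 :: complex) = (of_nat k + 1/2) * (of_nat k + 1/3) * (of_nat k + 2/3)"
      by (simp add: power2_eq_square power3_eq_cube field_simps)
    finally show ?thesis .
  qed
  have "fps_nth F k = hyper_coeff k" for k
  proof (induction k)
    case 0
    have "fps_nth F 0 = Y 0" using has_fps_expansion_imp_0_eq_fps_nth_0[OF F] by simp
    then show ?case using \<open>Y 0 = 1\<close> by (simp add: hyper_coeff_def)
  next
    case (Suc k)
    have "(of_nat (Suc k) :: complex) ^ 3 \<noteq> 0" by (simp del: of_nat_Suc)
    then show ?case using rec[of k] hyper_coeff_Suc[of k] Suc by (metis mult.commute mult_cancel_left)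
  qed
  then have "F = hyper_fps" by (simp add: fps_eq_iff hyper_fps_def)
  with F show ?thesis by simp
qed

section \<open>X as a local coordinate at the cusp\<close>

definition cubic_X :: "complex \<Rightarrow> complex" where "cubic_X q = 4 * cubic_u q / (1 + cubic_u q)\<^sup>2"

definition cubic_r :: "complex \<Rightarrow> complex" where "cubic_r q = (1 - cubic_u q) / (1 + cubic_u q)"

text \<open>Since a^3 = b^3 (1 + u) and b^3 has no zeros, these are the points of the disc where a
  does not vanish.\<close>

definition cubic_domain :: "complex set" where "cubic_domain = {q \<in> ball 0 1. 1 + cubic_u q \<noteq> 0}"

lemma cubic_domain_subset: "cubic_domain \<subseteq> ball 0 1" by (auto simp: cubic_domain_def)

lemma cubic_domain_0: "0 \<in> cubic_domain" by (simp add: cubic_domain_def)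

lemma open_cubic_domain: "open cubic_domain"
proof -
  have "continuous_on (ball 0 1) (\<lambda>q. 1 + cubic_u q)"
    by (intro continuous_intros holomorphic_on_imp_continuous_on cubic_u_holomorphic)
  then have "open (ball 0 1 \<inter> (\<lambda>q. 1 + cubic_u q) -` (- {0}))"
    by (rule continuous_open_preimage) auto
  moreover have "ball 0 1 \<inter> (\<lambda>q. 1 + cubic_u q) -` (- {0}) = cubic_domain" by (auto simp: cubic_domain_def)
  ultimately show ?thesis by simp
qed

lemma cubic_X_holomorphic: "cubic_X holomorphic_on cubic_domain"
  unfolding cubic_X_def using cubic_domain_subset
  by (intro holomorphic_intros holomorphic_on_subset[OF cubic_u_holomorphic]) (auto simp: cubic_domain_def)

lemma cubic_r_holomorphic: "cubic_r holomorphic_on cubic_domain"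
  unfolding cubic_r_def using cubic_domain_subset
  by (intro holomorphic_intros holomorphic_on_subset[OF cubic_u_holomorphic]) (auto simp: cubic_domain_def)

lemma cubic_r_squared: "q \<in> cubic_domain \<Longrightarrow> (cubic_r q)\<^sup>2 = 1 - cubic_X q"
proof -
  assume "q \<in> cubic_domain"
  then have "1 - 4 * cubic_u q / (1 + cubic_u q)\<^sup>2 = ((1 + cubic_u q)\<^sup>2 - 4 * cubic_u q) / (1 + cubic_u q)\<^sup>2"
    by (simp add: cubic_domain_def diff_divide_distrib)
  also have "(1 + cubic_u q)\<^sup>2 - 4 * cubic_u q = (1 - cubic_u q)\<^sup>2" by (simp add: power2_eq_square algebra_simps)
  finally show ?thesis by (simp add: cubic_r_def cubic_X_def power_divide)
qed

lemma cube_b_eq: "q \<in> cubic_domain \<Longrightarrow> cube_b q = cubic_a q ^ 3 / (1 + cubic_u q)"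
  using cubic_a_cubed[of q] cube_b_nonzero[of q] by (auto simp: cubic_domain_def cubic_u_def field_simps)

lemma cubic_a_nonzero: "q \<in> cubic_domain \<Longrightarrow> cubic_a q \<noteq> 0"
  using cube_b_eq[of q] cube_b_nonzero[of q] by (auto simp: cubic_domain_def)

lemma cube_b_cube_c_eq: "q \<in> cubic_domain \<Longrightarrow> cube_b q * cube_c q = cubic_a q ^ 6 * cubic_X q / 4"
proof -
  assume q: "q \<in> cubic_domain"
  then have "cube_b q \<noteq> 0" using cube_b_nonzero cubic_domain_subset by blast
  then have "cube_c q = cube_b q * cubic_u q" by (simp add: cubic_u_def)
  then have "cube_b q * cube_c q = (cube_b q)\<^sup>2 * cubic_u q" by (simp add: power2_eq_square)
  then show ?thesis unfolding cube_b_eq[OF q] cubic_X_def by (simp add: power_divide flip: power_mult)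
qed

lemma theta_cubic_u: "q \<in> ball 0 1 \<Longrightarrow> q * deriv cubic_u q = (cubic_a q)\<^sup>2 * cubic_u q"
  using theta_cubic_u_cubic_e cubic_a_squared by simp

text \<open>Combines \<theta>u = a^2 u with u dX/du = X (1 - u) / (1 + u).\<close>

lemma theta_cubic_X:
  assumes q: "q \<in> cubic_domain"
  shows "q * deriv cubic_X q = (cubic_a q)\<^sup>2 * cubic_r q * cubic_X q"
proof -
  have q1: "q \<in> ball 0 1" and nz: "1 + cubic_u q \<noteq> 0" using q by (auto simp: cubic_domain_def)
  have u: "(cubic_u has_field_derivative deriv cubic_u q) (at q)"
    by (rule holomorphic_derivI[OF cubic_u_holomorphic _ q1]) simp
  have "(cubic_X has_field_derivative
      (4 * deriv cubic_u q * (1 + cubic_u q)\<^sup>2 - 4 * cubic_u q * (2 * (1 + cubic_u q) * deriv cubic_u q)) / ((1 + cubic_u q)\<^sup>2 * (1 + cubic_u q)\<^sup>2)) (at q)"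
    unfolding cubic_X_def using nz by (auto intro!: derivative_eq_intros u)
  then have d: "deriv cubic_X q = (4 * deriv cubic_u q * (1 + cubic_u q)\<^sup>2 - 4 * cubic_u q * (2 * (1 + cubic_u q) * deriv cubic_u q)) / ((1 + cubic_u q)\<^sup>2 * (1 + cubic_u q)\<^sup>2)"
    by (rule DERIV_imp_deriv)
  have "q * ((4 * D * s\<^sup>2 - 4 * u * (2 * s * D)) / (s\<^sup>2 * s\<^sup>2)) = 4 * (q * D) * (s - 2 * u) / s ^ 3" if "s \<noteq> 0" for s u D :: complex
    using that by (simp add: field_simps power2_eq_square power3_eq_cube)
  from this[OF nz] have "q * deriv cubic_X q = 4 * (q * deriv cubic_u q) * (1 - cubic_u q) / (1 + cubic_u q) ^ 3"
    unfolding d by simp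
  then show ?thesis unfolding theta_cubic_u[OF q1] cubic_r_def cubic_X_def[of q]
    by (simp add: power2_eq_square power3_eq_cube mult_ac)
qed

lemma cubic_X_0 [simp]: "cubic_X 0 = 0" by (simp add: cubic_X_def)

text \<open>X = 108 q + ..., which makes X locally invertible at the cusp.\<close>

lemma deriv_cubic_X_0: "deriv cubic_X 0 \<noteq> 0"
proof -
  define w where "w = (\<lambda>q. (euler_phi (q ^ 3) / euler_phi q) ^ 12)"
  have "w holomorphic_on ball 0 1" unfolding w_def using euler_phi_ball_nonzero
    by (intro holomorphic_intros euler_phi_holomorphic euler_phi_cube_holomorphic) auto
  then have w: "(w has_field_derivative deriv w 0) (at 0)" by (rule holomorphic_derivI) auto
  have "w 0 = 1" by (simp add: w_def)
  then have "((\<lambda>q. 27 * q * w q) has_field_derivative 27) (at 0)"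
    by (auto intro!: derivative_eq_intros w)
  then have "(cubic_u has_field_derivative 27) (at 0)"
    by (rule has_field_derivative_transform_within_open[OF _ open_ball[of 0 1]]) (auto simp: cubic_u_eq w_def)
  then have "(cubic_X has_field_derivative 108) (at 0)"
    unfolding cubic_X_def by (auto intro!: derivative_eq_intros)
  then show ?thesis by (simp add: DERIV_imp_deriv)
qed

text \<open>With x = X(q) as the variable, the functions a, v = \<theta>a / a^2 and r are closed
  under x d/dx: x a' = v / r, x v' = a x / (18 r) and x r' = - x / (2 r). Together with r^2 = 1 - x
  these rules reduce the third-order equation for a^2 to an identity of rational functions.\<close>

theorem cubic_a_squared_hypergeometric_near_0:
  "\<forall>\<^sub>F q in nhds 0. eval_fps hyper_fps (cubic_X q) = (cubic_a q)\<^sup>2"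
proof -
  obtain \<rho> where \<rho>: "\<rho> > 0" "ball 0 \<rho> \<subseteq> cubic_domain" "inj_on cubic_X (ball 0 \<rho>)"
    using has_complex_derivative_locally_injective[OF cubic_X_holomorphic cubic_domain_0 open_cubic_domain deriv_cubic_X_0] .
  have Xhol: "cubic_X holomorphic_on ball 0 \<rho>" by (rule holomorphic_on_subset[OF cubic_X_holomorphic \<rho>(2)])
  obtain \<psi> where \<psi>: "\<psi> holomorphic_on cubic_X ` ball 0 \<rho>"
    "\<And>z. z \<in> ball 0 \<rho> \<Longrightarrow> deriv cubic_X z * deriv \<psi> (cubic_X z) = 1"
    "\<And>z. z \<in> ball 0 \<rho> \<Longrightarrow> \<psi> (cubic_X z) = z"
    using holomorphic_has_inverse[OF Xhol open_ball \<rho>(3)] by blast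
  have op: "open (cubic_X ` ball 0 \<rho>)" by (rule open_mapping_thm3[OF Xhol open_ball \<rho>(3)])
  moreover have "0 \<in> cubic_X ` ball 0 \<rho>" using \<rho>(1) by (auto intro!: image_eqI[of _ _ 0])
  ultimately obtain \<epsilon>' where \<epsilon>': "\<epsilon>' > 0" "ball 0 \<epsilon>' \<subseteq> cubic_X ` ball 0 \<rho>" using openE by blast
  \<comment> \<open>The bound 1 keeps r, with r^2 = 1 - x, away from 0.\<close>
  define \<epsilon> where "\<epsilon> = min \<epsilon>' 1"
  have \<epsilon>: "\<epsilon> > 0" "ball 0 \<epsilon> \<subseteq> cubic_X ` ball 0 \<rho>" "\<epsilon> \<le> 1" using \<epsilon>' by (auto simp: \<epsilon>_def)
  have inv: "\<psi> x \<in> ball 0 \<rho>" "\<psi> x \<in> cubic_domain" "cubic_X (\<psi> x) = x" "deriv cubic_X (\<psi> x) * deriv \<psi> x = 1"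
    if "x \<in> ball 0 \<epsilon>" for x
  proof -
    from that \<epsilon>(2) obtain z where z: "z \<in> ball 0 \<rho>" "x = cubic_X z" by blast
    then show "\<psi> x \<in> ball 0 \<rho>" "cubic_X (\<psi> x) = x" "deriv cubic_X (\<psi> x) * deriv \<psi> x = 1" using \<psi> by auto
    then show "\<psi> x \<in> cubic_domain" using \<rho>(2) by blast
  qed
  define a where "a = (\<lambda>x. cubic_a (\<psi> x))"
  define r where "r = (\<lambda>x. cubic_r (\<psi> x))"
  define v where "v = (\<lambda>x. theta_a (\<psi> x) / (a x)\<^sup>2)"
  have a0: "a x \<noteq> 0" if "x \<in> ball 0 \<epsilon>" for x using cubic_a_nonzero[OF inv(2)[OF that]] by (simp add: a_def)
  have r2: "(r x)\<^sup>2 = 1 - x" if "x \<in> ball 0 \<epsilon>" for x using cubic_r_squared[OF inv(2)[OF that]] inv(3)[OF that] by (simp add: r_def)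
  have r0: "r x \<noteq> 0" if "x \<in> ball 0 \<epsilon>" for x
  proof
    assume "r x = 0"
    then have "x = 1" using r2[OF that] by simp
    then show False using that \<epsilon>(3) by simp
  qed
  \<comment> \<open>By \<open>theta_cubic_X\<close>, q d/dq becomes a^2 r times x d/dx. The rule is
    stated for x * D so that x = 0 needs no exception.\<close>
  have comp: "\<exists>D. ((\<lambda>x. f (\<psi> x)) has_field_derivative D) (at x) \<and> x * D = \<psi> x * deriv f (\<psi> x) / ((a x)\<^sup>2 * r x)"
    if x: "x \<in> ball 0 \<epsilon>" and f: "f holomorphic_on cubic_domain" for f x
  proof (intro exI conjI)
    have "(\<psi> has_field_derivative deriv \<psi> x) (at x)"
      by (rule holomorphic_derivI[OF \<psi>(1) op]) (use x \<epsilon>(2) in blast)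
    moreover have "(f has_field_derivative deriv f (\<psi> x)) (at (\<psi> x))"
      by (rule holomorphic_derivI[OF f open_cubic_domain inv(2)[OF x]])
    ultimately show "((\<lambda>x. f (\<psi> x)) has_field_derivative deriv f (\<psi> x) * deriv \<psi> x) (at x)"
      by (intro DERIV_chain2)
    have "\<psi> x = \<psi> x * deriv cubic_X (\<psi> x) * deriv \<psi> x" using inv(4)[OF x] by (simp add: mult.assoc)
    also have "\<dots> = (a x)\<^sup>2 * r x * x * deriv \<psi> x"
      unfolding theta_cubic_X[OF inv(2)[OF x]] inv(3)[OF x] by (simp add: a_def r_def)
    finally have "x * deriv \<psi> x = \<psi> x / ((a x)\<^sup>2 * r x)" using a0[OF x] r0[OF x] by (simp add: field_simps)
    then show "x * (deriv f (\<psi> x) * deriv \<psi> x) = \<psi> x * deriv f (\<psi> x) / ((a x)\<^sup>2 * r x)"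
      by (metis mult.commute mult.left_commute times_divide_eq_right)
  qed
  have ahol: "cubic_a holomorphic_on cubic_domain" by (rule holomorphic_on_subset[OF cubic_a_holomorphic cubic_domain_subset])
  have thol: "theta_a holomorphic_on cubic_domain" by (rule holomorphic_on_subset[OF theta_a_holomorphic cubic_domain_subset])
  have da: "\<exists>D. (a has_field_derivative D) (at x) \<and> x * D = v x / r x" if x: "x \<in> ball 0 \<epsilon>" for x
    using comp[OF x ahol] by (simp add: a_def[symmetric] v_def theta_a_def)
  have dv: "\<exists>D. (v has_field_derivative D) (at x) \<and> x * D = a x * x / (18 * r x)" if x: "x \<in> ball 0 \<epsilon>" for x
  proof -
    define z where "z = \<psi> x"
    have z: "z \<in> cubic_domain" "z \<in> ball 0 1" "cubic_X z = x"
      using inv[OF x] cubic_domain_subset by (auto simp: z_def simp del: mem_ball)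
    obtain D where D: "((\<lambda>x. theta_a (\<psi> x)) has_field_derivative D) (at x)" "x * D = z * deriv theta_a z / ((a x)\<^sup>2 * r x)"
      using comp[OF x thol] by (auto simp: z_def)
    obtain E where E: "(a has_field_derivative E) (at x)" "x * E = v x / r x" using da[OF x] by blast
    have 1: "(v has_field_derivative (D * (a x)\<^sup>2 - theta_a z * (2 * a x * E)) / ((a x)\<^sup>2 * (a x)\<^sup>2)) (at x)"
      unfolding v_def z_def using a0[OF x] by (auto intro!: derivative_eq_intros D E)
    have "x * ((D * (a x)\<^sup>2 - theta_a z * (2 * a x * E)) / ((a x)\<^sup>2 * (a x)\<^sup>2)) =
      ((x * D) * (a x)\<^sup>2 - theta_a z * (2 * a x * (x * E))) / ((a x)\<^sup>2 * (a x)\<^sup>2)"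
      by (simp add: algebra_simps)
    also have "\<dots> = (a x * (z * deriv theta_a z) - 2 * (theta_a z)\<^sup>2) / ((a x) ^ 5 * r x)"
      unfolding D E v_def z_def[symmetric] using a0[OF x] r0[OF x] by (simp add: field_simps eval_nat_numeral)
    \<comment> \<open>1/18 is the 2/9 of the differential equation times the 1/4 of
      \<open>cube_b_cube_c_eq\<close>.\<close>
    also have "a x * (z * deriv theta_a z) - 2 * (theta_a z)\<^sup>2 = (a x) ^ 6 * x / 18"
      using cubic_a_differential_equation[OF z(2)] cube_b_cube_c_eq[OF z(1)] by (simp add: a_def z_def[symmetric] z(3))
    also have "(a x) ^ 6 * x / 18 / ((a x) ^ 5 * r x) = a x * x / (18 * r x)"
      using a0[OF x] r0[OF x] by (simp add: field_simps eval_nat_numeral)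
    finally show ?thesis using 1 by blast
  qed
  have dr: "\<exists>D. (r has_field_derivative D) (at x) \<and> x * D = - x / (2 * r x)" if x: "x \<in> ball 0 \<epsilon>" for x
  proof -
    obtain D where D: "(r has_field_derivative D) (at x)"
      using comp[OF x cubic_r_holomorphic] by (auto simp: r_def[symmetric])
    have "((\<lambda>x. (r x)\<^sup>2) has_field_derivative 2 * r x * D) (at x)"
      by (auto intro!: derivative_eq_intros D)
    moreover have "((\<lambda>x. (r x)\<^sup>2) has_field_derivative -1) (at x)"
    proof (rule has_field_derivative_transform_within_open[OF _ open_ball x])
      show "((\<lambda>x. 1 - x) has_field_derivative -1) (at x)" by (auto intro!: derivative_eq_intros)
    qed (simp add: r2)
    ultimately have "2 * r x * D = -1" by (rule DERIV_unique)
    then have "D = -1 / (2 * r x)" using r0[OF x] by (simp add: field_simps)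
    then show ?thesis using D by auto
  qed
  define Y where "Y = (\<lambda>x. (a x)\<^sup>2)"
  \<comment> \<open>\<open>Y1\<close> and \<open>Y2\<close> are what the three rules make of x d/dx
    applied once and twice to a^2.\<close>
  define Y1 where "Y1 = (\<lambda>x. 2 * a x * v x / r x)"
  define Y2 where "Y2 = (\<lambda>x. 2 * (v x)\<^sup>2 / (r x)\<^sup>2 + (a x)\<^sup>2 * x / (9 * (r x)\<^sup>2) + a x * v x * x / r x ^ 3)"
  define Y3 where "Y3 = (\<lambda>x. x * deriv Y2 x)"
  have Y1: "Y1 x = x * deriv Y x" if x: "x \<in> ball 0 \<epsilon>" for x
  proof -
    obtain A where A: "(a has_field_derivative A) (at x)" "x * A = v x / r x" using da[OF x] by blast
    have "(Y has_field_derivative 2 * a x * A) (at x)" unfolding Y_def by (auto intro!: derivative_eq_intros A)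
    then have "x * deriv Y x = 2 * a x * (x * A)" by (simp add: DERIV_imp_deriv)
    then show ?thesis unfolding A Y1_def by simp
  qed
  have Y2: "Y2 x = x * deriv Y1 x" if x: "x \<in> ball 0 \<epsilon>" for x
  proof -
    obtain A where A: "(a has_field_derivative A) (at x)" "x * A = v x / r x" using da[OF x] by blast
    obtain V where V: "(v has_field_derivative V) (at x)" "x * V = a x * x / (18 * r x)" using dv[OF x] by blast
    obtain R where R: "(r has_field_derivative R) (at x)" "x * R = - x / (2 * r x)" using dr[OF x] by blast
    have "(Y1 has_field_derivative (2 * (A * v x + a x * V) * r x - 2 * a x * v x * R) / (r x * r x)) (at x)"
      unfolding Y1_def using r0[OF x] by (auto intro!: derivative_eq_intros A V R simp: algebra_simps)
    then have "x * deriv Y1 x = (2 * ((x * A) * v x + a x * (x * V)) * r x - 2 * a x * v x * (x * R)) / (r x * r x)"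
      by (simp add: DERIV_imp_deriv algebra_simps)
    also have "\<dots> = Y2 x"
      unfolding A V R Y2_def using r0[OF x] by (simp add: field_simps power2_eq_square power3_eq_cube)
    finally show ?thesis by simp
  qed
  have ode: "(1 - x) * Y3 x = x * (3/2 * Y2 x + 13/18 * Y1 x + 1/9 * Y x)" if x: "x \<in> ball 0 \<epsilon>" for x
  proof -
    obtain A where A: "(a has_field_derivative A) (at x)" "x * A = v x / r x" using da[OF x] by blast
    obtain V where V: "(v has_field_derivative V) (at x)" "x * V = a x * x / (18 * r x)" using dv[OF x] by blast
    obtain R where R: "(r has_field_derivative R) (at x)" "x * R = - x / (2 * r x)" using dr[OF x] by blast
    have "((\<lambda>x. 2 * (v x)\<^sup>2 / (r x)\<^sup>2) has_field_derivative
        (4 * v x * V * (r x)\<^sup>2 - 2 * (v x)\<^sup>2 * (2 * r x * R)) / ((r x)\<^sup>2 * (r x)\<^sup>2)) (at x)"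
      using r0[OF x] by (auto intro!: derivative_eq_intros V R)
    moreover have "((\<lambda>x. (a x)\<^sup>2 * x / (9 * (r x)\<^sup>2)) has_field_derivative
        ((2 * a x * A * x + (a x)\<^sup>2) * (9 * (r x)\<^sup>2) - (a x)\<^sup>2 * x * (9 * (2 * r x * R))) / ((9 * (r x)\<^sup>2) * (9 * (r x)\<^sup>2))) (at x)"
      using r0[OF x] by (auto intro!: derivative_eq_intros A R)
    moreover have "((\<lambda>x. a x * v x * x / r x ^ 3) has_field_derivative
        (((A * v x + a x * V) * x + a x * v x) * r x ^ 3 - a x * v x * x * (3 * (r x)\<^sup>2 * R)) / (r x ^ 3 * r x ^ 3)) (at x)"
      using r0[OF x] by (auto intro!: derivative_eq_intros A V R simp: algebra_simps)
    ultimately have "(Y2 has_field_derivative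
       ((4 * v x * V * (r x)\<^sup>2 - 2 * (v x)\<^sup>2 * (2 * r x * R)) / ((r x)\<^sup>2 * (r x)\<^sup>2)
       + ((2 * a x * A * x + (a x)\<^sup>2) * (9 * (r x)\<^sup>2) - (a x)\<^sup>2 * x * (9 * (2 * r x * R))) / ((9 * (r x)\<^sup>2) * (9 * (r x)\<^sup>2))
       + (((A * v x + a x * V) * x + a x * v x) * r x ^ 3 - a x * v x * x * (3 * (r x)\<^sup>2 * R)) / (r x ^ 3 * r x ^ 3))) (at x)"
      unfolding Y2_def by (intro DERIV_add)
    then have "Y3 x = x * (((4 * v x * V * (r x)\<^sup>2 - 2 * (v x)\<^sup>2 * (2 * r x * R)) / ((r x)\<^sup>2 * (r x)\<^sup>2)
       + ((2 * a x * A * x + (a x)\<^sup>2) * (9 * (r x)\<^sup>2) - (a x)\<^sup>2 * x * (9 * (2 * r x * R))) / ((9 * (r x)\<^sup>2) * (9 * (r x)\<^sup>2))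
       + (((A * v x + a x * V) * x + a x * v x) * r x ^ 3 - a x * v x * x * (3 * (r x)\<^sup>2 * R)) / (r x ^ 3 * r x ^ 3)))"
      unfolding Y3_def by (simp only: DERIV_imp_deriv)
    \<comment> \<open>The factor x is moved onto each derivative, so that only x * A, x * V and x *
      R occur and the rules can be substituted.\<close>
    also have "\<dots> = (4 * v x * (x * V) * (r x)\<^sup>2 - 2 * (v x)\<^sup>2 * (2 * r x * (x * R))) / ((r x)\<^sup>2 * (r x)\<^sup>2)
       + ((2 * a x * (x * A) * x + (a x)\<^sup>2 * x) * (9 * (r x)\<^sup>2) - (a x)\<^sup>2 * x * (9 * (2 * r x * (x * R)))) / ((9 * (r x)\<^sup>2) * (9 * (r x)\<^sup>2))
       + ((((x * A) * v x + a x * (x * V)) * x + a x * v x * x) * r x ^ 3 - a x * v x * x * (3 * (r x)\<^sup>2 * (x * R))) / (r x ^ 3 * r x ^ 3)"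
      unfolding distrib_left times_divide_eq_right by (simp only: algebra_simps)
    finally have Y3: "Y3 x = \<dots>" .
    have "(r x)\<^sup>2 * Y3 x = x * (3/2 * Y2 x + 13/18 * Y1 x + 1/9 * Y x)"
      unfolding Y3 A V R Y2_def Y1_def Y_def using r0[OF x] by (simp add: field_simps power2_eq_square power3_eq_cube)
    then show ?thesis by (simp add: r2[OF x])
  qed
  have "\<psi> holomorphic_on ball 0 \<epsilon>" by (rule holomorphic_on_subset[OF \<psi>(1) \<epsilon>(2)])
  then have "a holomorphic_on ball 0 \<epsilon>" unfolding a_def
    by (rule holomorphic_on_compose_gen[OF _ ahol, unfolded o_def]) (use inv(2) in auto)
  then have "Y holomorphic_on ball 0 \<epsilon>" unfolding Y_def by (intro holomorphic_intros)
  moreover have "Y 0 = 1" using \<psi>(3)[of 0] \<rho>(1) by (simp add: Y_def a_def)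
  ultimately have "Y has_fps_expansion hyper_fps"
    by (intro hypergeometric_equation_unique[OF \<epsilon>(1) _ _ Y1 Y2 _ ode]) (simp_all add: Y3_def)
  then have "\<forall>\<^sub>F x in nhds 0. eval_fps hyper_fps x = Y x" by (simp add: has_fps_expansion_def)
  moreover have "filterlim cubic_X (nhds 0) (nhds 0)"
  proof -
    have "isCont cubic_X 0"
      using cubic_X_holomorphic open_cubic_domain cubic_domain_0 by (metis continuous_on_eq_continuous_at holomorphic_on_imp_continuous_on)
    then show ?thesis using isCont_def tendsto_at_iff_tendsto_nhds cubic_X_0 by metis
  qed
  ultimately have "\<forall>\<^sub>F q in nhds 0. eval_fps hyper_fps (cubic_X q) = Y (cubic_X q)"
    by (rule eventually_compose_filterlim)
  moreover have "\<forall>\<^sub>F q in nhds 0. q \<in> ball 0 \<rho>" using \<rho>(1) by (intro eventually_nhds_in_open) auto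
  ultimately show ?thesis by eventually_elim (simp add: Y_def a_def \<psi>(3))
qed

section \<open>The series for the reciprocal of pi\<close>

text \<open>\<open>L\<close> is the quotient of the Euler products at q^3 and q, which is the
  product of the factors 1 + q^k + q^(2k): visibly at least 1 and increasing on [0, 1).\<close>

lemma cubic_u_of_real:
  obtains L :: "real \<Rightarrow> real" where
    "\<And>q. 0 \<le> q \<Longrightarrow> q < 1 \<Longrightarrow> cubic_u (of_real q) = of_real (27 * q * L q ^ 12)"
    "\<And>q. 0 \<le> q \<Longrightarrow> q < 1 \<Longrightarrow> L q \<ge> 1"
    "\<And>q q'. 0 \<le> q \<Longrightarrow> q \<le> q' \<Longrightarrow> q' < 1 \<Longrightarrow> L q \<le> L q'"
proof
  define V where "V = (\<lambda>n (q::real). \<Prod>k<n. 1 + q ^ Suc k + (q ^ Suc k)\<^sup>2)"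
  define L where "L = (\<lambda>q::real. Re (euler_phi (of_real q ^ 3) / euler_phi (of_real q)))"
  have lim: "(\<lambda>n. complex_of_real (V n q)) \<longlonglongrightarrow> euler_phi (of_real q ^ 3) / euler_phi (of_real q)" if q: "0 \<le> q" "q < 1" for q
  proof -
    have q1: "complex_of_real q \<in> ball 0 1" using q by simp
    have "(\<lambda>n. (\<Prod>k<n. 1 - (of_real q ^ 3) ^ Suc k) / (\<Prod>k<n. 1 - of_real q ^ Suc k)) \<longlonglongrightarrow> euler_phi (of_real q ^ 3) / euler_phi (of_real q)"
      using q1 cube_in_ball[OF q1] euler_phi_ball_nonzero[OF q1] by (intro tendsto_divide euler_phi_LIMSEQ) auto
    moreover have "(\<Prod>k<n. 1 - (of_real q ^ 3) ^ Suc k) / (\<Prod>k<n. 1 - of_real q ^ Suc k) = complex_of_real (V n q)" for n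
    proof -
      have "(1 - (of_real q ^ 3) ^ Suc k) / (1 - of_real q ^ Suc k) = 1 + of_real q ^ Suc k + (complex_of_real q ^ Suc k)\<^sup>2" for k
      proof -
        define z where "z = complex_of_real q ^ Suc k"
        have "1 - z \<noteq> 0" unfolding z_def using q by (intro one_minus_power_Suc_nonzero) simp
        moreover have "(of_real q ^ 3) ^ Suc k = z ^ 3" unfolding z_def by (simp only: mult.commute flip: power_mult)
        moreover have "1 - z ^ 3 = (1 + z + z\<^sup>2) * (1 - z)" by (simp add: power2_eq_square power3_eq_cube algebra_simps)
        ultimately show ?thesis unfolding z_def[symmetric] by simp
      qed
      then show ?thesis unfolding V_def prod_dividef[symmetric] by simp
    qed
    ultimately show ?thesis by simp
  qed
  have limL: "(\<lambda>n. V n q) \<longlonglongrightarrow> L q" if q: "0 \<le> q" "q < 1" for q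
    using tendsto_Re[OF lim[OF q]] by (simp add: L_def)
  have "euler_phi (of_real q ^ 3) / euler_phi (of_real q) = of_real (L q)" if q: "0 \<le> q" "q < 1" for q
    using lim[OF q] tendsto_of_real[OF limL[OF q]] by (rule LIMSEQ_unique)
  then show "cubic_u (of_real q) = of_real (27 * q * L q ^ 12)" if "0 \<le> q" "q < 1" for q
    using that by (simp add: cubic_u_eq)
  show "L q \<ge> 1" if q: "0 \<le> q" "q < 1" for q
    by (rule LIMSEQ_le_const[OF limL[OF q]]) (use q in \<open>auto simp: V_def intro!: prod_ge_1\<close>)
  show "L q \<le> L q'" if "0 \<le> q" "q \<le> q'" "q' < 1" for q q'
  proof (rule LIMSEQ_le[OF limL limL])
    have "V n q \<le> V n q'" for n unfolding V_def
      using that by (intro prod_mono conjI add_mono power_mono) auto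
    then show "\<exists>N. \<forall>n\<ge>N. V n q \<le> V n q'" by blast
  qed (use that in auto)
qed

text \<open>The bound on q is the nome of the fixed point of the involution. There u = 1/u and u >=
  0, hence u = 1, and u increases strictly up to this point.\<close>

lemma cubic_u_less_1:
  assumes "0 \<le> q" "q < exp (- 2 * pi / sqrt 3)"
  obtains x where "cubic_u (of_real q) = of_real x" "0 \<le> x" "x < 1"
proof -
  obtain L where L: "\<And>q. 0 \<le> q \<Longrightarrow> q < 1 \<Longrightarrow> cubic_u (of_real q) = of_real (27 * q * L q ^ 12)"
    "\<And>q. 0 \<le> q \<Longrightarrow> q < 1 \<Longrightarrow> L q \<ge> 1"
    "\<And>q q'. 0 \<le> q \<Longrightarrow> q \<le> q' \<Longrightarrow> q' < 1 \<Longrightarrow> L q \<le> L q'"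
    using cubic_u_of_real by blast
  define p where "p = exp (- 2 * pi / sqrt 3)"
  have p: "0 < p" "p < 1" "q < p" using assms by (auto simp: p_def)
  have fixed: "27 * p * L p ^ 12 = 1"
  proof -
    define \<tau> where "\<tau> = \<i> * complex_of_real (1 / sqrt 3)"
    have \<tau>: "\<tau> \<in> upper_half" by (simp add: \<tau>_def upper_half_def)
    have "fricke \<tau> = \<tau>"
      using of_real_sqrt_3_squared by (simp add: fricke_def \<tau>_def field_simps)
    moreover have np: "nome \<tau> = of_real p"
      unfolding nome_def \<tau>_def p_def by (simp add: exp_of_real[symmetric] mult_ac)
    ultimately have "cubic_u (of_real p) = 1 / cubic_u (of_real p)"
      using cubic_u_fricke[OF \<tau>] by simp
    moreover have "cubic_u (of_real p) \<noteq> 0"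
      using cubic_u_nonzero[OF nome_upper_half[OF \<tau>] nome_nonzero] by (simp only: np not_False_eq_True)
    ultimately have "cubic_u (of_real p) * cubic_u (of_real p) = 1"
      by (metis nonzero_eq_divide_eq)
    then have "complex_of_real ((27 * p * L p ^ 12) * (27 * p * L p ^ 12)) = of_real 1"
      using L(1)[of p] p by simp
    then have "(27 * p * L p ^ 12) * (27 * p * L p ^ 12) = 1" by (simp only: of_real_eq_iff)
    moreover have "27 * p * L p ^ 12 \<ge> 0" using p by simp
    ultimately show ?thesis by (metis abs_of_nonneg abs_1 abs_eq_iff abs_mult_self_eq mult_1 power2_eq_1_iff power2_eq_square)
  qed
  show ?thesis
  proof (rule that)
    show "cubic_u (of_real q) = of_real (27 * q * L q ^ 12)" using L(1) assms(1) p by simp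
    show "0 \<le> 27 * q * L q ^ 12" using assms(1) by simp
    have L1: "L p \<ge> 1" "L q \<ge> 1" "L q \<le> L p" using L(2)[of p] L(2)[of q] L(3)[of q p] assms(1) p by auto
    have "27 * q * L q ^ 12 \<le> 27 * q * L p ^ 12" using L1 assms(1) by (intro mult_left_mono power_mono) auto
    also have "\<dots> < 27 * p * L p ^ 12" using L1 p by (intro mult_strict_right_mono) auto
    finally show "27 * q * L q ^ 12 < 1" by (simp only: fixed)
  qed
qed

text \<open>X < 1 amounts to (1 - u)^2 > 0. The set where norm X < 1 need not be connected, so the
  local identity is continued on its component of 0, which contains the segment [0, q]. The equation
  is asserted near q, not only at q, because it is differentiated next.\<close>

theorem cubic_a_squared_hypergeometric:
  assumes q: "0 \<le> q" "q < exp (- 2 * pi / sqrt 3)"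
  shows "of_real q \<in> cubic_domain" and "norm (cubic_X (of_real q)) < 1"
    and "\<forall>\<^sub>F z in nhds (of_real q). eval_fps hyper_fps (cubic_X z) = (cubic_a z)\<^sup>2"
proof -
  define W where "W = {q \<in> cubic_domain. norm (cubic_X q) < 1}"
  have "open (cubic_domain \<inter> cubic_X -` ball 0 1)"
    by (intro continuous_open_preimage holomorphic_on_imp_continuous_on cubic_X_holomorphic open_cubic_domain open_ball)
  moreover have "cubic_domain \<inter> cubic_X -` ball 0 1 = W" by (auto simp: W_def)
  ultimately have W: "open W" by simp
  have inW: "complex_of_real p \<in> W" if p: "0 \<le> p" "p < exp (- 2 * pi / sqrt 3)" for p
  proof -
    obtain x where x: "cubic_u (of_real p) = of_real x" "0 \<le> x" "x < 1" by (rule cubic_u_less_1[OF p])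
    have "exp (- 2 * pi / sqrt 3) < 1" by simp
    then have "p < 1" using p by linarith
    moreover have "complex_of_real (1 + x) \<noteq> 0" using x(2) by (simp only: of_real_eq_0_iff)
    ultimately have "complex_of_real p \<in> cubic_domain" using p x(1) by (simp add: cubic_domain_def)
    moreover have "cubic_X (of_real p) = of_real (4 * x / (1 + x)\<^sup>2)" by (simp add: cubic_X_def x(1))
    moreover have "4 * x / (1 + x)\<^sup>2 < 1"
    proof -
      have "0 < (1 - x)\<^sup>2" using x(3) by simp
      then show ?thesis using x(2) by (simp add: divide_less_eq power2_eq_square algebra_simps)
    qed
    ultimately show ?thesis using x(2) by (simp add: W_def norm_divide norm_power del: of_real_divide of_real_mult of_real_power)
  qed
  from inW[OF q] show "of_real q \<in> cubic_domain" "norm (cubic_X (of_real q)) < 1" by (auto simp: W_def)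
  define C where "C = connected_component_set W 0"
  have C: "open C" "connected C" "C \<subseteq> W" unfolding C_def
    using open_connected_component[OF W] connected_component_subset by auto
  have "complex_of_real ` {0..q} \<subseteq> C" unfolding C_def
  proof (rule connected_component_maximal)
    show "0 \<in> complex_of_real ` {0..q}" using q(1) by (auto intro!: image_eqI[of _ _ 0])
    show "connected (complex_of_real ` {0..q})" by (intro connected_continuous_image continuous_intros) auto
    show "complex_of_real ` {0..q} \<subseteq> W" using inW q(2) by auto
  qed
  then have mem: "of_real q \<in> C" "0 \<in> C" using q(1) by (auto intro: image_eqI[of _ _ 0])
  have X: "cubic_X holomorphic_on C" by (rule holomorphic_on_subset[OF cubic_X_holomorphic]) (use C(3) in \<open>auto simp: W_def\<close>)
  have "eval_fps hyper_fps holomorphic_on ball 0 1"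
    by (rule holomorphic_on_eval_fps) (auto simp: eball_def intro: norm_less_hyper_conv_radius)
  then have "(\<lambda>z. eval_fps hyper_fps (cubic_X z)) holomorphic_on C"
    by (rule holomorphic_on_compose_gen[OF X, unfolded o_def]) (use C(3) in \<open>auto simp: W_def\<close>)
  moreover have "cubic_a holomorphic_on C"
    by (rule holomorphic_on_subset[OF cubic_a_holomorphic]) (use C(3) cubic_domain_subset in \<open>auto simp: W_def\<close>)
  ultimately have hol: "(\<lambda>z. eval_fps hyper_fps (cubic_X z) - (cubic_a z)\<^sup>2) holomorphic_on C"
    by (intro holomorphic_intros)
  obtain U where U: "open U" "0 \<in> U" "\<And>z. z \<in> U \<Longrightarrow> eval_fps hyper_fps (cubic_X z) = (cubic_a z)\<^sup>2"
    using cubic_a_squared_hypergeometric_near_0 unfolding eventually_nhds by blast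
  have "eval_fps hyper_fps (cubic_X z) - (cubic_a z)\<^sup>2 = 0" if "z \<in> C" for z
  proof (rule analytic_continuation[OF hol C(1,2), of "U \<inter> C" 0])
    show "0 islimpt U \<inter> C" using U mem C by (intro interior_limit_point) (simp add: interior_open open_Int)
  qed (use U mem that in auto)
  then show "\<forall>\<^sub>F z in nhds (of_real q). eval_fps hyper_fps (cubic_X z) = (cubic_a z)\<^sup>2"
    using eventually_nhds_in_open[OF C(1) mem(1)] by (auto elim!: eventually_mono)
qed

section \<open>Differentiating the series and evaluating the determinant\<close>

lemma hyper_coeff_sums:
  assumes "norm x < 1"
  shows "(\<lambda>k. hyper_coeff k * (b * of_nat k + a) * x ^ k) sums (b * (x * deriv (eval_fps hyper_fps) x) + a * eval_fps hyper_fps x)"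
proof -
  have x: "ereal (norm x) < fps_conv_radius hyper_fps" by (rule norm_less_hyper_conv_radius[OF assms])
  have 1: "(\<lambda>k. fps_nth hyper_fps k * x ^ k) sums eval_fps hyper_fps x" by (rule sums_eval_fps[OF x])
  have "(\<lambda>k. fps_nth (fps_deriv hyper_fps) k * x ^ k) sums eval_fps (fps_deriv hyper_fps) x"
    by (rule sums_eval_fps) (use x fps_conv_radius_deriv[of hyper_fps] in order)
  then have "(\<lambda>k. x * (fps_nth (fps_deriv hyper_fps) k * x ^ k)) sums (x * deriv (eval_fps hyper_fps) x)"
    unfolding eval_fps_deriv[OF x] by (rule sums_mult)
  then have "(\<lambda>k. of_nat (Suc k) * hyper_coeff (Suc k) * x ^ Suc k) sums (x * deriv (eval_fps hyper_fps) x)"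
    by (simp add: hyper_fps_def mult_ac)
  then have "(\<lambda>k. of_nat k * hyper_coeff k * x ^ k) sums (x * deriv (eval_fps hyper_fps) x + of_nat 0 * hyper_coeff 0 * x ^ 0)"
    by (rule sums_Suc)
  from sums_add[OF sums_mult[OF this, of b] sums_mult[OF 1, of a]] show ?thesis
    by (simp add: hyper_fps_def algebra_simps)
qed

text \<open>Apply \<theta> to S(X) = a^2, where S is the series: by \<open>theta_cubic_X\<close> the
  left side is a^2 r X S'(X), and the right side is 2 a \<theta>a.\<close>

lemma cubic_hypergeometric_derivative:
  assumes q: "0 < q" "q < exp (- 2 * pi / sqrt 3)"
  defines "z \<equiv> complex_of_real q"
  shows "cubic_r z * (cubic_X z * deriv (eval_fps hyper_fps) (cubic_X z)) = 2 * theta_a z / cubic_a z"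
proof -
  note hyp = cubic_a_squared_hypergeometric[of q, folded z_def]
  have dom: "z \<in> cubic_domain" and X1: "norm (cubic_X z) < 1"
    and ev: "\<forall>\<^sub>F z in nhds z. eval_fps hyper_fps (cubic_X z) = (cubic_a z)\<^sup>2"
    using hyp q by auto
  have a: "(cubic_a has_field_derivative deriv cubic_a z) (at z)"
    by (rule holomorphic_derivI[OF cubic_a_holomorphic open_ball]) (use dom cubic_domain_subset in blast)
  define S where "S = deriv (eval_fps hyper_fps) (cubic_X z)"
  have "(eval_fps hyper_fps has_field_derivative S) (at (cubic_X z))"
    unfolding S_def eval_fps_deriv[symmetric, OF norm_less_hyper_conv_radius[OF X1]]
    by (rule has_field_derivative_eval_fps[OF norm_less_hyper_conv_radius[OF X1]])
  moreover have "(cubic_X has_field_derivative deriv cubic_X z) (at z)"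
    by (rule holomorphic_derivI[OF cubic_X_holomorphic open_cubic_domain dom])
  ultimately have "((\<lambda>z. eval_fps hyper_fps (cubic_X z)) has_field_derivative S * deriv cubic_X z) (at z)"
    by (rule DERIV_chain2)
  then have "((\<lambda>z. (cubic_a z)\<^sup>2) has_field_derivative S * deriv cubic_X z) (at z)"
    using DERIV_cong_ev[OF refl ev refl] by simp
  moreover have "((\<lambda>z. (cubic_a z)\<^sup>2) has_field_derivative 2 * cubic_a z * deriv cubic_a z) (at z)"
    by (auto intro!: derivative_eq_intros a)
  ultimately have "S * deriv cubic_X z = 2 * cubic_a z * deriv cubic_a z" by (rule DERIV_unique)
  then have "S * (z * deriv cubic_X z) = 2 * cubic_a z * theta_a z" by (simp add: theta_a_def)
  then have "cubic_a z * (cubic_a z * (cubic_r z * (cubic_X z * S))) = cubic_a z * (2 * theta_a z)"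
    unfolding theta_cubic_X[OF dom] by (simp add: power2_eq_square mult_ac)
  then show ?thesis using cubic_a_nonzero[OF dom] unfolding S_def by (simp add: field_simps)
qed

lemma cubic_alpha_eq:
  assumes "y > 0"
  defines "q \<equiv> complex_of_real (exp (- 2 * pi * y))"
  shows "cubic_alpha q = cubic_u q / (1 + cubic_u q)"
proof -
  define \<tau> where "\<tau> = \<i> * complex_of_real y"
  have e: "exp (2 * pi * \<i> * \<tau>) = q" unfolding \<tau>_def q_def by (simp add: exp_of_real[symmetric] mult_ac)
  have q: "q \<in> ball 0 1" "q \<noteq> 0" using assms(1) by (simp_all add: q_def)
  have u0: "cubic_u q \<noteq> 0" using cubic_u_nonzero q by blast
  have "1 / cubic_alpha q = 1 + 1 / 27 * (dedekind_eta \<tau> ^ 12 / dedekind_eta (3 * \<tau>) ^ 12)"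
    using cubic_alpha_exp[of \<tau>] by (simp only: e)
  also have "\<dots> = 1 + 1 / 27 * (euler_phi q ^ 12 / euler_phi (q ^ 3) ^ 12 / q)"
    unfolding dedekind_eta_quotient e Let_def euler_phi_def ..
  also have "\<dots> = 1 + 1 / cubic_u q"
    unfolding cubic_u_eq[OF q(1)] by (simp add: power_divide)
  also have "\<dots> = (1 + cubic_u q) / cubic_u q" using u0 by (simp add: field_simps)
  finally have "1 / cubic_alpha q = (1 + cubic_u q) / cubic_u q" .
  then have "1 / (1 / cubic_alpha q) = 1 / ((1 + cubic_u q) / cubic_u q)" by (rule arg_cong)
  then show ?thesis by simp
qed

text \<open>With p the Fricke image of q and s = sqrt N, the laws read a(p) = s a(q) and
  \<theta>a(p) = s^2 (c a(q) - s \<theta>a(q)), where c = sqrt 3 / (2 pi). In the determinant the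
  two terms with \<theta>a(q) add up, hence the factor 2.\<close>

lemma cubic_C_eq:
  fixes N :: nat
  assumes N: "N > 0"
  defines "q \<equiv> complex_of_real (exp (- 2 * pi * sqrt (real N / 3)))"
    and "s \<equiv> complex_of_real (sqrt (real N))"
  assumes a0: "cubic_a q \<noteq> 0"
  shows "cubic_C N (complex_of_real (exp (- 2 * pi / sqrt (3 * real N)))) =
    2 * s * theta_a q / cubic_a q ^ 3 - of_real (sqrt 3 / (2 * pi)) / (cubic_a q)\<^sup>2"
proof -
  define y where "y = sqrt (real N / 3)"
  define p where "p = complex_of_real (exp (- 2 * pi / sqrt (3 * real N)))"
  have y: "y > 0" using N by (simp add: y_def)
  have y3: "3 * y = sqrt (3 * real N)"
  proof -
    have "sqrt (3 * real N) = sqrt (9 * (real N / 3))" by simp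
    also have "\<dots> = sqrt 9 * sqrt (real N / 3)" by (rule real_sqrt_mult)
    finally show ?thesis by (simp add: y_def)
  qed
  have ys: "sqrt 3 * y = sqrt (real N)" by (simp add: y_def real_sqrt_divide)
  define \<tau> where "\<tau> = \<i> * complex_of_real y"
  have \<tau>: "\<tau> \<in> upper_half" using y by (simp add: \<tau>_def upper_half_def)
  have nq: "nome \<tau> = q" unfolding \<tau>_def q_def nome_def y_def by (simp add: exp_of_real[symmetric] mult_ac)
  have np: "nome (fricke \<tau>) = p"
    using y unfolding \<tau>_def p_def nome_def fricke_def y3[symmetric] by (simp add: exp_of_real[symmetric] field_simps)
  have s2: "s\<^sup>2 = of_nat N" unfolding s_def of_real_power[symmetric] by simp
  have s0: "s \<noteq> 0" using N by (simp add: s_def)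
  have aut: "automorphy \<tau> = s" by (simp only: \<tau>_def automorphy_imaginary ys s_def)
  have ap: "cubic_a p = s * cubic_a q"
    using cubic_a_fricke[OF \<tau>] by (simp only: nq np aut)
  have "3 * \<tau>\<^sup>2 = - (automorphy \<tau>)\<^sup>2" by (simp add: automorphy_squared)
  then have \<tau>2: "3 * \<tau>\<^sup>2 = - s\<^sup>2" by (simp only: aut)
  define c where "c = complex_of_real (sqrt 3 / (2 * pi))"
  have tp: "theta_a p = s\<^sup>2 * (c * cubic_a q - s * theta_a q)"
  proof -
    have "theta_a p = - s\<^sup>2 * (- \<i> * complex_of_real (sqrt 3) * cubic_a q + s * (2 * complex_of_real pi * \<i> * theta_a q)) / (2 * complex_of_real pi * \<i>)"
      using theta_a_fricke[OF \<tau>] unfolding nq np aut \<tau>2 .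
    also have "- s\<^sup>2 * (- \<i> * complex_of_real (sqrt 3) * cubic_a q + s * (2 * complex_of_real pi * \<i> * theta_a q)) =
        (s\<^sup>2 * (complex_of_real (sqrt 3) * cubic_a q - s * (2 * complex_of_real pi * theta_a q))) * \<i>"
      by (simp add: algebra_simps)
    also have "\<dots> / (2 * complex_of_real pi * \<i>) =
        s\<^sup>2 * (complex_of_real (sqrt 3) * cubic_a q - s * (2 * complex_of_real pi * theta_a q)) / (2 * complex_of_real pi)"
      by (rule mult_divide_mult_cancel_right) simp
    finally show ?thesis by (simp add: c_def field_simps)
  qed
  have pN: "p ^ N = q"
  proof -
    have "real N * (- 2 * pi / sqrt (3 * real N)) = - 2 * pi * sqrt (real N / 3)"
    proof -
      have "real N = sqrt (real N) * sqrt (real N)" by simp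
      then show ?thesis using N by (simp add: real_sqrt_mult real_sqrt_divide field_simps)
    qed
    then show ?thesis unfolding p_def q_def of_real_power[symmetric] exp_of_nat_mult[symmetric] by (simp only:)
  qed
  have qb: "q \<in> ball 0 1" using nome_upper_half[OF \<tau>] by (simp only: nq)
  have "(cubic_a has_field_derivative deriv cubic_a (p ^ N)) (at (p ^ N))"
    unfolding pN by (rule holomorphic_derivI[OF cubic_a_holomorphic open_ball qb])
  moreover have "((\<lambda>z. z ^ N) has_field_derivative of_nat N * p ^ (N - 1)) (at p)"
    by (auto intro!: derivative_eq_intros)
  ultimately have "((\<lambda>z. cubic_a (z ^ N)) has_field_derivative deriv cubic_a (p ^ N) * (of_nat N * p ^ (N - 1))) (at p)"
    by (rule DERIV_chain2)
  then have "p * deriv (\<lambda>z. cubic_a (z ^ N)) p = p * (deriv cubic_a q * (of_nat N * p ^ (N - 1)))"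
    by (simp only: DERIV_imp_deriv pN)
  also have "\<dots> = of_nat N * (p ^ N * deriv cubic_a q)" using N by (simp add: power_eq_if)
  finally have dN: "p * deriv (\<lambda>z. cubic_a (z ^ N)) p = s\<^sup>2 * theta_a q" by (simp only: pN theta_a_def s2)
  have "cubic_C N p = 1 / ((cubic_a p)\<^sup>2 * (cubic_a q)\<^sup>2) * (cubic_a p * (s\<^sup>2 * theta_a q) - cubic_a q * theta_a p)"
    unfolding cubic_C_def det_2 vector_2 pN dN theta_a_def[of p] by simp
  also have "\<dots> = 2 * s * theta_a q / cubic_a q ^ 3 - c / (cubic_a q)\<^sup>2"
    unfolding ap tp using s0 a0 by (simp add: field_simps power2_eq_square power3_eq_cube)
  finally show ?thesis by (simp only: p_def c_def)
qed

theorem theorem5p1: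
  fixes N :: nat and \<alpha> a b X :: complex
  assumes "N \<ge> 2"
    and "\<alpha> = cubic_alpha (complex_of_real (exp (- 2 * pi * sqrt (real N / 3))))"
    and "b = 1 - 2 * \<alpha>"
    and "a = - (1 / complex_of_real (sqrt (real N))) *
               cubic_C N (complex_of_real (exp (- 2 * pi / sqrt (3 * real N))))"
    and "X = 4 * \<alpha> * (1 - \<alpha>)"
  shows "(\<lambda>k. pochhammer (1 / 2) k * pochhammer (1 / 3) k * pochhammer (2 / 3) k / fact k ^ 3 *
              (b * of_nat k + a) * X ^ k)
         sums complex_of_real (sqrt (3 / real N) * (1 / (2 * pi)))"
proof -
  define t where "t = exp (- 2 * pi * sqrt (real N / 3))"
  define q where "q = complex_of_real t"
  define s where "s = complex_of_real (sqrt (real N))"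
  have N: "real N / 3 > 0" "N > 0" using assms(1) by auto
  \<comment> \<open>The strict inequality is where N >= 2 enters: N = 1 would give the fixed point
    itself, where X = 1.\<close>
  have "sqrt (1 / 3) < sqrt (real N / 3)" using assms(1) by (intro real_sqrt_less_mono) simp
  then have "2 * pi * sqrt (1 / 3) < 2 * pi * sqrt (real N / 3)" by (intro mult_strict_left_mono) auto
  then have t: "0 < t" "t < exp (- 2 * pi / sqrt 3)" by (simp_all add: t_def real_sqrt_divide)
  note hyp = cubic_a_squared_hypergeometric[of t, folded q_def]
  have dom: "q \<in> cubic_domain" and X1: "norm (cubic_X q) < 1"
    and S: "eval_fps hyper_fps (cubic_X q) = (cubic_a q)\<^sup>2"
    using hyp t eventually_nhds_x_imp_x by auto
  have u1: "1 + cubic_u q \<noteq> 0" using dom by (simp add: cubic_domain_def)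
  have \<alpha>: "\<alpha> = cubic_u q / (1 + cubic_u q)"
    using cubic_alpha_eq[of "sqrt (real N / 3)"] N assms(2) by (simp add: q_def t_def)
  have b: "b = cubic_r q" using u1 by (simp add: assms(3) \<alpha> cubic_r_def field_simps)
  have "1 - \<alpha> = 1 / (1 + cubic_u q)" using u1 by (simp add: \<alpha> field_simps)
  then have X: "X = cubic_X q" by (simp add: assms(5) \<alpha> cubic_X_def power2_eq_square)
  have a0: "cubic_a q \<noteq> 0" by (rule cubic_a_nonzero[OF dom])
  have s0: "s \<noteq> 0" using N by (simp add: s_def)
  have a: "a = - (1 / s) * (2 * s * theta_a q / cubic_a q ^ 3 - of_real (sqrt 3 / (2 * pi)) / (cubic_a q)\<^sup>2)"
    using cubic_C_eq[OF N(2)] a0 unfolding assms(4) by (simp only: s_def q_def t_def not_False_eq_True)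
  have "b * (X * deriv (eval_fps hyper_fps) X) + a * eval_fps hyper_fps X =
      2 * theta_a q / cubic_a q + a * (cubic_a q)\<^sup>2"
    using cubic_hypergeometric_derivative[OF t, folded q_def] by (simp only: b X S)
  \<comment> \<open>The contribution - 2 \<theta>a / a of \<open>a\<close> cancels the
    differentiated series; only the term from the weight factor is left.\<close>
  also have "\<dots> = of_real (sqrt 3 / (2 * pi)) / s"
    unfolding a using a0 s0 by (simp add: field_simps power2_eq_square power3_eq_cube)
  also have "\<dots> = complex_of_real (sqrt (3 / real N) * (1 / (2 * pi)))"
    by (simp add: s_def real_sqrt_divide)
  finally show ?thesis
    using hyper_coeff_sums[of X b a] X1 X by (simp add: hyper_coeff_def)
qed

end
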